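(* Let $F(x)=e^{-|x|}$ on $(-1,1)$, let $\mathscr{H}_F$ be the corresponding reproducing kernel Hilbert space, let $\theta\in[0,2\pi)$, and let $\Lambda_\theta\subset\mathbb{R}$ be the spectrum of the selfadjoint operator $A_\theta$ in $\mathscr{H}_F$. Write $e_\lambda(x)=e^{i\lambda x}$. Then $$\left\{\sqrt{\tfrac{2}{\lambda^{2}+3}}\;e_\lambda\ :\ \lambda\in\Lambda_\theta\right\}$$ is an orthonormal basis of $\mathscr{H}_F$.
   Context: Inner products are conjugate-linear in the first variable. $\mathscr{H}_F$ is the reproducing kernel Hilbert space of functions on $(0,1)$ (all of which extend continuously to $[0,1]$): the completion of the span of $\{F(\cdot-x):x\in(0,1)\}$ with respect to $\langle F(\cdot-x),F(\cdot-y)\rangle_{\mathscr{H}_F}=F(x-y)$; it satisfies $\langle F(\cdot-x),\xi\rangle_{\mathscr{H}_F}=\xi(x)$. For $\varphi\in C_c^\infty(0,1)$ put $F_\varphi(x)=\int_0^1\varphi(y)F(x-y)\,dy$. $D_F$ is the densely defined skew-Hermitian operator in $\mathscr{H}_F$ with domain $\{F_\varphi:\varphi\in C_c^\infty(0,1)\}$ and $D_F(F_\varphi)=F_{\varphi'}$; $\overline{D_F}$ is its closure. For $\theta\in[0,2\pi)$, $A_\theta$ is the selfadjoint extension of $-iD_F$ with $$\mathrm{dom}(A_\theta)=\{h+c(e^{-x}+e^{i\theta}e^{x-1}): h\in\mathrm{dom}(\overline{D_F}),\ c\in\mathbb{C}\},$$ $$A_\theta\big(h+c(e^{-x}+e^{i\theta}e^{x-1})\big)=-ih'+ic(e^{-x}-e^{i\theta}e^{x-1}).$$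 *)

theory Defs
  imports
    "HOL-Analysis.Analysis"
    "HOL-Library.Function_Algebras"
    "HOL-Library.Poly_Mapping"
begin

text \<open>
  A complex-valued function on the interval (0,1) is encoded as a function
  \<^typ>\<open>real \<Rightarrow> complex\<close> that vanishes outside the interval; the vector space operations are the
  pointwise ones. Inner products are conjugate-linear in the first variable.
\<close>

definition on01 :: "(real \<Rightarrow> complex) \<Rightarrow> real \<Rightarrow> complex" where
  "on01 f = (\<lambda>x. if x \<in> {0<..<1} then f x else 0)"

definition cscale :: "complex \<Rightarrow> (real \<Rightarrow> complex) \<Rightarrow> real \<Rightarrow> complex" where
  "cscale c f = (\<lambda>x. c * f x)"

lemma vector_space_cscale: "vector_space cscale"
  by unfold_locales (auto simp: cscale_def plus_fun_def algebra_simps)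


section \<open>The reproducing kernel Hilbert space of a kernel F(x - y) on (0,1)\<close>

text \<open>
  A finitely supported coefficient family c stands for the finite linear combination of the
  translates of F with coefficients c y, y in (0,1). On such combinations the sesquilinear form
  is determined by requiring that the product of the translates by x and y is F(x - y).
\<close>

definition kernel_form ::
  "(real \<Rightarrow> complex) \<Rightarrow> (real \<Rightarrow>\<^sub>0 complex) \<Rightarrow> (real \<Rightarrow>\<^sub>0 complex) \<Rightarrow> complex" where
  "kernel_form F c d =
     (\<Sum>x\<in>Poly_Mapping.keys c. \<Sum>y\<in>Poly_Mapping.keys d.
        cnj (Poly_Mapping.lookup c x) * Poly_Mapping.lookup d y * F (x - y))"

definition kernel_comb :: "(real \<Rightarrow> complex) \<Rightarrow> (real \<Rightarrow>\<^sub>0 complex) \<Rightarrow> real \<Rightarrow> complex" where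
  "kernel_comb F c =
     on01 (\<lambda>x. \<Sum>y\<in>Poly_Mapping.keys c. Poly_Mapping.lookup c y * F (x - y))"

text \<open>
  The completion is realised inside the functions on (0,1): the point represented by a sequence
  that is Cauchy for the form is its pointwise limit. For a positive definite F this
  representation is faithful, and the inner product of two limits is the limit of the inner
  products, whichever representing sequences are taken.
\<close>

definition represents ::
  "(real \<Rightarrow> complex) \<Rightarrow> (nat \<Rightarrow> real \<Rightarrow>\<^sub>0 complex) \<Rightarrow> (real \<Rightarrow> complex) \<Rightarrow> bool" where
  "represents F c f \<longleftrightarrow>
     (\<forall>n. Poly_Mapping.keys (c n) \<subseteq> {0<..<1}) \<and>
     (\<forall>e>0. \<exists>N. \<forall>m\<ge>N. \<forall>n\<ge>N. sqrt (Re (kernel_form F (c m - c n) (c m - c n))) < e) \<and>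
     (\<forall>x. (\<lambda>n. kernel_comb F (c n) x) \<longlonglongrightarrow> f x)"

definition rkhs :: "(real \<Rightarrow> complex) \<Rightarrow> (real \<Rightarrow> complex) set" where
  "rkhs F = {f. \<exists>c. represents F c f}"

definition rkhs_inner ::
  "(real \<Rightarrow> complex) \<Rightarrow> (real \<Rightarrow> complex) \<Rightarrow> (real \<Rightarrow> complex) \<Rightarrow> complex" where
  "rkhs_inner F f g =
     (THE z. \<forall>c d. represents F c f \<longrightarrow> represents F d g \<longrightarrow>
        (\<lambda>n. kernel_form F (c n) (d n)) \<longlonglongrightarrow> z)"


section \<open>Hilbert space notions for a space H with inner product ip\<close>

definition ip_norm ::
  "((real \<Rightarrow> complex) \<Rightarrow> (real \<Rightarrow> complex) \<Rightarrow> complex) \<Rightarrow> (real \<Rightarrow> complex) \<Rightarrow> real" where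
  "ip_norm ip f = sqrt (Re (ip f f))"

definition orthonormal_basis ::
  "(real \<Rightarrow> complex) set \<Rightarrow> ((real \<Rightarrow> complex) \<Rightarrow> (real \<Rightarrow> complex) \<Rightarrow> complex) \<Rightarrow>
   (real \<Rightarrow> complex) set \<Rightarrow> bool" where
  "orthonormal_basis H ip B \<longleftrightarrow>
     B \<subseteq> H \<and>
     (\<forall>u\<in>B. \<forall>v\<in>B. ip u v = (if u = v then 1 else 0)) \<and>
     (\<forall>f\<in>H. \<forall>e>0. \<exists>s \<in> module.span cscale B. ip_norm ip (f - s) < e)"

text \<open>
  A linear operator in H is given by its graph.
\<close>

type_synonym op_graph = "((real \<Rightarrow> complex) \<times> (real \<Rightarrow> complex)) set"

definition op_closure ::
  "(real \<Rightarrow> complex) set \<Rightarrow> ((real \<Rightarrow> complex) \<Rightarrow> (real \<Rightarrow> complex) \<Rightarrow> complex) \<Rightarrow>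
   op_graph \<Rightarrow> op_graph" where
  "op_closure H ip G =
     {(u, v). u \<in> H \<and> v \<in> H \<and>
        (\<exists>s t. (\<forall>n. (s n, t n) \<in> G) \<and>
           (\<lambda>n. ip_norm ip (s n - u)) \<longlonglongrightarrow> 0 \<and> (\<lambda>n. ip_norm ip (t n - v)) \<longlonglongrightarrow> 0)}"

definition resolvent_set ::
  "(real \<Rightarrow> complex) set \<Rightarrow> ((real \<Rightarrow> complex) \<Rightarrow> (real \<Rightarrow> complex) \<Rightarrow> complex) \<Rightarrow>
   op_graph \<Rightarrow> complex set" where
  "resolvent_set H ip A =
     {z. bij_betw (\<lambda>(u, v). v - cscale z u) A H \<and>
         (\<exists>C. \<forall>(u, v)\<in>A. ip_norm ip u \<le> C * ip_norm ip (v - cscale z u))}"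

definition op_spectrum ::
  "(real \<Rightarrow> complex) set \<Rightarrow> ((real \<Rightarrow> complex) \<Rightarrow> (real \<Rightarrow> complex) \<Rightarrow> complex) \<Rightarrow>
   op_graph \<Rightarrow> complex set" where
  "op_spectrum H ip A = - resolvent_set H ip A"


section \<open>The operators D_F and A_theta\<close>

definition smooth :: "(real \<Rightarrow> complex) \<Rightarrow> bool" where
  "smooth f \<longleftrightarrow>
     (\<exists>D. D 0 = f \<and> (\<forall>n x. (D n has_vector_derivative D (Suc n) x) (at x)))"

definition test_function :: "(real \<Rightarrow> complex) \<Rightarrow> bool" where
  "test_function \<phi> \<longleftrightarrow>
     smooth \<phi> \<and> compact (closure {x. \<phi> x \<noteq> 0}) \<and> closure {x. \<phi> x \<noteq> 0} \<subseteq> {0<..<1}"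

definition F_conv :: "(real \<Rightarrow> complex) \<Rightarrow> (real \<Rightarrow> complex) \<Rightarrow> real \<Rightarrow> complex" where
  "F_conv F \<phi> = on01 (\<lambda>x. integral {0..1} (\<lambda>y. \<phi> y * F (x - y)))"

definition D_op :: "(real \<Rightarrow> complex) \<Rightarrow> op_graph" where
  "D_op F =
     {(F_conv F \<phi>, F_conv F (\<lambda>x. vector_derivative \<phi> (at x))) | \<phi>. test_function \<phi>}"

definition exp_kernel :: "real \<Rightarrow> complex" where
  "exp_kernel x = complex_of_real (exp (- \<bar>x\<bar>))"

text \<open>
  In the following definition k is the image of h under the closure of \<^term>\<open>D_op exp_kernel\<close>,
  that is, the derivative of h.
\<close>

definition A_op :: "real \<Rightarrow> op_graph" where
  "A_op \<theta> =
     {(h + cscale c (on01 (\<lambda>x. exp (- of_real x) + cis \<theta> * exp (of_real x - 1))),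
       cscale (- \<i>) k + cscale (\<i> * c) (on01 (\<lambda>x. exp (- of_real x) - cis \<theta> * exp (of_real x - 1))))
      | h k c. (h, k) \<in> op_closure (rkhs exp_kernel) (rkhs_inner exp_kernel) (D_op exp_kernel)}"

definition e_fun :: "real \<Rightarrow> real \<Rightarrow> complex" where
  "e_fun l = on01 (\<lambda>x. exp (\<i> * of_real l * of_real x))"

end

theory Submission
  imports Defs "HOL-Real_Asymp.Real_Asymp"
begin

text \<open>
The span of the functions \<open>exp (i l x)\<close> is handled through one number. All these functions have
modulus 1, so for a finite set of orthonormal multiples \<open>sqrt (2 / (l^2 + 3)) exp (i l x)\<close> the
squared distance from a translate \<open>K x\<close> of the kernel to their span is
\<open>1 - (\<Sum>l. 2 / (l^2 + 3))\<close>, whatever \<open>x\<close> is. As the translates are total, completeness of the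
system amounts to the identity \<open>(\<Sum>l. 2 / (l^2 + 3)) = 1\<close>.

The relevant \<open>l\<close> are the real solutions of \<open>cis l * (1 + i l) = cis \<theta> * (1 - i l)\<close>. This is the
boundary condition of the operator, which acts as \<open>-i d/dx\<close>; comparing arguments, it says that
\<open>l + 2 arctan l\<close> lies in \<open>\<theta> + 2 \<pi> \<int>\<close>. Let \<open>\<Lambda>\<close> be the inverse of the increasing function
\<open>l + 2 arctan l\<close>, and let \<open>w t = 2 / (\<Lambda> t ^ 2 + 3)\<close>. Then the identity concerns
the sum of \<open>w (\<theta> + 2 \<pi> n)\<close> over all integers \<open>n\<close>, and it holds for three reasons
(theorem \<open>weight_sum_tendsto_one\<close>). First, this sum is at most 1 for every \<open>\<theta>\<close>, by Bessel's
inequality applied to one function \<open>K x\<close>. Second, its integral over a period is the integral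
of \<open>w\<close> over the line, which is \<open>2 \<pi>\<close> because \<open>w\<close> is the derivative of \<open>2 arctan \<circ> \<Lambda>\<close>.
Third, the sum varies slowly, since \<open>w' \<le> w\<close>, so it cannot drop below its mean value 1.

Orthogonality needs no integrals: the eigenvectors pair symmetrically with the operator
(\<open>A_op_symmetric_on_e_fun\<close>), and eigenvalues are real by construction. That the functions are
eigenvectors requires to show that certain functions belong to the domain of the closure of \<open>D_F\<close>
(\<open>smooth_in_D_closure\<close>); the convergence there comes from the identity
\<open>norm (F_f')^2 + norm (F_f)^2 = 2 \<integral> |f|^2\<close> of \<open>norm_conv_deriv\<close>, which turns convergence in
mean square of the test functions into convergence in the Hilbert space.

Finally, completeness determines the whole spectrum (\<open>spectrum_of_eigenbasis\<close>). For \<open>z\<close> off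
the closed set of eigenvalues, Parseval's identity bounds \<open>A - z\<close> from below; its range is then
closed, and it contains all eigenvectors, hence it is everything.
\<close>

section \<open>Inner product spaces on a carrier set\<close>

text \<open>
The Hilbert spaces of this development are sets of functions, and their inner products are not
those of a type class, so the elementary theory is developed relative to a carrier. The form
may be degenerate, because the theory is also applied to the coefficient families of a kernel,
some of which may represent the zero function.
\<close>

locale prehilbert = vector_space scl
  for scl :: "complex \<Rightarrow> 'v::ab_group_add \<Rightarrow> 'v" +
  fixes V :: "'v set" and ip :: "'v \<Rightarrow> 'v \<Rightarrow> complex"
  assumes subspace_V: "subspace V"
    and ip_add_right: "\<lbrakk>x \<in> V; y \<in> V; z \<in> V\<rbrakk> \<Longrightarrow> ip x (y + z) = ip x y + ip x z"
    and ip_scale_right: "\<lbrakk>x \<in> V; y \<in> V\<rbrakk> \<Longrightarrow> ip x (scl a y) = a * ip x y"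
    and ip_cnj: "\<lbrakk>x \<in> V; y \<in> V\<rbrakk> \<Longrightarrow> ip y x = cnj (ip x y)"
    and ip_nonneg: "x \<in> V \<Longrightarrow> 0 \<le> Re (ip x x)"
begin

definition nrm :: "'v \<Rightarrow> real" where
  "nrm x = sqrt (Re (ip x x))"

definition cauchy_seq :: "(nat \<Rightarrow> 'v) \<Rightarrow> bool" where
  "cauchy_seq s \<longleftrightarrow> (\<forall>e>0. \<exists>N. \<forall>m\<ge>N. \<forall>n\<ge>N. nrm (s m - s n) < e)"

abbreviation tends_to :: "(nat \<Rightarrow> 'v) \<Rightarrow> 'v \<Rightarrow> bool" where
  "tends_to s l \<equiv> (\<lambda>n. nrm (s n - l)) \<longlonglongrightarrow> 0"

lemma V_simps [simp, intro]:
  "0 \<in> V" "x \<in> V \<Longrightarrow> y \<in> V \<Longrightarrow> x + y \<in> V" "x \<in> V \<Longrightarrow> y \<in> V \<Longrightarrow> x - y \<in> V"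
  "x \<in> V \<Longrightarrow> - x \<in> V" "x \<in> V \<Longrightarrow> scl a x \<in> V"
  using subspace_V by (auto intro: subspace_0 subspace_add subspace_diff subspace_neg subspace_scale)

lemma V_sum [simp, intro]: "(\<And>i. i \<in> I \<Longrightarrow> f i \<in> V) \<Longrightarrow> sum f I \<in> V"
  using subspace_V by (rule subspace_sum)

lemma ip_add_left: "\<lbrakk>x \<in> V; y \<in> V; z \<in> V\<rbrakk> \<Longrightarrow> ip (x + y) z = ip x z + ip y z"
  using ip_cnj[of z "x + y"] ip_cnj[of z x] ip_cnj[of z y] by (simp add: ip_add_right)

lemma ip_scale_left: "\<lbrakk>x \<in> V; y \<in> V\<rbrakk> \<Longrightarrow> ip (scl a x) y = cnj a * ip x y"
  using ip_cnj[of y "scl a x"] ip_cnj[of y x] by (simp add: ip_scale_right)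

lemma ip_minus_right: "\<lbrakk>x \<in> V; y \<in> V\<rbrakk> \<Longrightarrow> ip x (- y) = - ip x y"
  using ip_scale_right[of x y "-1"] by simp

lemma ip_minus_left: "\<lbrakk>x \<in> V; y \<in> V\<rbrakk> \<Longrightarrow> ip (- x) y = - ip x y"
  using ip_scale_left[of x y "-1"] by simp

lemma ip_diff_right: "\<lbrakk>x \<in> V; y \<in> V; z \<in> V\<rbrakk> \<Longrightarrow> ip x (y - z) = ip x y - ip x z"
  using ip_add_right[of x y "- z"] by (simp add: ip_minus_right)

lemma ip_diff_left: "\<lbrakk>x \<in> V; y \<in> V; z \<in> V\<rbrakk> \<Longrightarrow> ip (x - y) z = ip x z - ip y z"
  using ip_add_left[of x "- y" z] by (simp add: ip_minus_left)

lemma ip_zero [simp]: "x \<in> V \<Longrightarrow> ip x 0 = 0" "x \<in> V \<Longrightarrow> ip 0 x = 0"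
  using ip_scale_right[of x 0 0] ip_scale_left[of 0 x 0] by auto

lemma ip_sum_right: "x \<in> V \<Longrightarrow> (\<And>i. i \<in> I \<Longrightarrow> f i \<in> V) \<Longrightarrow> ip x (sum f I) = (\<Sum>i\<in>I. ip x (f i))"
  by (induction I rule: infinite_finite_induct) (auto simp: ip_add_right)

lemma ip_sum_left: "x \<in> V \<Longrightarrow> (\<And>i. i \<in> I \<Longrightarrow> f i \<in> V) \<Longrightarrow> ip (sum f I) x = (\<Sum>i\<in>I. ip (f i) x)"
  by (induction I rule: infinite_finite_induct) (auto simp: ip_add_left)

lemmas ip_simps = ip_add_left ip_add_right ip_diff_left ip_diff_right ip_scale_left ip_scale_right
  ip_minus_left ip_minus_right

lemma nrm_ge_0 [simp]: "x \<in> V \<Longrightarrow> 0 \<le> nrm x"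
  by (simp add: nrm_def ip_nonneg)

lemma nrm_sq: "x \<in> V \<Longrightarrow> (nrm x)\<^sup>2 = Re (ip x x)"
  by (simp add: nrm_def ip_nonneg)

lemma ip_self: "x \<in> V \<Longrightarrow> ip x x = complex_of_real ((nrm x)\<^sup>2)"
  using ip_cnj[of x x] by (auto simp: nrm_sq complex_eq_iff)

lemma nrm_add_sq:
  assumes "x \<in> V" "y \<in> V"
  shows "(nrm (x + y))\<^sup>2 = (nrm x)\<^sup>2 + (nrm y)\<^sup>2 + 2 * Re (ip x y)"
  using assms ip_cnj[OF assms] by (simp add: nrm_sq ip_simps)

lemma nrm_scale: "x \<in> V \<Longrightarrow> nrm (scl a x) = cmod a * nrm x"
proof -
  assume x: "x \<in> V"
  have "cnj a * (a * ip x x) = of_real ((cmod a * nrm x)\<^sup>2)"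
    unfolding ip_self[OF x] by (simp add: power_mult_distrib mult_ac flip: complex_norm_square)
  then have "ip (scl a x) (scl a x) = of_real ((cmod a * nrm x)\<^sup>2)"
    using x by (simp only: ip_scale_left ip_scale_right V_simps mult.left_commute[of a])
  then show ?thesis
    using x by (simp only: nrm_def[of "scl a x"] Re_complex_of_real) simp
qed

lemma nrm_minus: "x \<in> V \<Longrightarrow> nrm (- x) = nrm x"
  using nrm_scale[of x "-1"] by simp

lemma nrm_zero [simp]: "nrm 0 = 0"
  by (simp add: nrm_def)

lemma nrm_diff_commute: "x \<in> V \<Longrightarrow> y \<in> V \<Longrightarrow> nrm (x - y) = nrm (y - x)"
  using nrm_minus[of "x - y"] by simp

lemma Cauchy_Schwarz:
  assumes x: "x \<in> V" and y: "y \<in> V"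
  shows "cmod (ip x y) \<le> nrm x * nrm y"
proof -
  define a where "a = ip x y"
  have q: "0 \<le> (nrm x)\<^sup>2 + (s * cmod a)\<^sup>2 * (nrm y)\<^sup>2 - 2 * s * (cmod a)\<^sup>2" for s :: real
  proof -
    define t where "t = - (of_real s * cnj a)"
    have "(nrm (x + scl t y))\<^sup>2 = (nrm x)\<^sup>2 + (cmod t * nrm y)\<^sup>2 + 2 * Re (t * a)"
      using x y by (simp add: nrm_add_sq nrm_scale ip_scale_right a_def)
    moreover have "cmod t = \<bar>s\<bar> * cmod a"
      by (simp add: t_def norm_mult)
    moreover have "Re (t * a) = - (s * (cmod a)\<^sup>2)"
      by (simp add: t_def cmod_power2) (simp add: power2_eq_square algebra_simps)
    moreover have "0 \<le> (nrm (x + scl t y))\<^sup>2" by (rule zero_le_power2)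
    ultimately show ?thesis by (simp add: power_mult_distrib)
  qed
  have "(cmod a)\<^sup>2 \<le> (nrm x)\<^sup>2 * (nrm y)\<^sup>2"
  proof (cases "nrm y = 0")
    case True
    show ?thesis
    proof (rule ccontr)
      assume "\<not> ?thesis"
      then have "(cmod a)\<^sup>2 > 0" using True by auto
      then show False
        using q[of "((nrm x)\<^sup>2 + 1) / (2 * (cmod a)\<^sup>2)"] True by (simp add: field_simps)
    qed
  next
    case False
    then have p: "(nrm y)\<^sup>2 > 0" by simp
    have "(1 / (nrm y)\<^sup>2 * cmod a)\<^sup>2 * (nrm y)\<^sup>2 = (cmod a)\<^sup>2 / (nrm y)\<^sup>2"
      using p by (simp add: field_simps power2_eq_square)
    then have "(cmod a)\<^sup>2 / (nrm y)\<^sup>2 \<le> (nrm x)\<^sup>2"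
      using q[of "1 / (nrm y)\<^sup>2"] by simp
    then show ?thesis using p by (simp add: field_simps)
  qed
  then show ?thesis
    using x y by (intro power2_le_imp_le[of "cmod (ip x y)"]) (simp_all add: a_def power_mult_distrib)
qed

lemma nrm_triangle:
  assumes "x \<in> V" "y \<in> V"
  shows "nrm (x + y) \<le> nrm x + nrm y"
proof (rule power2_le_imp_le)
  have "Re (ip x y) \<le> nrm x * nrm y"
    using Cauchy_Schwarz[OF assms] complex_Re_le_cmod order_trans by blast
  then show "(nrm (x + y))\<^sup>2 \<le> (nrm x + nrm y)\<^sup>2"
    using assms by (simp add: nrm_add_sq power2_sum)
qed (use assms in auto)

lemma nrm_triangle_diff:
  "\<lbrakk>x \<in> V; y \<in> V; z \<in> V\<rbrakk> \<Longrightarrow> nrm (x - z) \<le> nrm (x - y) + nrm (y - z)"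
  using nrm_triangle[of "x - y" "y - z"] by simp

lemma nrm_tendsto:
  assumes "\<And>n. s n \<in> V" "l \<in> V" "tends_to s l"
  shows "(\<lambda>n. nrm (s n)) \<longlonglongrightarrow> nrm l"
proof -
  have "\<bar>nrm (s n) - nrm l\<bar> \<le> nrm (s n - l)" for n
  proof -
    have "nrm (s n) \<le> nrm (s n - l) + nrm l" "nrm l \<le> nrm (l - s n) + nrm (s n)"
      using nrm_triangle[of "s n - l" l] nrm_triangle[of "l - s n" "s n"] assms(1,2) by simp_all
    then show ?thesis using nrm_diff_commute[OF assms(1)[of n] assms(2)] by linarith
  qed
  then have "(\<lambda>n. nrm (s n) - nrm l) \<longlonglongrightarrow> 0"
    by (intro Lim_null_comparison[OF _ assms(3)]) auto
  then show ?thesis by (simp add: LIM_zero_iff)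
qed

lemma ip_diff_bound:
  assumes "x \<in> V" "y \<in> V" "x' \<in> V" "y' \<in> V"
  shows "cmod (ip x y - ip x' y') \<le> nrm x * nrm (y - y') + nrm (x - x') * nrm y'"
proof -
  have "ip x y - ip x' y' = ip x (y - y') + ip (x - x') y'"
    using assms by (simp add: ip_simps)
  then show ?thesis
    using Cauchy_Schwarz[of x "y - y'"] Cauchy_Schwarz[of "x - x'" y'] assms
    by (metis V_simps(3) add_mono norm_triangle_mono)
qed

lemma cauchy_bounded:
  assumes "cauchy_seq s" "\<And>n. s n \<in> V"
  obtains M where "M > 0" "\<And>n. nrm (s n) \<le> M"
proof -
  obtain N where N: "\<And>m n. m \<ge> N \<Longrightarrow> n \<ge> N \<Longrightarrow> nrm (s m - s n) < 1"
    using assms(1) unfolding cauchy_seq_def by (metis zero_less_one)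
  define M where "M = 1 + (\<Sum>n\<le>N. nrm (s n))"
  have le: "nrm (s n) \<le> (\<Sum>n\<le>N. nrm (s n))" if "n \<le> N" for n
    using that assms(2) by (intro member_le_sum) auto
  have "nrm (s n) \<le> M" for n
  proof (cases "n \<le> N")
    case True
    then show ?thesis using le[of n] by (simp add: M_def)
  next
    case False
    have "nrm (s n) \<le> nrm (s n - s N) + nrm (s N)"
      using nrm_triangle[of "s n - s N" "s N"] assms(2) by simp
    then show ?thesis using N[of n N] le[of N] False by (simp add: M_def)
  qed
  moreover have "M > 0" unfolding M_def using assms(2) by (simp add: add_pos_nonneg sum_nonneg)
  ultimately show ?thesis using that by blast
qed

lemma convergent_imp_cauchy:
  assumes "\<And>n. s n \<in> V" "l \<in> V" "tends_to s l"
  shows "cauchy_seq s"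
  unfolding cauchy_seq_def
proof (intro allI impI)
  fix e :: real assume "e > 0"
  then obtain N where N: "\<And>n. n \<ge> N \<Longrightarrow> nrm (s n - l) < e / 2"
    using order_tendstoD(2)[OF assms(3), of "e/2"] by (auto simp: eventually_sequentially)
  show "\<exists>N. \<forall>m\<ge>N. \<forall>n\<ge>N. nrm (s m - s n) < e"
  proof (intro exI allI impI)
    fix m n assume "m \<ge> N" "n \<ge> N"
    then show "nrm (s m - s n) < e"
      using N[of m] N[of n] nrm_triangle_diff[of "s m" l "s n"] nrm_diff_commute[of "s n" l] assms(1,2) by simp
  qed
qed

lemma cauchy_add_scale:
  assumes c: "cauchy_seq c" "\<And>n. c n \<in> V" and d: "cauchy_seq d" "\<And>n. d n \<in> V"
  shows "cauchy_seq (\<lambda>n. c n + scl a (d n))"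
  unfolding cauchy_seq_def
proof (intro allI impI)
  fix e :: real assume "e > 0"
  moreover have a: "cmod a + 1 > 0" by (simp add: add_nonneg_pos)
  ultimately have e: "e / 2 > 0" "e / 2 / (cmod a + 1) > 0" by simp_all
  obtain N where N: "\<And>m n. m \<ge> N \<Longrightarrow> n \<ge> N \<Longrightarrow> nrm (c m - c n) < e / 2"
    using c(1) e(1) unfolding cauchy_seq_def by blast
  obtain N' where N': "\<And>m n. m \<ge> N' \<Longrightarrow> n \<ge> N' \<Longrightarrow> nrm (d m - d n) < e / 2 / (cmod a + 1)"
    using d(1) e(2) unfolding cauchy_seq_def by blast
  show "\<exists>N. \<forall>m\<ge>N. \<forall>n\<ge>N. nrm (c m + scl a (d m) - (c n + scl a (d n))) < e"
  proof (intro exI allI impI)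
    fix m n assume mn: "m \<ge> max N N'" "n \<ge> max N N'"
    have "nrm ((c m - c n) + scl a (d m - d n)) \<le> nrm (c m - c n) + cmod a * nrm (d m - d n)"
      using nrm_triangle[of "c m - c n" "scl a (d m - d n)"] c(2) d(2) by (simp add: nrm_scale)
    moreover have "cmod a * nrm (d m - d n) \<le> (cmod a + 1) * nrm (d m - d n)"
      using d(2) by (intro mult_right_mono) auto
    moreover have "nrm (d m - d n) < e / 2 / (cmod a + 1)" using N'[of m n] mn by simp
    then have "(cmod a + 1) * nrm (d m - d n) < e / 2"
      by (simp only: pos_less_divide_eq[OF a] mult.commute)
    moreover have "nrm (c m - c n) < e / 2" using N[of m n] mn by simp
    ultimately have "nrm ((c m - c n) + scl a (d m - d n)) < e" by linarith
    then show "nrm (c m + scl a (d m) - (c n + scl a (d n))) < e"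
      by (simp add: add_diff_add scale_right_diff_distrib)
  qed
qed

lemma ip_cauchy_convergent:
  assumes s: "cauchy_seq s" "\<And>n. s n \<in> V" and t: "cauchy_seq t" "\<And>n. t n \<in> V"
  shows "convergent (\<lambda>n. ip (s n) (t n))"
proof (rule Cauchy_convergent, rule metric_CauchyI)
  fix e :: real assume e: "e > 0"
  obtain M where M: "M > 0" "\<And>n. nrm (s n) \<le> M" using cauchy_bounded[OF s] by blast
  obtain M' where M': "M' > 0" "\<And>n. nrm (t n) \<le> M'" using cauchy_bounded[OF t] by blast
  obtain N where N: "\<And>m n. m \<ge> N \<Longrightarrow> n \<ge> N \<Longrightarrow> nrm (t m - t n) < e / (2 * M)"
    using t(1) e M(1) unfolding cauchy_seq_def by (metis divide_pos_pos mult_pos_pos zero_less_numeral)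
  obtain N' where N': "\<And>m n. m \<ge> N' \<Longrightarrow> n \<ge> N' \<Longrightarrow> nrm (s m - s n) < e / (2 * M')"
    using s(1) e M'(1) unfolding cauchy_seq_def by (metis divide_pos_pos mult_pos_pos zero_less_numeral)
  show "\<exists>N. \<forall>m\<ge>N. \<forall>n\<ge>N. dist (ip (s m) (t m)) (ip (s n) (t n)) < e"
  proof (intro exI allI impI)
    fix m n assume mn: "m \<ge> max N N'" "n \<ge> max N N'"
    have "nrm (s m) * nrm (t m - t n) \<le> M * nrm (t m - t n)"
      using M s t by (intro mult_right_mono) auto
    also have "\<dots> < M * (e / (2 * M))"
      using N[of m n] mn M by (intro mult_strict_left_mono) auto
    finally have 1: "nrm (s m) * nrm (t m - t n) < e / 2" using M by simp
    have "nrm (s m - s n) * nrm (t n) \<le> nrm (s m - s n) * M'"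
      using M' s t by (intro mult_left_mono) auto
    also have "\<dots> < (e / (2 * M')) * M'"
      using N'[of m n] mn M' by (intro mult_strict_right_mono) auto
    finally have 2: "nrm (s m - s n) * nrm (t n) < e / 2" using M' by simp
    show "dist (ip (s m) (t m)) (ip (s n) (t n)) < e"
      using 1 2 ip_diff_bound[of "s m" "t m" "s n" "t n"] s t by (simp add: dist_norm)
  qed
qed

lemma ip_tendsto:
  assumes s: "\<And>n. s n \<in> V" "l \<in> V" "tends_to s l"
    and t: "\<And>n. t n \<in> V" "k \<in> V" "tends_to t k"
  shows "(\<lambda>n. ip (s n) (t n)) \<longlonglongrightarrow> ip l k"
proof -
  have "(\<lambda>n. nrm (s n) * nrm (t n - k) + nrm (s n - l) * nrm k) \<longlonglongrightarrow> nrm l * 0 + 0 * nrm k"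
    by (intro tendsto_intros nrm_tendsto s t)
  then have "(\<lambda>n. nrm (s n) * nrm (t n - k) + nrm (s n - l) * nrm k) \<longlonglongrightarrow> 0" by simp
  then have "(\<lambda>n. ip (s n) (t n) - ip l k) \<longlonglongrightarrow> 0"
    by (rule Lim_null_comparison[rotated]) (use s t in \<open>auto intro!: always_eventually ip_diff_bound\<close>)
  then show ?thesis by (simp add: LIM_zero_iff)
qed

lemma ip_tendsto_right:
  assumes "x \<in> V" "\<And>n. t n \<in> V" "k \<in> V" "tends_to t k"
  shows "(\<lambda>n. ip x (t n)) \<longlonglongrightarrow> ip x k"
  using ip_tendsto[of "\<lambda>_. x" x t k] assms by simp

lemma nrm_diff_tendsto_0I:
  assumes "\<And>n. s n \<in> V" "l \<in> V" "\<And>n. nrm (s n - l) \<le> b n" "b \<longlonglongrightarrow> 0"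
  shows "tends_to s l"
  by (rule tendsto_sandwich[OF _ _ tendsto_const assms(4)]) (use assms(1-3) in auto)

lemma nrm_add_tendsto:
  assumes "\<And>n. s n \<in> V" "l \<in> V" "tends_to s l"
    and "\<And>n. t n \<in> V" "k \<in> V" "tends_to t k"
  shows "(\<lambda>n. nrm (s n + t n - (l + k))) \<longlonglongrightarrow> 0"
proof (rule nrm_diff_tendsto_0I)
  show "nrm (s n + t n - (l + k)) \<le> nrm (s n - l) + nrm (t n - k)" for n
    using nrm_triangle[of "s n - l" "t n - k"] assms by (simp add: add_diff_add)
  show "(\<lambda>n. nrm (s n - l) + nrm (t n - k)) \<longlonglongrightarrow> 0"
    using tendsto_add[OF assms(3,6)] by simp
qed (use assms in auto)

lemma nrm_scale_tendsto:
  assumes "\<And>n. s n \<in> V" "l \<in> V" "tends_to s l" "a \<longlonglongrightarrow> b"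
  shows "(\<lambda>n. nrm (scl (a n) (s n) - scl b l)) \<longlonglongrightarrow> 0"
proof (rule nrm_diff_tendsto_0I)
  show "nrm (scl (a n) (s n) - scl b l) \<le> cmod (a n) * nrm (s n - l) + cmod (a n - b) * nrm l" for n
  proof -
    have "scl (a n) (s n) - scl b l = scl (a n) (s n - l) + scl (a n - b) l"
      by (simp add: scale_right_diff_distrib scale_left_diff_distrib)
    then show ?thesis
      using nrm_triangle[of "scl (a n) (s n - l)" "scl (a n - b) l"] assms(1,2) by (simp add: nrm_scale)
  qed
  have "(\<lambda>n. cmod (a n) * nrm (s n - l) + cmod (a n - b) * nrm l) \<longlonglongrightarrow> cmod b * 0 + cmod (b - b) * nrm l"
    by (intro tendsto_intros assms)
  then show "(\<lambda>n. cmod (a n) * nrm (s n - l) + cmod (a n - b) * nrm l) \<longlonglongrightarrow> 0" by simp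
qed (use assms in auto)

definition orthonormal :: "'v set \<Rightarrow> bool" where
  "orthonormal T \<longleftrightarrow> T \<subseteq> V \<and> (\<forall>u\<in>T. \<forall>v\<in>T. ip u v = (if u = v then 1 else 0))"

definition proj :: "'v set \<Rightarrow> 'v \<Rightarrow> 'v" where
  "proj T f = (\<Sum>u\<in>T. scl (ip u f) u)"

lemma orthonormal_subset: "orthonormal B \<Longrightarrow> T \<subseteq> B \<Longrightarrow> orthonormal T"
  unfolding orthonormal_def by blast

lemma ip_proj:
  assumes "finite T" "orthonormal T" "u \<in> T" "f \<in> V"
  shows "ip u (proj T f) = ip u f"
proof -
  have "ip u (proj T f) = (\<Sum>v\<in>T. ip v f * ip u v)"
    unfolding proj_def using assms by (subst ip_sum_right) (auto simp: orthonormal_def ip_scale_right subsetD)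
  also have "\<dots> = (\<Sum>v\<in>T. if u = v then ip v f else 0)"
    using assms by (intro sum.cong) (auto simp: orthonormal_def)
  finally show ?thesis using assms by simp
qed

lemma proj_in [simp, intro]: "orthonormal T \<Longrightarrow> proj T f \<in> V"
  unfolding proj_def orthonormal_def by auto

text \<open>
The residual \<open>f - proj T f\<close> is orthogonal to every combination of \<open>T\<close>. Bessel's inequality and
the best approximation property are both instances of the resulting Pythagorean identity.
\<close>

lemma nrm_comb_plus_residual:
  assumes "finite T" "orthonormal T" "f \<in> V"
  shows "(nrm ((\<Sum>u\<in>T. scl (r u) u) + (f - proj T f)))\<^sup>2
    = (nrm (\<Sum>u\<in>T. scl (r u) u))\<^sup>2 + (nrm (f - proj T f))\<^sup>2"
proof -
  have T: "T \<subseteq> V" using assms by (simp add: orthonormal_def)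
  have V: "(\<Sum>u\<in>T. scl (r u) u) \<in> V" "f - proj T f \<in> V" using T assms by auto
  have "ip (\<Sum>u\<in>T. scl (r u) u) (f - proj T f) = (\<Sum>u\<in>T. cnj (r u) * ip u (f - proj T f))"
    using T V ip_sum_left[of "f - proj T f" T "\<lambda>u. scl (r u) u"] by (auto simp: ip_scale_left subsetD)
  also have "\<dots> = 0"
    using T assms by (intro sum.neutral) (auto simp: ip_diff_right ip_proj)
  finally show ?thesis using V by (simp add: nrm_add_sq)
qed

lemma nrm_residual:
  assumes "finite T" "orthonormal T" "f \<in> V"
  shows "(nrm (f - proj T f))\<^sup>2 = (nrm f)\<^sup>2 - (\<Sum>u\<in>T. (cmod (ip u f))\<^sup>2)"
proof -
  have T: "T \<subseteq> V" using assms by (simp add: orthonormal_def)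
  have "ip (proj T f) (proj T f) = (\<Sum>u\<in>T. cnj (ip u f) * ip u (proj T f))"
    using T assms ip_sum_left[of "proj T f" T "\<lambda>u. scl (ip u f) u"]
    by (auto simp: ip_scale_left subsetD proj_def[symmetric])
  also have "\<dots> = (\<Sum>u\<in>T. of_real ((cmod (ip u f))\<^sup>2))"
    using assms by (intro sum.cong) (auto simp: ip_proj complex_norm_square mult_ac simp del: of_real_power)
  finally have "(nrm (proj T f))\<^sup>2 = (\<Sum>u\<in>T. (cmod (ip u f))\<^sup>2)"
    using assms by (simp add: nrm_sq flip: of_real_sum)
  moreover have "(nrm f)\<^sup>2 = (nrm (proj T f))\<^sup>2 + (nrm (f - proj T f))\<^sup>2"
    using nrm_comb_plus_residual[OF assms, of "\<lambda>u. ip u f"] unfolding proj_def[symmetric] by simp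
  ultimately show ?thesis by simp
qed

lemma Bessel:
  assumes "finite T" "orthonormal T" "f \<in> V"
  shows "(\<Sum>u\<in>T. (cmod (ip u f))\<^sup>2) \<le> (nrm f)\<^sup>2"
  using nrm_residual[OF assms] by (metis diff_ge_0_iff_ge zero_le_power2)

lemma best_approximation:
  assumes "finite T" "orthonormal T" "f \<in> V"
  shows "nrm (f - proj T f) \<le> nrm (f - (\<Sum>u\<in>T. scl (r u) u))"
proof (rule power2_le_imp_le)
  have T: "T \<subseteq> V" using assms by (simp add: orthonormal_def)
  have "f - (\<Sum>u\<in>T. scl (r u) u) = (\<Sum>u\<in>T. scl (ip u f - r u) u) + (f - proj T f)"
    by (simp add: proj_def scale_left_diff_distrib sum_subtractf)
  then show "(nrm (f - proj T f))\<^sup>2 \<le> (nrm (f - (\<Sum>u\<in>T. scl (r u) u)))\<^sup>2"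
    using nrm_comb_plus_residual[OF assms, of "\<lambda>u. ip u f - r u"] by (simp only: zero_le_power2 le_add_same_cancel2)
  show "0 \<le> nrm (f - (\<Sum>u\<in>T. scl (r u) u))"
    using T assms by (intro nrm_ge_0 V_simps V_sum) auto
qed

definition closed_span :: "'v set \<Rightarrow> 'v set" where
  "closed_span B = {f \<in> V. \<forall>e>0. \<exists>s\<in>span B. nrm (f - s) < e}"

lemma span_in_V: "B \<subseteq> V \<Longrightarrow> s \<in> span B \<Longrightarrow> s \<in> V"
  using span_minimal[OF _ subspace_V] by blast

lemma closed_span_closed:
  assumes "B \<subseteq> V" "f \<in> V" "\<And>e. e > 0 \<Longrightarrow> \<exists>g\<in>closed_span B. nrm (f - g) < e"
  shows "f \<in> closed_span B"
  unfolding closed_span_def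
proof (intro CollectI conjI allI impI assms)
  fix e :: real assume e: "e > 0"
  obtain g where g: "g \<in> closed_span B" "nrm (f - g) < e / 2" using assms(3)[of "e/2"] e by auto
  obtain s where s: "s \<in> span B" "nrm (g - s) < e / 2"
    using g(1) half_gt_zero[OF e] unfolding closed_span_def by blast
  have "nrm (f - s) \<le> nrm (f - g) + nrm (g - s)"
    using g(1) s(1) assms by (intro nrm_triangle_diff) (auto simp: closed_span_def intro: span_in_V)
  then show "\<exists>s\<in>span B. nrm (f - s) < e" using g s by force
qed

lemma closed_span_iff:
  assumes B: "B \<subseteq> V"
  shows "f \<in> closed_span B \<longleftrightarrow> f \<in> V \<and> (\<exists>s. (\<forall>n. s n \<in> span B) \<and> tends_to s f)"
proof safe
  assume f: "f \<in> closed_span B"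
  then show fV: "f \<in> V" by (simp add: closed_span_def)
  have "\<exists>s\<in>span B. nrm (f - s) < 1 / real (Suc n)" for n
    using f unfolding closed_span_def by simp
  then obtain s where s: "\<And>n. s n \<in> span B" "\<And>n. nrm (f - s n) < 1 / real (Suc n)" by metis
  have sV: "s n \<in> V" for n using s(1) span_in_V[OF B] by blast
  have "tends_to s f"
    by (rule nrm_diff_tendsto_0I[OF sV fV _ lim_inverse_n'[THEN LIMSEQ_Suc]])
      (use less_imp_le[OF s(2)] in \<open>simp only: nrm_diff_commute[OF sV fV]\<close>)
  then show "\<exists>s. (\<forall>n. s n \<in> span B) \<and> tends_to s f" using s(1) by blast
next
  fix s assume f: "f \<in> V" and s: "\<forall>n. s n \<in> span B" "tends_to s f"
  show "f \<in> closed_span B"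
    unfolding closed_span_def
  proof (intro CollectI conjI allI impI f)
    fix e :: real assume "e > 0"
    then obtain n where "nrm (s n - f) < e"
      using order_tendstoD(2)[OF s(2)] by (auto simp: eventually_sequentially)
    then show "\<exists>s\<in>span B. nrm (f - s) < e"
      using s(1) span_in_V[OF B] nrm_diff_commute[OF f] by metis
  qed
qed

lemma subspace_closed_span:
  assumes B: "B \<subseteq> V"
  shows "subspace (closed_span B)"
proof (rule subspaceI)
  show "0 \<in> closed_span B"
    unfolding closed_span_def by (auto intro!: bexI[of _ 0] span_zero)
next
  fix f g assume "f \<in> closed_span B" "g \<in> closed_span B"
  then obtain s t where "f \<in> V" "\<And>n. s n \<in> span B" "tends_to s f"
    and "g \<in> V" "\<And>n. t n \<in> span B" "tends_to t g"
    unfolding closed_span_iff[OF B] by blast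
  then show "f + g \<in> closed_span B"
    unfolding closed_span_iff[OF B] using span_in_V[OF B]
    by (intro conjI exI[of _ "\<lambda>n. s n + t n"]) (auto intro: span_add nrm_add_tendsto)
next
  fix a f assume "f \<in> closed_span B"
  then obtain s where "f \<in> V" "\<And>n. s n \<in> span B" "tends_to s f"
    unfolding closed_span_iff[OF B] by blast
  then show "scl a f \<in> closed_span B"
    unfolding closed_span_iff[OF B] using span_in_V[OF B]
    by (intro conjI exI[of _ "\<lambda>n. scl a (s n)"]) (auto intro: span_scale nrm_scale_tendsto)
qed

text \<open>
Parseval's identity in the form that avoids infinite sums: an element of the closed span is
approximated by some finite combination, and replacing that combination by the projection
onto the same finite set can only improve it.
\<close>

lemma Parseval_approx:
  assumes B: "orthonormal B" and f: "f \<in> closed_span B" and e: "e > 0"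
  obtains T where "finite T" "T \<subseteq> B" "(nrm f)\<^sup>2 < (\<Sum>u\<in>T. (cmod (ip u f))\<^sup>2) + e"
proof -
  obtain s where s: "s \<in> span B" "nrm (f - s) < sqrt e"
    using f real_sqrt_gt_zero[OF e] unfolding closed_span_def by blast
  obtain T r where T: "finite T" "T \<subseteq> B" "s = (\<Sum>u\<in>T. scl (r u) u)"
    using s(1) unfolding span_explicit by blast
  have fV: "f \<in> V" using f by (simp add: closed_span_def)
  have oT: "orthonormal T" using B T orthonormal_subset by blast
  have "nrm (f - proj T f) < sqrt e"
    using best_approximation[OF T(1) oT fV, of r] s T by simp
  then have "(nrm (f - proj T f))\<^sup>2 < (sqrt e)\<^sup>2"
    using fV oT by (intro power_strict_mono) auto
  then show ?thesis
    using that[of T] T nrm_residual[OF T(1) oT fV] e by simp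
qed

end

locale hilbert = prehilbert +
  assumes definite: "x \<in> V \<Longrightarrow> nrm x = 0 \<Longrightarrow> x = 0"
    and complete: "cauchy_seq s \<Longrightarrow> (\<And>n. s n \<in> V) \<Longrightarrow> \<exists>l\<in>V. tends_to s l"
begin

text \<open>
The representing vector is the minimiser of \<open>J x = |x|^2 - 2 Re (\<phi> x)\<close>. The parallelogram law
makes every minimising sequence Cauchy, and vanishing of the first variation of \<open>J\<close> at the limit
is the claim.
\<close>

theorem Riesz_representation:
  assumes add: "\<And>x y. x \<in> V \<Longrightarrow> y \<in> V \<Longrightarrow> \<phi> (x + y) = \<phi> x + \<phi> y"
    and scale: "\<And>a x. x \<in> V \<Longrightarrow> \<phi> (scl a x) = a * \<phi> x"
    and bound: "\<And>x. x \<in> V \<Longrightarrow> cmod (\<phi> x) \<le> C * nrm x"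
  shows "\<exists>r\<in>V. \<forall>x\<in>V. ip r x = \<phi> x"
proof -
  define J where "J x = (nrm x)\<^sup>2 - 2 * Re (\<phi> x)" for x
  have J_lower: "- (C\<^sup>2) \<le> J x" if "x \<in> V" for x
  proof -
    have "Re (\<phi> x) \<le> C * nrm x" by (rule order_trans[OF complex_Re_le_cmod bound[OF that]])
    moreover have "0 \<le> (nrm x - C)\<^sup>2" by (rule zero_le_power2)
    ultimately show ?thesis unfolding J_def power2_diff by (simp only: mult.commute[of C])
  qed
  define m where "m = Inf (J ` V)"
  have bdd: "bdd_below (J ` V)" using J_lower by (rule bdd_belowI2)
  have m_le: "m \<le> J x" if "x \<in> V" for x
    unfolding m_def using bdd that by (intro cInf_lower) auto
  have "\<exists>x\<in>V. J x < m + 1 / real (Suc n)" for n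
    using cInf_lessD[of "J ` V" "m + 1 / real (Suc n)"] V_simps(1) by (auto simp: m_def simp del: V_simps)
  then obtain s where s: "\<And>n. s n \<in> V" "\<And>n. J (s n) < m + 1 / real (Suc n)" by metis
  \<comment> \<open>both the quadratic and the linear part of \<open>J\<close> enter: the linear parts cancel between the three values\<close>
  have par: "(nrm (x - y))\<^sup>2 = 2 * J x + 2 * J y - 4 * J (scl (1/2) (x + y))" if "x \<in> V" "y \<in> V" for x y
  proof -
    have "(nrm (x - y))\<^sup>2 = (nrm x)\<^sup>2 + (nrm y)\<^sup>2 - 2 * Re (ip x y)"
      using that nrm_add_sq[of x "- y"] by (simp add: nrm_minus ip_minus_right)
    moreover have "(nrm (scl (1/2) (x + y)))\<^sup>2 = ((nrm x)\<^sup>2 + (nrm y)\<^sup>2 + 2 * Re (ip x y)) / 4"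
      using that by (simp add: nrm_scale power_divide nrm_add_sq)
    moreover have "\<phi> (scl (1/2) (x + y)) = (\<phi> x + \<phi> y) / 2"
      using that by (simp add: scale add)
    then have "Re (\<phi> (scl (1/2) (x + y))) = (Re (\<phi> x) + Re (\<phi> y)) / 2"
      by (simp only:) simp
    ultimately show ?thesis
      unfolding J_def by (simp only:) (simp add: field_simps)
  qed
  have "cauchy_seq s"
    unfolding cauchy_seq_def
  proof (intro allI impI)
    fix e :: real assume e: "e > 0"
    obtain N where N: "4 / real (Suc N) < e\<^sup>2"
      using e reals_Archimedean[of "e\<^sup>2 / 4"] by (auto simp: field_simps)
    show "\<exists>N. \<forall>m\<ge>N. \<forall>n\<ge>N. nrm (s m - s n) < e"
    proof (intro exI allI impI)
      fix i j assume ij: "i \<ge> N" "j \<ge> N"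
      have "(nrm (s i - s j))\<^sup>2 \<le> 2 * J (s i) + 2 * J (s j) - 4 * m"
        using par[of "s i" "s j"] m_le[of "scl (1/2) (s i + s j)"] s by simp
      also have "\<dots> < 2 / real (Suc i) + 2 / real (Suc j)"
        using s(2)[of i] s(2)[of j] by simp
      also have "\<dots> \<le> 2 / real (Suc N) + 2 / real (Suc N)"
        using ij by (intro add_mono divide_left_mono) auto
      also have "\<dots> < e\<^sup>2" using N by simp
      finally show "nrm (s i - s j) < e" using e by (simp add: power_less_imp_less_base)
    qed
  qed
  then obtain r where r: "r \<in> V" "tends_to s r" using complete[of s] s by blast
  have "(\<lambda>n. \<phi> (s n) - \<phi> r) \<longlonglongrightarrow> 0"
  proof (rule Lim_null_comparison)
    have "\<phi> (s n) - \<phi> r = \<phi> (s n - r)" for n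
      using add[of "s n - r" r] s r by simp
    then show "\<forall>\<^sub>F n in sequentially. cmod (\<phi> (s n) - \<phi> r) \<le> C * nrm (s n - r)"
      using bound s r by (auto intro!: always_eventually)
    show "(\<lambda>n. C * nrm (s n - r)) \<longlonglongrightarrow> 0" using r by (auto intro: tendsto_mult_right_zero)
  qed
  then have "(\<lambda>n. \<phi> (s n)) \<longlonglongrightarrow> \<phi> r" by (simp add: LIM_zero_iff)
  then have "(\<lambda>n. J (s n)) \<longlonglongrightarrow> J r"
    unfolding J_def using s r by (intro tendsto_intros nrm_tendsto) auto
  moreover have "(\<lambda>n. m + 1 / real (Suc n)) \<longlonglongrightarrow> m"
    using tendsto_add[OF tendsto_const lim_inverse_n'[THEN LIMSEQ_Suc], of m] by simp
  ultimately have "J r \<le> m"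
    using s(2) by (intro LIMSEQ_le[of "\<lambda>n. J (s n)"]) (auto intro: less_imp_le)
  have "ip r x = \<phi> x" if x: "x \<in> V" for x
  proof -
    define d where "d = ip r x - \<phi> x"
    \<comment> \<open>compare \<open>J\<close> at \<open>r\<close> and at \<open>r - t (cnj d) x\<close>, a step in the direction of steepest descent\<close>
    have q: "0 \<le> t\<^sup>2 * (cmod d)\<^sup>2 * (nrm x)\<^sup>2 - 2 * t * (cmod d)\<^sup>2" for t :: real
    proof -
      define a where "a = - (of_real t * cnj d)"
      have "J (r + scl a x) = J r + (cmod a * nrm x)\<^sup>2 + 2 * Re (a * d)"
        using r x by (simp add: J_def nrm_add_sq nrm_scale add scale ip_scale_right d_def algebra_simps)
      moreover have "J (r + scl a x) \<ge> J r" using \<open>J r \<le> m\<close> m_le[of "r + scl a x"] r x by simp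
      moreover have "cmod a = \<bar>t\<bar> * cmod d" by (simp add: a_def norm_mult)
      moreover have "Re (a * d) = - (t * (cmod d)\<^sup>2)"
        by (simp add: a_def cmod_power2) (simp add: power2_eq_square algebra_simps)
      ultimately show ?thesis by (simp add: power_mult_distrib)
    qed
    have "d = 0"
    proof (rule ccontr)
      assume "d \<noteq> 0"
      define t where "t = 1 / ((nrm x)\<^sup>2 + 1)"
      have "0 < (nrm x)\<^sup>2 + 1" by (simp add: add_nonneg_pos)
      then have t: "t > 0" "t * (nrm x)\<^sup>2 \<le> 1" by (simp_all add: t_def)
      have "t\<^sup>2 * (cmod d)\<^sup>2 * (nrm x)\<^sup>2 - 2 * t * (cmod d)\<^sup>2 = t * (cmod d)\<^sup>2 * (t * (nrm x)\<^sup>2 - 2)"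
        by (simp add: power2_eq_square algebra_simps)
      moreover have "\<dots> < 0" using t \<open>d \<noteq> 0\<close> by (intro mult_pos_neg) auto
      ultimately show False using q[of t] by simp
    qed
    then show ?thesis by (simp add: d_def)
  qed
  then show ?thesis using r by blast
qed

end

section \<open>Closures and spectra of operator graphs\<close>

locale function_hilbert = hilbert cscale V ip
  for V :: "(real \<Rightarrow> complex) set" and ip :: "(real \<Rightarrow> complex) \<Rightarrow> (real \<Rightarrow> complex) \<Rightarrow> complex"
begin

lemma ip_norm_eq_nrm: "ip_norm ip = nrm"
  by (simp add: fun_eq_iff ip_norm_def nrm_def)

lemma orthonormal_basis_iff:
  "orthonormal_basis V ip B \<longleftrightarrow> orthonormal B \<and> V \<subseteq> closed_span B"
  unfolding orthonormal_basis_def orthonormal_def closed_span_def ip_norm_eq_nrm by blast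

lemma op_closureI:
  assumes "u \<in> V" "v \<in> V" "\<And>n. (s n, t n) \<in> G" "tends_to s u" "tends_to t v"
  shows "(u, v) \<in> op_closure V ip G"
  unfolding op_closure_def ip_norm_eq_nrm using assms by auto

lemma op_closureE:
  assumes "(u, v) \<in> op_closure V ip G" "G \<subseteq> V \<times> V"
  obtains s t where "u \<in> V" "v \<in> V" "\<And>n. (s n, t n) \<in> G" "\<And>n. s n \<in> V" "\<And>n. t n \<in> V"
    "tends_to s u" "tends_to t v"
proof -
  obtain s t where st: "u \<in> V" "v \<in> V" "\<And>n. (s n, t n) \<in> G"
    "tends_to s u" "tends_to t v"
    using assms(1) unfolding op_closure_def ip_norm_eq_nrm by auto
  moreover have "s n \<in> V" "t n \<in> V" for n using st(3)[of n] assms(2) by auto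
  ultimately show ?thesis using that by blast
qed

lemma op_closure_add:
  assumes G: "G \<subseteq> V \<times> V"
    and add: "\<And>u v u' v'. (u, v) \<in> G \<Longrightarrow> (u', v') \<in> G \<Longrightarrow> (u + u', v + v') \<in> G"
    and "(u, v) \<in> op_closure V ip G" "(u', v') \<in> op_closure V ip G"
  shows "(u + u', v + v') \<in> op_closure V ip G"
proof -
  obtain s t where st: "u \<in> V" "v \<in> V" "\<And>n. (s n, t n) \<in> G" "\<And>n. s n \<in> V" "\<And>n. t n \<in> V"
    "tends_to s u" "tends_to t v"
    using assms(3) G by (rule op_closureE) blast
  obtain s' t' where st': "u' \<in> V" "v' \<in> V" "\<And>n. (s' n, t' n) \<in> G" "\<And>n. s' n \<in> V" "\<And>n. t' n \<in> V"
    "(\<lambda>n. nrm (s' n - u')) \<longlonglongrightarrow> 0" "(\<lambda>n. nrm (t' n - v')) \<longlonglongrightarrow> 0"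
    using assms(4) G by (rule op_closureE) blast
  show ?thesis
    by (rule op_closureI[of _ _ "\<lambda>n. s n + s' n" "\<lambda>n. t n + t' n"])
      (use st st' add in \<open>auto intro: nrm_add_tendsto\<close>)
qed

lemma op_closure_scale:
  assumes G: "G \<subseteq> V \<times> V"
    and scale: "\<And>a u v. (u, v) \<in> G \<Longrightarrow> (cscale a u, cscale a v) \<in> G"
    and "(u, v) \<in> op_closure V ip G"
  shows "(cscale a u, cscale a v) \<in> op_closure V ip G"
proof -
  obtain s t where st: "u \<in> V" "v \<in> V" "\<And>n. (s n, t n) \<in> G" "\<And>n. s n \<in> V" "\<And>n. t n \<in> V"
    "tends_to s u" "tends_to t v"
    using assms(3) G by (rule op_closureE) blast
  show ?thesis
    by (rule op_closureI[of _ _ "\<lambda>n. cscale a (s n)" "\<lambda>n. cscale a (t n)"])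
      (use st scale in \<open>auto intro: nrm_scale_tendsto\<close>)
qed

text \<open>
A diagonal argument: each point of the sequence in the closure is replaced by a point of the
graph itself within distance \<open>1 / (n + 1)\<close>.
\<close>

lemma op_closure_closed:
  assumes G: "G \<subseteq> V \<times> V" and st: "\<And>n. (s n, t n) \<in> op_closure V ip G" and u: "u \<in> V" "v \<in> V"
    and lim: "tends_to s u" "tends_to t v"
  shows "(u, v) \<in> op_closure V ip G"
proof -
  have V: "s n \<in> V" "t n \<in> V" for n using st[of n] by (auto simp: op_closure_def)
  have "\<exists>p. p \<in> G \<and> nrm (fst p - s n) < 1 / real (Suc n) \<and> nrm (snd p - t n) < 1 / real (Suc n)" for n
  proof -
    have pos: "1 / real (Suc n) > 0" by simp
    obtain a b where ab: "\<And>k. (a k, b k) \<in> G" "(\<lambda>k. nrm (a k - s n)) \<longlonglongrightarrow> 0" "(\<lambda>k. nrm (b k - t n)) \<longlonglongrightarrow> 0"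
      using st[of n] G by (rule op_closureE) blast
    have "\<forall>\<^sub>F k in sequentially. nrm (a k - s n) < 1 / real (Suc n) \<and> nrm (b k - t n) < 1 / real (Suc n)"
      using order_tendstoD(2)[OF ab(2) pos] order_tendstoD(2)[OF ab(3) pos] by (rule eventually_conj)
    then obtain k where "nrm (a k - s n) < 1 / real (Suc n)" "nrm (b k - t n) < 1 / real (Suc n)"
      by (auto simp: eventually_sequentially)
    then show ?thesis using ab(1)[of k] by (intro exI[of _ "(a k, b k)"]) auto
  qed
  then obtain p where p: "\<And>n. p n \<in> G" "\<And>n. nrm (fst (p n) - s n) < 1 / real (Suc n)"
    "\<And>n. nrm (snd (p n) - t n) < 1 / real (Suc n)" by metis
  have pV: "fst (p n) \<in> V" "snd (p n) \<in> V" for n using p(1)[of n] G by auto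
  have inv: "(\<lambda>n. 1 / real (Suc n)) \<longlonglongrightarrow> 0" using lim_inverse_n'[THEN LIMSEQ_Suc] by simp
  have *: "tends_to x w"
    if "\<And>n. x n \<in> V" "\<And>n. y n \<in> V" "w \<in> V" "\<And>n. nrm (x n - y n) < 1 / real (Suc n)"
      "tends_to y w" for x y w
  proof (rule nrm_diff_tendsto_0I[OF that(1,3)])
    show "nrm (x n - w) \<le> 1 / real (Suc n) + nrm (y n - w)" for n
      using nrm_triangle_diff[OF that(1)[of n] that(2)[of n] that(3)] that(4)[of n] by linarith
    show "(\<lambda>n. 1 / real (Suc n) + nrm (y n - w)) \<longlonglongrightarrow> 0" using tendsto_add[OF inv that(5)] by simp
  qed
  show ?thesis
  proof (rule op_closureI[of _ _ "\<lambda>n. fst (p n)" "\<lambda>n. snd (p n)"])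
    show "(\<lambda>n. nrm (fst (p n) - u)) \<longlonglongrightarrow> 0" by (rule *[of _ s]) (use pV V u p lim in auto)
    show "(\<lambda>n. nrm (snd (p n) - v)) \<longlonglongrightarrow> 0" by (rule *[of _ t]) (use pV V u p lim in auto)
  qed (use u p in auto)
qed

text \<open>
Symmetry against the eigenvectors gives \<open>(l - m) <e l, e m> = 0\<close> for any two of them.
\<close>

lemma eigenvectors_orthonormal:
  assumes A: "A \<subseteq> V \<times> V"
    and eig: "\<And>l. l \<in> L \<Longrightarrow> (e l, cscale (complex_of_real l) (e l)) \<in> A"
    and unit: "\<And>l. l \<in> L \<Longrightarrow> nrm (e l) = 1"
    and sym: "\<And>l u v. l \<in> L \<Longrightarrow> (u, v) \<in> A \<Longrightarrow> ip (e l) v = of_real l * ip (e l) u"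
  shows "orthonormal (e ` L)" and "inj_on e L"
proof -
  have eV: "e l \<in> V" if "l \<in> L" for l using eig[OF that] A by auto
  have one: "ip (e l) (e l) = 1" if "l \<in> L" for l
    using that by (simp add: ip_self eV unit)
  have orth: "ip (e l) (e m) = 0" if "l \<in> L" "m \<in> L" "l \<noteq> m" for l m
    using sym[OF that(1) eig[OF that(2)]] that eV by (simp add: ip_scale_right)
  show "inj_on e L"
    using one orth by (metis inj_onI zero_neq_one)
  show "orthonormal (e ` L)"
    unfolding orthonormal_def
  proof (intro conjI ballI)
    show "e ` L \<subseteq> V" using eV by blast
    fix u v assume "u \<in> e ` L" "v \<in> e ` L"
    then obtain l m where "l \<in> L" "m \<in> L" "u = e l" "v = e m" by blast
    then show "ip u v = (if u = v then 1 else 0)"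
      using one orth by (cases "l = m") (metis zero_neq_one)+
  qed
qed

text \<open>
A closed operator that is symmetric against a complete system of unit eigenvectors has no spectrum
besides the eigenvalues, provided that these form a closed set. Off that set \<open>A - z\<close> multiplies
every Fourier coefficient by a factor of modulus at least \<open>d > 0\<close>, so it is bounded below by \<open>d\<close>
by Parseval. Hence it is injective and, since \<open>A\<close> is closed, its range is closed. The range
contains each eigenvector, hence the whole space.
\<close>

theorem spectrum_of_eigenbasis:
  assumes A: "A \<subseteq> V \<times> V"
    and zero: "(0, 0) \<in> A"
    and add: "\<And>u v u' v'. (u, v) \<in> A \<Longrightarrow> (u', v') \<in> A \<Longrightarrow> (u + u', v + v') \<in> A"
    and scale: "\<And>a u v. (u, v) \<in> A \<Longrightarrow> (cscale a u, cscale a v) \<in> A"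
    and closed: "\<And>s t u v. (\<And>n. (s n, t n) \<in> A) \<Longrightarrow> u \<in> V \<Longrightarrow> v \<in> V \<Longrightarrow>
      tends_to s u \<Longrightarrow> tends_to t v \<Longrightarrow> (u, v) \<in> A"
    and eig: "\<And>l. l \<in> L \<Longrightarrow> (e l, cscale (complex_of_real l) (e l)) \<in> A"
    and unit: "\<And>l. l \<in> L \<Longrightarrow> nrm (e l) = 1"
    and sym: "\<And>l u v. l \<in> L \<Longrightarrow> (u, v) \<in> A \<Longrightarrow> ip (e l) v = of_real l * ip (e l) u"
    and dense: "V \<subseteq> closed_span (e ` L)" and L: "closed L"
  shows "op_spectrum V ip A = complex_of_real ` L"
proof -
  have on: "orthonormal (e ` L)"
    using A eig unit sym by (rule eigenvectors_orthonormal(1))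
  have eV: "e l \<in> V" if "l \<in> L" for l using eig[OF that] A by auto
  have AV: "u \<in> V" "v \<in> V" if "(u, v) \<in> A" for u v using that A by auto
  define S where "S z = (\<lambda>(u, v). v - cscale z u)" for z :: complex
  have "z \<notin> resolvent_set V ip A" if "z \<in> complex_of_real ` L" for z
  proof -
    obtain l where l: "l \<in> L" "z = of_real l" using \<open>z \<in> _\<close> by blast
    have "S z (e l, cscale (of_real l) (e l)) = S z (0, 0)" by (simp add: S_def l)
    moreover have "e l \<noteq> 0" using unit[OF l(1)] by auto
    ultimately have "\<not> inj_on (S z) A" using eig[OF l(1)] zero by (auto dest!: inj_onD)
    then show ?thesis by (auto simp: resolvent_set_def bij_betw_def S_def)
  qed
  moreover have "z \<in> resolvent_set V ip A" if z: "z \<notin> complex_of_real ` L" for z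
  proof -
    have "complex_of_real ` L = {w. Im w = 0} \<inter> Re -` L"
      by (auto simp: complex_eq_iff image_iff)
    moreover have "closed ({w. Im w = 0} \<inter> Re -` L)"
      using L by (intro closed_Int closed_vimage) (auto intro!: closed_Collect_eq continuous_intros)
    ultimately have "open (- (complex_of_real ` L))" by (simp only: open_Compl)
    then obtain d where d: "d > 0" "ball z d \<subseteq> - (complex_of_real ` L)"
      using z open_contains_ball by (metis ComplI)
    have gap: "d \<le> cmod (of_real l - z)" if "l \<in> L" for l
      using d(2) that by (force simp: subset_iff dist_norm norm_minus_commute)
    have bound: "d * nrm u \<le> nrm (S z (u, v))" if uv: "(u, v) \<in> A" for u v
    proof (rule power2_le_imp_le)
      have SV: "S z (u, v) \<in> V" using AV[OF uv] by (simp add: S_def)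
      show "0 \<le> nrm (S z (u, v))" using SV by simp
      show "(d * nrm u)\<^sup>2 \<le> (nrm (S z (u, v)))\<^sup>2"
      proof (rule field_le_epsilon)
        fix \<epsilon> :: real assume "\<epsilon> > 0"
        then have e: "\<epsilon> / d\<^sup>2 > 0" using d by simp
        obtain T where T: "finite T" "T \<subseteq> e ` L" "(nrm u)\<^sup>2 < (\<Sum>w\<in>T. (cmod (ip w u))\<^sup>2) + \<epsilon> / d\<^sup>2"
          using Parseval_approx[where f=u, OF on _ e] dense AV[OF uv] by blast
        have "(d * cmod (ip w u))\<^sup>2 \<le> (cmod (ip w (S z (u, v))))\<^sup>2" if "w \<in> T" for w
        proof -
          obtain l where l: "l \<in> L" "w = e l" using \<open>w \<in> T\<close> T(2) by blast
          have "ip w (S z (u, v)) = (of_real l - z) * ip w u"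
            using AV[OF uv] eV l sym[OF l(1) uv] by (simp add: S_def ip_simps algebra_simps)
          then show ?thesis
            using gap[OF l(1)] d by (simp add: norm_mult power_mono mult_right_mono)
        qed
        then have "d\<^sup>2 * (\<Sum>w\<in>T. (cmod (ip w u))\<^sup>2) \<le> (\<Sum>w\<in>T. (cmod (ip w (S z (u, v))))\<^sup>2)"
          by (auto simp: sum_distrib_left power_mult_distrib intro: sum_mono)
        also have "\<dots> \<le> (nrm (S z (u, v)))\<^sup>2"
          using T on SV orthonormal_subset by (intro Bessel) auto
        finally have "d\<^sup>2 * (\<Sum>w\<in>T. (cmod (ip w u))\<^sup>2) \<le> (nrm (S z (u, v)))\<^sup>2" .
        moreover have "d\<^sup>2 * (nrm u)\<^sup>2 < d\<^sup>2 * ((\<Sum>w\<in>T. (cmod (ip w u))\<^sup>2) + \<epsilon> / d\<^sup>2)"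
          using T(3) d by (intro mult_strict_left_mono) auto
        ultimately show "(d * nrm u)\<^sup>2 \<le> (nrm (S z (u, v)))\<^sup>2 + \<epsilon>"
          using d by (simp add: power_mult_distrib distrib_left)
      qed
    qed
    have diff: "(u - u', v - v') \<in> A" if "(u, v) \<in> A" "(u', v') \<in> A" for u v u' v'
      using add[OF that(1) scale[OF that(2), of "-1"]] by simp
    have S_diff: "S z (u - u', v - v') = S z (u, v) - S z (u', v')" for u v u' v'
      by (simp add: S_def scale_right_diff_distrib)
    have "inj_on (S z) A"
    proof (rule inj_onI, clarify)
      fix u v u' v' assume uv: "(u, v) \<in> A" "(u', v') \<in> A" "S z (u, v) = S z (u', v')"
      have "d * nrm (u - u') \<le> 0"
        using bound[OF diff[OF uv(1,2)]] uv(3) by (simp add: S_diff)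
      then have "nrm (u - u') = 0"
        using d AV[OF uv(1)] AV[OF uv(2)] by (simp add: mult_le_0_iff order_antisym)
      then have "u = u'" using definite[of "u - u'"] AV[OF uv(1)] AV[OF uv(2)] by simp
      then show "u = u' \<and> v = v'" using uv(3) by (simp add: S_def)
    qed
    moreover have "S z ` A = V"
    proof
      show "S z ` A \<subseteq> V" using AV by (auto simp: S_def)
      have sub: "span (e ` L) \<subseteq> S z ` A"
      proof (rule span_minimal)
        show "e ` L \<subseteq> S z ` A"
        proof clarify
          fix l assume l: "l \<in> L"
          define c where "c = 1 / (of_real l - z)"
          have "of_real l \<noteq> z" using z l by blast
          then have "c * (of_real l - z) = 1" by (simp add: c_def)
          then have "c * of_real l - z * c = 1" by (simp add: algebra_simps)
          then have "S z (cscale c (e l), cscale c (cscale (of_real l) (e l))) = e l"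
            by (simp add: S_def flip: scale_left_diff_distrib)
          then show "e l \<in> S z ` A" using scale[OF eig[OF l], of c] by (metis imageI)
        qed
        show "subspace (S z ` A)"
        proof (rule subspaceI)
          show "0 \<in> S z ` A" using zero by (auto simp: S_def image_iff intro!: bexI[of _ "(0, 0)"])
          fix x y assume "x \<in> S z ` A" "y \<in> S z ` A"
          then obtain u v u' v' where uv: "(u, v) \<in> A" "x = S z (u, v)" "(u', v') \<in> A" "y = S z (u', v')" by auto
          have "x + y = S z (u + u', v + v')" by (simp add: uv S_def scale_right_distrib)
          then show "x + y \<in> S z ` A" using add[OF uv(1,3)] by blast
        next
          fix a x assume "x \<in> S z ` A"
          then obtain u v where uv: "(u, v) \<in> A" "x = S z (u, v)" by auto
          have "cscale a x = S z (cscale a u, cscale a v)"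
            by (simp add: uv S_def scale_right_diff_distrib mult.commute)
          then show "cscale a x \<in> S z ` A" using scale[OF uv(1)] by blast
        qed
      qed
      show "V \<subseteq> S z ` A"
      proof
        fix f assume f: "f \<in> V"
        have "\<exists>p\<in>A. nrm (S z p - f) < 1 / real (Suc n)" for n
        proof -
          have pos: "1 / real (Suc n) > 0" by simp
          obtain s where s: "s \<in> span (e ` L)" "nrm (f - s) < 1 / real (Suc n)"
            using dense f pos unfolding closed_span_def by blast
          have "s \<in> V" using s(1) span_in_V[of "e ` L"] eV by blast
          then show ?thesis using s sub f nrm_diff_commute[of f s] by auto
        qed
        then obtain p where p: "\<And>n. p n \<in> A" "\<And>n. nrm (S z (p n) - f) < 1 / real (Suc n)" by metis
        define u v where "u n = fst (p n)" and "v n = snd (p n)" for n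
        have uv: "(u n, v n) \<in> A" for n using p(1)[of n] by (simp add: u_def v_def)
        note V' = AV[OF uv]
        define g where "g n = S z (u n, v n)" for n
        have gV: "g n \<in> V" for n using V' by (simp add: g_def S_def)
        have g: "tends_to g f"
        proof (rule nrm_diff_tendsto_0I[OF gV f _ lim_inverse_n'[THEN LIMSEQ_Suc]])
          show "nrm (g n - f) \<le> 1 / real (Suc n)" for n
            using less_imp_le[OF p(2)] by (simp add: g_def u_def v_def)
        qed
        have gC: "cauchy_seq g" using convergent_imp_cauchy[of g f] gV f g by blast
        have "cauchy_seq u"
          unfolding cauchy_seq_def
        proof (intro allI impI)
          fix \<epsilon> :: real assume "\<epsilon> > 0"
          then have "d * \<epsilon> > 0" using d by simp
          then obtain N where N: "\<And>m n. m \<ge> N \<Longrightarrow> n \<ge> N \<Longrightarrow> nrm (g m - g n) < d * \<epsilon>"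
            using gC unfolding cauchy_seq_def by blast
          have "nrm (u m - u n) < \<epsilon>" if "m \<ge> N" "n \<ge> N" for m n
          proof -
            have "d * nrm (u m - u n) \<le> nrm (g m - g n)"
              using bound[OF diff[OF uv[of m] uv[of n]]] by (simp add: S_diff g_def)
            then have "d * nrm (u m - u n) < d * \<epsilon>" using N[OF that] by linarith
            then show ?thesis using d by simp
          qed
          then show "\<exists>N. \<forall>m\<ge>N. \<forall>n\<ge>N. nrm (u m - u n) < \<epsilon>" by blast
        qed
        then obtain u0 where u0: "u0 \<in> V" "tends_to u u0" using complete[of u] V' by blast
        have "(\<lambda>n. nrm (g n + cscale z (u n) - (f + cscale z u0))) \<longlonglongrightarrow> 0"
          using u0 gV f V' g by (intro nrm_add_tendsto nrm_scale_tendsto) auto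
        moreover have "g n + cscale z (u n) = v n" for n by (simp add: g_def S_def)
        ultimately have "(u0, f + cscale z u0) \<in> A"
          using closed[of u v u0] uv u0 f by simp
        moreover have "S z (u0, f + cscale z u0) = f" by (simp add: S_def)
        ultimately show "f \<in> S z ` A" by (metis imageI)
      qed
    qed
    moreover have "\<exists>C. \<forall>(u, v)\<in>A. nrm u \<le> C * nrm (S z (u, v))"
      using bound d by (intro exI[of _ "1 / d"]) (auto simp: field_simps)
    ultimately show ?thesis
      unfolding resolvent_set_def ip_norm_eq_nrm bij_betw_def S_def by simp
  qed
  ultimately show ?thesis unfolding op_spectrum_def by blast
qed

end

section \<open>The Hilbert space of a positive definite kernel\<close>

definition pscale :: "complex \<Rightarrow> ('a \<Rightarrow>\<^sub>0 complex) \<Rightarrow> 'a \<Rightarrow>\<^sub>0 complex" where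
  "pscale a = Poly_Mapping.map ((*) a)"

abbreviation keys :: "('a \<Rightarrow>\<^sub>0 'b::zero) \<Rightarrow> 'a set" where
  "keys \<equiv> Poly_Mapping.keys"

abbreviation lookup :: "('a \<Rightarrow>\<^sub>0 'b::zero) \<Rightarrow> 'a \<Rightarrow> 'b" where
  "lookup \<equiv> Poly_Mapping.lookup"

lemma lookup_pscale [simp]: "lookup (pscale a c) x = a * lookup c x"
  by (simp add: pscale_def Poly_Mapping.map.rep_eq when_def)

lemma keys_pscale_subset: "keys (pscale a c) \<subseteq> keys c"
  by (auto simp: in_keys_iff)

lemma vector_space_pscale: "vector_space pscale"
  by unfold_locales (auto intro!: poly_mapping_eqI simp: lookup_add algebra_simps)

lemma kernel_form_superset:
  assumes "finite S" "keys c \<subseteq> S" "keys d \<subseteq> S"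
  shows "kernel_form F c d = (\<Sum>x\<in>S. \<Sum>y\<in>S. cnj (lookup c x) * lookup d y * F (x - y))"
proof -
  have "kernel_form F c d = (\<Sum>x\<in>keys c. \<Sum>y\<in>S. cnj (lookup c x) * lookup d y * F (x - y))"
    unfolding kernel_form_def using assms
    by (intro sum.cong refl sum.mono_neutral_left) (auto simp: in_keys_iff)
  also have "\<dots> = (\<Sum>x\<in>S. \<Sum>y\<in>S. cnj (lookup c x) * lookup d y * F (x - y))"
    using assms by (intro sum.mono_neutral_left) (auto simp: in_keys_iff)
  finally show ?thesis .
qed

lemma kernel_form_add_right: "kernel_form F c (d + d') = kernel_form F c d + kernel_form F c d'"
proof -
  let ?S = "keys c \<union> keys d \<union> keys d'"
  have "keys (d + d') \<subseteq> ?S" "keys c \<subseteq> ?S" "keys d \<subseteq> ?S" "keys d' \<subseteq> ?S"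
    using keys_add[of d d'] by auto
  then show ?thesis
    by (simp add: kernel_form_superset[of ?S] lookup_add sum.distrib algebra_simps)
qed

lemma kernel_form_scale_right: "kernel_form F c (pscale a d) = a * kernel_form F c d"
proof -
  let ?S = "keys c \<union> keys d"
  have "keys (pscale a d) \<subseteq> ?S" using keys_pscale_subset[of a d] by auto
  then show ?thesis
    by (simp add: kernel_form_superset[of ?S] sum_distrib_left mult_ac)
qed

definition point_mass :: "real \<Rightarrow> real \<Rightarrow>\<^sub>0 complex" where
  "point_mass x = Poly_Mapping.single x 1"

lemma keys_point_mass [simp]: "keys (point_mass x) = {x}"
  by (simp add: point_mass_def)

lemma kernel_comb_eq_form:
  "kernel_comb F c x = (if x \<in> {0<..<1} then kernel_form F (point_mass x) c else 0)"
  by (simp add: kernel_comb_def on01_def kernel_form_def point_mass_def)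

text \<open>
The form is a finite combination of point values of the function represented by the second
argument. This is why pointwise convergence controls the form.
\<close>

lemma kernel_form_eq_comb:
  assumes "keys c \<subseteq> {0<..<1}"
  shows "kernel_form F c d = (\<Sum>x\<in>keys c. cnj (lookup c x) * kernel_comb F d x)"
  using assms unfolding kernel_form_def
  by (intro sum.cong) (auto simp: kernel_comb_def on01_def sum_distrib_left mult.assoc subset_iff)

abbreviation coeffs :: "(real \<Rightarrow>\<^sub>0 complex) set" where
  "coeffs \<equiv> {c. keys c \<subseteq> {0<..<1}}"

locale pd_kernel =
  fixes F :: "real \<Rightarrow> complex"
  assumes F_minus: "F (- x) = cnj (F x)"
    and F_pos: "keys c \<subseteq> {0<..<1} \<Longrightarrow> 0 \<le> Re (kernel_form F c c)"
begin

sublocale P: prehilbert pscale coeffs "kernel_form F"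
proof (intro prehilbert.intro vector_space_pscale prehilbert_axioms.intro)
  interpret vector_space "pscale :: complex \<Rightarrow> (real \<Rightarrow>\<^sub>0 complex) \<Rightarrow> _" by (rule vector_space_pscale)
  show "module.subspace pscale coeffs"
  proof (rule subspaceI; clarsimp)
    show "x \<in> keys (c + d) \<Longrightarrow> keys c \<subseteq> {0<..<1} \<Longrightarrow> keys d \<subseteq> {0<..<1} \<Longrightarrow> 0 < x \<and> x < 1"
      for c d :: "real \<Rightarrow>\<^sub>0 complex" and x
      using keys_add[of c d] unfolding greaterThanLessThan_iff[symmetric] by blast
    show "x \<in> keys (pscale a c) \<Longrightarrow> keys c \<subseteq> {0<..<1} \<Longrightarrow> 0 < x \<and> x < 1"
      for c :: "real \<Rightarrow>\<^sub>0 complex" and x a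
      using keys_pscale_subset[of a c] unfolding greaterThanLessThan_iff[symmetric] by blast
  qed
  show "kernel_form F d c = cnj (kernel_form F c d)" for c d
  proof -
    have "cnj (F (x - y)) = F (y - x)" for x y using F_minus[of "x - y"] by simp
    then show ?thesis
      unfolding kernel_form_def by (subst sum.swap) (simp add: cnj_sum mult_ac)
  qed
qed (simp_all add: kernel_form_add_right kernel_form_scale_right F_pos)

lemma point_mass_in [simp]: "keys (point_mass x) \<subseteq> {0<..<1} \<longleftrightarrow> x \<in> {0<..<1}"
  by auto

lemma represents_iff:
  "represents F c f \<longleftrightarrow> (\<forall>n. keys (c n) \<subseteq> {0<..<1}) \<and> P.cauchy_seq c \<and>
     (\<forall>x. (\<lambda>n. kernel_comb F (c n) x) \<longlonglongrightarrow> f x)"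
  unfolding represents_def P.cauchy_seq_def P.nrm_def by simp

lemma kernel_comb_add: "kernel_comb F (c + d) x = kernel_comb F c x + kernel_comb F d x"
  and kernel_comb_scale: "kernel_comb F (pscale a c) x = a * kernel_comb F c x"
  by (simp_all add: kernel_comb_eq_form kernel_form_add_right kernel_form_scale_right)

lemma represents_add_scale:
  "represents F c f \<Longrightarrow> represents F d g \<Longrightarrow> represents F (\<lambda>n. c n + pscale a (d n)) (f + cscale a g)"
  unfolding represents_iff using P.V_simps(2,5)
  by (auto simp: kernel_comb_add kernel_comb_scale cscale_def intro!: P.cauchy_add_scale tendsto_intros)

lemma represents_add: "represents F c f \<Longrightarrow> represents F d g \<Longrightarrow> represents F (\<lambda>n. c n + d n) (f + g)"
  using represents_add_scale[of c f d g 1] by (simp add: cscale_def)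

lemma represents_diff: "represents F c f \<Longrightarrow> represents F d g \<Longrightarrow> represents F (\<lambda>n. c n - d n) (f - g)"
  using represents_add_scale[of c f d g "-1"] by (simp add: cscale_def fun_Compl_def fun_diff_def plus_fun_def)

lemma represents_scale: "represents F d g \<Longrightarrow> represents F (\<lambda>n. pscale a (d n)) (cscale a g)"
  using represents_add_scale[of d g d g "a - 1"]
  by (simp add: cscale_def plus_fun_def algebra_simps P.scale_left_diff_distrib)

text \<open>
This is the faithfulness of the completion: a Cauchy sequence whose functions tend to 0 pointwise
tends to 0 in norm. Split \<open>|c n|^2 = <c n - c N, c n> + <c N, c n>\<close>. The first term is small
by the Cauchy property, and the second tends to 0 for fixed \<open>N\<close>, being a combination of finitely
many point values.
\<close>

lemma represents_zero_imp_null: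
  assumes "represents F c 0"
  shows "(\<lambda>n. P.nrm (c n)) \<longlonglongrightarrow> 0"
proof (rule LIMSEQ_I)
  have c: "\<And>n. keys (c n) \<subseteq> {0<..<1}" "P.cauchy_seq c" "\<And>x. (\<lambda>n. kernel_comb F (c n) x) \<longlonglongrightarrow> 0"
    using assms by (auto simp: represents_iff)
  then have cV: "c n \<in> coeffs" for n by simp
  fix e :: real assume e: "e > 0"
  obtain M where M: "M > 0" "\<And>n. P.nrm (c n) \<le> M" using P.cauchy_bounded[OF c(2) cV] by blast
  have "e\<^sup>2 / (2 * M) > 0" using e M by simp
  then obtain N where N: "\<And>m n. m \<ge> N \<Longrightarrow> n \<ge> N \<Longrightarrow> P.nrm (c m - c n) < e\<^sup>2 / (2 * M)"
    using c(2) unfolding P.cauchy_seq_def by blast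
  have "(\<lambda>n. kernel_form F (c N) (c n)) \<longlonglongrightarrow> (\<Sum>x\<in>keys (c N). cnj (lookup (c N) x) * 0)"
    unfolding kernel_form_eq_comb[OF c(1)] by (intro tendsto_intros c(3))
  then have "(\<lambda>n. kernel_form F (c N) (c n)) \<longlonglongrightarrow> 0" by simp
  then have "\<forall>\<^sub>F n in sequentially. cmod (kernel_form F (c N) (c n)) < e\<^sup>2 / 2"
    using order_tendstoD(2)[OF tendsto_norm, of _ 0 sequentially "e\<^sup>2/2"] e by simp
  then obtain N' where N': "\<And>n. n \<ge> N' \<Longrightarrow> cmod (kernel_form F (c N) (c n)) < e\<^sup>2 / 2"
    by (auto simp: eventually_sequentially)
  have "P.nrm (c n) < e" if n: "n \<ge> max N N'" for n
  proof -
    have "(P.nrm (c n))\<^sup>2 = Re (kernel_form F (c n - c N) (c n)) + Re (kernel_form F (c N) (c n))"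
      using cV by (simp only: P.nrm_sq P.ip_diff_left) simp
    also have "\<dots> \<le> cmod (kernel_form F (c n - c N) (c n)) + cmod (kernel_form F (c N) (c n))"
      by (intro add_mono complex_Re_le_cmod)
    also have "cmod (kernel_form F (c n - c N) (c n)) \<le> P.nrm (c n - c N) * P.nrm (c n)"
      using cV P.V_simps(3)[OF cV[of n] cV[of N]] by (intro P.Cauchy_Schwarz) 
    also have "\<dots> \<le> P.nrm (c n - c N) * M"
      using P.nrm_ge_0[OF P.V_simps(3)[OF cV[of n] cV[of N]]] M by (intro mult_left_mono)
    also have "\<dots> \<le> e\<^sup>2 / (2 * M) * M"
      using N[of n N] n M by (intro mult_right_mono) auto
    also have "\<dots> = e\<^sup>2 / 2" using M by simp
    finally have "(P.nrm (c n))\<^sup>2 < e\<^sup>2" using N'[of n] n by simp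
    then show ?thesis using e by (simp add: power_less_imp_less_base)
  qed
  then show "\<exists>N. \<forall>n\<ge>N. norm (P.nrm (c n) - 0) < e"
    using P.nrm_ge_0[OF cV] by (intro exI[of _ "max N N'"]) auto
qed

lemma form_limit_well_defined:
  assumes "represents F c f" "represents F c' f" "represents F d g" "represents F d' g"
    and lim: "(\<lambda>n. kernel_form F (c n) (d n)) \<longlonglongrightarrow> z"
  shows "(\<lambda>n. kernel_form F (c' n) (d' n)) \<longlonglongrightarrow> z"
proof -
  have V: "c n \<in> coeffs" "c' n \<in> coeffs"
    "d n \<in> coeffs" "d' n \<in> coeffs" for n
    using assms by (auto simp: represents_iff)
  have c0: "(\<lambda>n. P.nrm (c' n - c n)) \<longlonglongrightarrow> 0" and d0: "(\<lambda>n. P.nrm (d' n - d n)) \<longlonglongrightarrow> 0"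
    using assms(1-4) represents_diff[of c' f c f] represents_diff[of d' g d g]
    by (auto intro: represents_zero_imp_null)
  have cauchy: "P.cauchy_seq c'" "P.cauchy_seq d" using assms by (auto simp: represents_iff)
  obtain M where M: "\<And>n. P.nrm (c' n) \<le> M" by (rule P.cauchy_bounded[OF cauchy(1) V(2)]) blast
  obtain M' where M': "\<And>n. P.nrm (d n) \<le> M'" by (rule P.cauchy_bounded[OF cauchy(2) V(3)]) blast
  have "(\<lambda>n. kernel_form F (c' n) (d' n) - kernel_form F (c n) (d n)) \<longlonglongrightarrow> 0"
  proof (rule Lim_null_comparison)
    have "cmod (kernel_form F (c' n) (d' n) - kernel_form F (c n) (d n))
        \<le> M * P.nrm (d' n - d n) + P.nrm (c' n - c n) * M'" for n
    proof -
      have "cmod (kernel_form F (c' n) (d' n) - kernel_form F (c n) (d n))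
        \<le> P.nrm (c' n) * P.nrm (d' n - d n) + P.nrm (c' n - c n) * P.nrm (d n)"
        by (rule P.ip_diff_bound) (rule V)+
      also have "\<dots> \<le> M * P.nrm (d' n - d n) + P.nrm (c' n - c n) * M'"
        by (intro add_mono mult_left_mono mult_right_mono M M' P.nrm_ge_0 P.V_simps V)
      finally show ?thesis .
    qed
    then show "\<forall>\<^sub>F n in sequentially. cmod (kernel_form F (c' n) (d' n) - kernel_form F (c n) (d n))
        \<le> M * P.nrm (d' n - d n) + P.nrm (c' n - c n) * M'" by simp
    show "(\<lambda>n. M * P.nrm (d' n - d n) + P.nrm (c' n - c n) * M') \<longlonglongrightarrow> 0"
      using tendsto_add[OF tendsto_mult_right_zero[OF d0] tendsto_mult_left_zero[OF c0]] by simp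
  qed
  then show ?thesis using tendsto_add[OF _ lim, of "\<lambda>n. kernel_form F (c' n) (d' n) - kernel_form F (c n) (d n)" 0] by simp
qed

text \<open>
The description defining the inner product has a unique solution, since the limit of the forms
exists and does not depend on the representing sequences.
\<close>

lemma rkhs_inner_lim:
  assumes "represents F c f" "represents F d g"
  shows "(\<lambda>n. kernel_form F (c n) (d n)) \<longlonglongrightarrow> rkhs_inner F f g"
proof -
  have "convergent (\<lambda>n. kernel_form F (c n) (d n))"
    by (rule P.ip_cauchy_convergent) (use assms in \<open>auto simp: represents_iff\<close>)
  then obtain z where z: "(\<lambda>n. kernel_form F (c n) (d n)) \<longlonglongrightarrow> z" by (auto simp: convergent_def)
  have "rkhs_inner F f g = z"
    unfolding rkhs_inner_def
  proof (rule the_equality)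
    show "\<forall>c d. represents F c f \<longrightarrow> represents F d g \<longrightarrow> (\<lambda>n. kernel_form F (c n) (d n)) \<longlonglongrightarrow> z"
      using form_limit_well_defined[OF assms(1) _ assms(2) _ z] by blast
    show "w = z" if "\<forall>c d. represents F c f \<longrightarrow> represents F d g \<longrightarrow> (\<lambda>n. kernel_form F (c n) (d n)) \<longlonglongrightarrow> w" for w
      using that assms z LIMSEQ_unique by blast
  qed
  then show ?thesis using z by simp
qed

lemma represents_const:
  assumes "keys c \<subseteq> {0<..<1}"
  shows "represents F (\<lambda>_. c) (kernel_comb F c)"
  using assms unfolding represents_iff P.cauchy_seq_def by auto

lemma kernel_comb_in_rkhs: "keys c \<subseteq> {0<..<1} \<Longrightarrow> kernel_comb F c \<in> rkhs F"
  using represents_const unfolding rkhs_def by blast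

lemma rkhsE: "f \<in> rkhs F \<Longrightarrow> (\<And>c. represents F c f \<Longrightarrow> P) \<Longrightarrow> P"
  unfolding rkhs_def by blast

lemma rkhs_prehilbert: "prehilbert cscale (rkhs F) (rkhs_inner F)"
proof (intro prehilbert.intro vector_space_cscale prehilbert_axioms.intro)
  interpret C: vector_space cscale by (rule vector_space_cscale)
  show "C.subspace (rkhs F)"
  proof (rule C.subspaceI)
    show "0 \<in> rkhs F"
      using kernel_comb_in_rkhs[of 0] by (simp add: kernel_comb_def on01_def zero_fun_def)
    show "f + g \<in> rkhs F" if "f \<in> rkhs F" "g \<in> rkhs F" for f g
      using that represents_add unfolding rkhs_def by blast
    show "cscale a f \<in> rkhs F" if "f \<in> rkhs F" for a f
      using that represents_scale unfolding rkhs_def by blast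
  qed
next
  fix f g h assume "f \<in> rkhs F" "g \<in> rkhs F" "h \<in> rkhs F"
  then obtain c d e where r: "represents F c f" "represents F d g" "represents F e h" by (metis rkhsE)
  have "(\<lambda>n. kernel_form F (c n) (d n + e n)) \<longlonglongrightarrow> rkhs_inner F f (g + h)"
    by (rule rkhs_inner_lim[OF r(1) represents_add[OF r(2,3)]])
  moreover have "(\<lambda>n. kernel_form F (c n) (d n + e n)) \<longlonglongrightarrow> rkhs_inner F f g + rkhs_inner F f h"
    unfolding kernel_form_add_right by (intro tendsto_add rkhs_inner_lim r)
  ultimately show "rkhs_inner F f (g + h) = rkhs_inner F f g + rkhs_inner F f h"
    by (rule LIMSEQ_unique)
next
  fix f g a assume "f \<in> rkhs F" "g \<in> rkhs F"
  then obtain c d where r: "represents F c f" "represents F d g" by (metis rkhsE)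
  have "(\<lambda>n. kernel_form F (c n) (pscale a (d n))) \<longlonglongrightarrow> rkhs_inner F f (cscale a g)"
    by (rule rkhs_inner_lim[OF r(1) represents_scale[OF r(2)]])
  moreover have "(\<lambda>n. kernel_form F (c n) (pscale a (d n))) \<longlonglongrightarrow> a * rkhs_inner F f g"
    unfolding kernel_form_scale_right by (intro tendsto_mult_left rkhs_inner_lim r)
  ultimately show "rkhs_inner F f (cscale a g) = a * rkhs_inner F f g"
    by (rule LIMSEQ_unique)
next
  fix f g assume "f \<in> rkhs F" "g \<in> rkhs F"
  then obtain c d where r: "represents F c f" "represents F d g" by (metis rkhsE)
  have "kernel_form F (d n) (c n) = cnj (kernel_form F (c n) (d n))" for n
    using r by (intro P.ip_cnj) (auto simp: represents_iff)
  then have "(\<lambda>n. kernel_form F (d n) (c n)) \<longlonglongrightarrow> cnj (rkhs_inner F f g)"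
    using tendsto_cnj[OF rkhs_inner_lim[OF r]] by simp
  then show "rkhs_inner F g f = cnj (rkhs_inner F f g)"
    using rkhs_inner_lim[OF r(2,1)] LIMSEQ_unique by blast
next
  fix f assume "f \<in> rkhs F"
  then obtain c where r: "represents F c f" by (metis rkhsE)
  have "(\<lambda>n. Re (kernel_form F (c n) (c n))) \<longlonglongrightarrow> Re (rkhs_inner F f f)"
    by (intro tendsto_Re rkhs_inner_lim r)
  then show "0 \<le> Re (rkhs_inner F f f)"
    by (rule LIMSEQ_le_const) (use r in \<open>auto simp: represents_iff F_pos\<close>)
qed

sublocale H: prehilbert cscale "rkhs F" "rkhs_inner F"
  by (rule rkhs_prehilbert)

text \<open>
The translate of the kernel is defined for every \<open>x\<close>, because the two endpoints 0 and 1
of the interval will be needed as well.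
\<close>

definition K :: "real \<Rightarrow> real \<Rightarrow> complex" where
  "K x = on01 (\<lambda>y. F (y - x))"

lemma kernel_comb_point_mass: "kernel_comb F (point_mass x) = K x"
  by (simp add: kernel_comb_def K_def on01_def fun_eq_iff point_mass_def)

lemma K_in [simp]: "x \<in> {0<..<1} \<Longrightarrow> K x \<in> rkhs F"
  using kernel_comb_in_rkhs[of "point_mass x"] by (simp add: kernel_comb_point_mass)

lemma kernel_comb_eq_sum: "kernel_comb F c = (\<Sum>x\<in>keys c. cscale (lookup c x) (K x))"
proof
  fix y
  have sum_app: "(\<Sum>x\<in>A. g x) y = (\<Sum>x\<in>A. g x y)" for A :: "real set" and g :: "real \<Rightarrow> real \<Rightarrow> complex"
    by (induction A rule: infinite_finite_induct) auto
  show "kernel_comb F c y = (\<Sum>x\<in>keys c. cscale (lookup c x) (K x)) y"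
    by (cases "y \<in> {0<..<1}") (auto simp: sum_app kernel_comb_def K_def cscale_def on01_def)
qed

lemma reproducing:
  assumes f: "f \<in> rkhs F" and x: "x \<in> {0<..<1}"
  shows "rkhs_inner F (K x) f = f x"
proof -
  obtain c where r: "represents F c f" using f by (metis rkhsE)
  have "represents F (\<lambda>_. point_mass x) (K x)"
    using represents_const[of "point_mass x"] x by (simp add: kernel_comb_point_mass)
  from rkhs_inner_lim[OF this r] have "(\<lambda>n. kernel_comb F (c n) x) \<longlonglongrightarrow> rkhs_inner F (K x) f"
    using x by (simp add: kernel_comb_eq_form)
  moreover have "(\<lambda>n. kernel_comb F (c n) x) \<longlonglongrightarrow> f x" using r by (simp add: represents_iff)
  ultimately show ?thesis by (rule LIMSEQ_unique)
qed

lemma rkhs_outside: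
  assumes "f \<in> rkhs F" "x \<notin> {0<..<1}"
  shows "f x = 0"
proof -
  obtain c where "represents F c f" using assms by (metis rkhsE)
  then have "(\<lambda>n. kernel_comb F (c n) x) \<longlonglongrightarrow> f x" by (simp add: represents_iff)
  moreover have "(\<lambda>n. kernel_comb F (c n) x) = (\<lambda>_. 0)"
    using assms(2) by (auto simp: kernel_comb_eq_form)
  ultimately show ?thesis by (simp add: LIMSEQ_const_iff)
qed

lemma represents_tendsto:
  assumes r: "represents F c f"
  shows "(\<lambda>n. H.nrm (kernel_comb F (c n) - f)) \<longlonglongrightarrow> 0"
proof (rule LIMSEQ_I)
  fix e :: real assume e: "e > 0"
  have f: "f \<in> rkhs F" using r by (auto simp: rkhs_def)
  have cV: "keys (c n) \<subseteq> {0<..<1}" for n using r by (simp add: represents_iff)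
  obtain N where N: "\<And>m n. m \<ge> N \<Longrightarrow> n \<ge> N \<Longrightarrow> P.nrm (c m - c n) < e / 2"
    using r e unfolding represents_iff P.cauchy_seq_def by (meson half_gt_zero)
  have "H.nrm (kernel_comb F (c n) - f) \<le> e / 2" if n: "n \<ge> N" for n
  proof -
    have rd: "represents F (\<lambda>m. c n - c m) (kernel_comb F (c n) - f)"
      by (rule represents_diff[OF represents_const[OF cV] r])
    have "(\<lambda>m. sqrt (Re (kernel_form F (c n - c m) (c n - c m)))) \<longlonglongrightarrow> H.nrm (kernel_comb F (c n) - f)"
      unfolding H.nrm_def by (intro tendsto_real_sqrt tendsto_Re rkhs_inner_lim rd)
    then show ?thesis
      by (rule LIMSEQ_le_const2) (use N[OF n] in \<open>auto simp: P.nrm_def intro: less_imp_le\<close>)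
  qed
  moreover have "0 \<le> H.nrm (kernel_comb F (c n) - f)" for n
    using f kernel_comb_in_rkhs[OF cV] by simp
  ultimately have "norm (H.nrm (kernel_comb F (c n) - f) - 0) < e" if "n \<ge> N" for n
    using that e by (smt (verit) real_norm_def field_sum_of_halves)
  then show "\<exists>N. \<forall>n\<ge>N. norm (H.nrm (kernel_comb F (c n) - f) - 0) < e" by blast
qed

lemma nrm_comb_diff:
  assumes "keys c \<subseteq> {0<..<1}" "keys d \<subseteq> {0<..<1}"
  shows "H.nrm (kernel_comb F c - kernel_comb F d) = P.nrm (c - d)"
proof -
  have "represents F (\<lambda>_. c - d) (kernel_comb F c - kernel_comb F d)"
    using assms by (intro represents_diff represents_const)
  from rkhs_inner_lim[OF this this] show ?thesis
    by (simp add: H.nrm_def P.nrm_def LIMSEQ_const_iff)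
qed

sublocale H: function_hilbert "rkhs F" "rkhs_inner F"
proof (intro function_hilbert.intro hilbert.intro rkhs_prehilbert hilbert_axioms.intro)
  fix f assume f: "f \<in> rkhs F" "H.nrm f = 0"
  have "f x = 0" for x
  proof (cases "x \<in> {0<..<1}")
    case True
    then show ?thesis
      using H.Cauchy_Schwarz[of "K x" f] f reproducing[of f x] by simp
  qed (use f rkhs_outside in auto)
  then show "f = 0" by auto
next
  fix s assume s: "H.cauchy_seq s" "\<And>n. s n \<in> rkhs F"
  have "\<exists>c. keys c \<subseteq> {0<..<1} \<and> H.nrm (kernel_comb F c - s n) < 1 / real (Suc n)" for n
  proof -
    obtain c where r: "represents F c (s n)" using s(2) by (metis rkhsE)
    have "\<forall>\<^sub>F k in sequentially. H.nrm (kernel_comb F (c k) - s n) < 1 / real (Suc n)"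
      using represents_tendsto[OF r] by (rule order_tendstoD) simp
    then show ?thesis using r by (auto simp: eventually_sequentially represents_iff)
  qed
  then obtain c where c: "\<And>n. keys (c n) \<subseteq> {0<..<1}" "\<And>n. H.nrm (kernel_comb F (c n) - s n) < 1 / real (Suc n)"
    by metis
  note cH = kernel_comb_in_rkhs[OF c(1)]
  have near: "(\<lambda>n. H.nrm (kernel_comb F (c n) - s n)) \<longlonglongrightarrow> 0"
    by (rule tendsto_sandwich[OF _ _ tendsto_const lim_inverse_n'[THEN LIMSEQ_Suc]])
      (use less_imp_le[OF c(2)] cH s in auto)
  have "P.cauchy_seq c"
    unfolding P.cauchy_seq_def
  proof (intro allI impI)
    fix e :: real assume "e > 0"
    then have e: "e / 3 > 0" by simp
    obtain N where N: "\<And>m n. m \<ge> N \<Longrightarrow> n \<ge> N \<Longrightarrow> H.nrm (s m - s n) < e / 3"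
      using s(1) e unfolding H.cauchy_seq_def by blast
    obtain N' where N': "\<And>n. n \<ge> N' \<Longrightarrow> H.nrm (kernel_comb F (c n) - s n) < e / 3"
      using order_tendstoD(2)[OF near e] by (auto simp: eventually_sequentially)
    show "\<exists>N. \<forall>m\<ge>N. \<forall>n\<ge>N. P.nrm (c m - c n) < e"
    proof (intro exI allI impI)
      fix m n assume mn: "m \<ge> max N N'" "n \<ge> max N N'"
      have "P.nrm (c m - c n) = H.nrm (kernel_comb F (c m) - kernel_comb F (c n))"
        using c by (simp add: nrm_comb_diff)
      moreover have "H.nrm (kernel_comb F (c m) - kernel_comb F (c n))
          \<le> H.nrm (kernel_comb F (c m) - s m) + H.nrm (s m - kernel_comb F (c n))"
        using s cH by (intro H.nrm_triangle_diff)
      moreover have "H.nrm (s m - kernel_comb F (c n)) \<le> H.nrm (s m - s n) + H.nrm (s n - kernel_comb F (c n))"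
        using s cH by (intro H.nrm_triangle_diff)
      moreover have "H.nrm (s n - kernel_comb F (c n)) = H.nrm (kernel_comb F (c n) - s n)"
        using s cH by (intro H.nrm_diff_commute)
      moreover have "m \<ge> N" "n \<ge> N" "m \<ge> N'" "n \<ge> N'" using mn by auto
      ultimately show "P.nrm (c m - c n) < e" using N[of m n] N'[of m] N'[of n] by linarith
    qed
  qed
  moreover have "\<exists>l. (\<lambda>n. kernel_comb F (c n) x) \<longlonglongrightarrow> l" for x
  proof (cases "x \<in> {0<..<1}")
    case True
    have "convergent (\<lambda>n. kernel_form F (point_mass x) (c n))"
      using \<open>P.cauchy_seq c\<close> c True
      by (intro P.ip_cauchy_convergent) (auto simp: P.cauchy_seq_def)
    then show ?thesis using True by (simp add: kernel_comb_eq_form convergent_def)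
  qed (auto simp: kernel_comb_eq_form intro!: exI[of _ "0::complex"])
  then obtain f where "\<And>x. (\<lambda>n. kernel_comb F (c n) x) \<longlonglongrightarrow> f x" by metis
  ultimately have r: "represents F c f" using c by (simp add: represents_iff)
  then have f: "f \<in> rkhs F" by (auto simp: rkhs_def)
  have "(\<lambda>n. H.nrm (s n - f)) \<longlonglongrightarrow> 0"
  proof (rule H.nrm_diff_tendsto_0I[OF s(2) f])
    show "H.nrm (s n - f) \<le> H.nrm (kernel_comb F (c n) - s n) + H.nrm (kernel_comb F (c n) - f)" for n
      using H.nrm_triangle_diff[OF s(2)[of n] cH[of n] f] H.nrm_diff_commute[OF s(2)[of n] cH[of n]] by simp
    show "(\<lambda>n. H.nrm (kernel_comb F (c n) - s n) + H.nrm (kernel_comb F (c n) - f)) \<longlonglongrightarrow> 0"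
      using tendsto_add[OF near represents_tendsto[OF r]] by simp
  qed
  then show "\<exists>l\<in>rkhs F. (\<lambda>n. H.nrm (s n - l)) \<longlonglongrightarrow> 0" using f by blast
qed

text \<open>
A closed span is everything as soon as it contains the translates of the kernel, since the
combinations of these represent all elements by limits.
\<close>

lemma kernels_dense:
  assumes B: "B \<subseteq> rkhs F" and K: "\<And>x. x \<in> {0<..<1} \<Longrightarrow> K x \<in> H.closed_span B"
  shows "rkhs F \<subseteq> H.closed_span B"
proof
  fix f assume f: "f \<in> rkhs F"
  obtain c where r: "represents F c f" using f by (metis rkhsE)
  have comb: "kernel_comb F (c n) \<in> H.closed_span B" for n
    unfolding kernel_comb_eq_sum using r K
    by (intro H.subspace_sum H.subspace_scale H.subspace_closed_span B) (auto simp: represents_iff subset_iff)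
  show "f \<in> H.closed_span B"
  proof (rule H.closed_span_closed[OF B f])
    fix e :: real assume "e > 0"
    then obtain n where "H.nrm (kernel_comb F (c n) - f) < e"
      using order_tendstoD(2)[OF represents_tendsto[OF r]] by (auto simp: eventually_sequentially)
    then show "\<exists>g\<in>H.closed_span B. H.nrm (f - g) < e"
      using comb[of n] f H.nrm_diff_commute[of f "kernel_comb F (c n)"] by (auto simp: H.closed_span_def)
  qed
qed

end

section \<open>Smooth functions and cutoffs\<close>

text \<open>
Coinduction for smoothness: a family of functions closed under differentiation consists of
smooth functions. Products, affine substitutions and the flat function are all treated by naming such
a family, with no formula for the derivatives of higher order.
\<close>

lemma smooth_coinduct:
  assumes "f \<in> S" and step: "\<And>g. g \<in> S \<Longrightarrow> \<exists>g'\<in>S. \<forall>x. (g has_vector_derivative g' x) (at x)"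
  shows "smooth f"
proof -
  obtain d where d: "\<And>g. g \<in> S \<Longrightarrow> d g \<in> S" "\<And>g x. g \<in> S \<Longrightarrow> (g has_vector_derivative d g x) (at x)"
    using step by metis
  have "(d ^^ n) f \<in> S" for n
    by (induction n) (use assms(1) d(1) in auto)
  then show ?thesis
    unfolding smooth_def using d(2) by (intro exI[of _ "\<lambda>n. (d ^^ n) f"]) auto
qed

lemma smoothE:
  assumes "smooth f"
  obtains f' where "smooth f'" "\<And>x. (f has_vector_derivative f' x) (at x)"
proof -
  obtain D where D: "D 0 = f" "\<And>n x. (D n has_vector_derivative D (Suc n) x) (at x)"
    using assms unfolding smooth_def by blast
  have "smooth (D 1)"
    unfolding smooth_def using D by (intro exI[of _ "\<lambda>n. D (Suc n)"]) auto
  then show ?thesis using that[of "D 1"] D(2)[of 0] D(1) by simp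
qed

lemma smooth_add:
  assumes "smooth f" "smooth g"
  shows "smooth (\<lambda>x. f x + g x)"
proof (rule smooth_coinduct[of _ "{\<lambda>x. f x + g x | f g. smooth f \<and> smooth g}"])
  fix p assume "p \<in> {\<lambda>x. f x + g x | f g. smooth f \<and> smooth g}"
  then obtain f g where p: "p = (\<lambda>x. f x + g x)" and "smooth f" "smooth g" by blast
  then obtain f' g' where "smooth f'" "smooth g'"
    "\<And>x. (f has_vector_derivative f' x) (at x)" "\<And>x. (g has_vector_derivative g' x) (at x)"
    by (metis smoothE)
  then show "\<exists>p'\<in>{\<lambda>x. f x + g x | f g. smooth f \<and> smooth g}. \<forall>x. (p has_vector_derivative p' x) (at x)"
    unfolding p by (intro bexI[of _ "\<lambda>x. f' x + g' x"]) (auto intro!: has_vector_derivative_add)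
qed (use assms in blast)

inductive_set sums_of_products :: "(real \<Rightarrow> complex) set" where
  prod: "smooth f \<Longrightarrow> smooth g \<Longrightarrow> (\<lambda>x. f x * g x) \<in> sums_of_products"
| add: "p \<in> sums_of_products \<Longrightarrow> q \<in> sums_of_products \<Longrightarrow> (\<lambda>x. p x + q x) \<in> sums_of_products"

lemma smooth_mult:
  assumes "smooth f" "smooth g"
  shows "smooth (\<lambda>x. f x * g x)"
proof (rule smooth_coinduct[of _ sums_of_products])
  fix p assume "p \<in> sums_of_products"
  then show "\<exists>p'\<in>sums_of_products. \<forall>x. (p has_vector_derivative p' x) (at x)"
  proof induction
    case (prod f g)
    then obtain f' g' where "smooth f'" "smooth g'"
      "\<And>x. (f has_vector_derivative f' x) (at x)" "\<And>x. (g has_vector_derivative g' x) (at x)"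
      by (metis smoothE)
    then show ?case
      using prod by (intro bexI[of _ "\<lambda>x. f x * g' x + f' x * g x"])
        (auto intro!: has_vector_derivative_mult sums_of_products.intros)
  next
    case (add p q)
    then obtain p' q' where "p' \<in> sums_of_products" "q' \<in> sums_of_products"
      "\<forall>x. (p has_vector_derivative p' x) (at x)" "\<forall>x. (q has_vector_derivative q' x) (at x)" by blast
    then show ?case
      by (intro bexI[of _ "\<lambda>x. p' x + q' x"]) (auto intro!: has_vector_derivative_add sums_of_products.add)
  qed
qed (use assms in \<open>blast intro: sums_of_products.prod\<close>)

lemma smooth_exp: "smooth (\<lambda>x. c * exp (s * of_real x))"
proof (rule smooth_coinduct[of _ "range (\<lambda>c x. c * exp (s * of_real x))"])
  fix p assume "p \<in> range (\<lambda>c x. c * exp (s * complex_of_real x))"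
  then obtain c where p: "p = (\<lambda>x. c * exp (s * of_real x))" by blast
  have "(p has_vector_derivative (c * s) * exp (s * of_real x)) (at x)" for x
  proof -
    have "((\<lambda>z. c * exp (s * z)) has_field_derivative (c * s) * exp (s * of_real x)) (at (of_real x))"
      by (auto intro!: derivative_eq_intros)
    then show ?thesis unfolding p by (rule has_vector_derivative_real_field)
  qed
  then show "\<exists>p'\<in>range (\<lambda>c x. c * exp (s * complex_of_real x)). \<forall>x. (p has_vector_derivative p' x) (at x)"
    by (intro bexI[of _ "\<lambda>x. (c * s) * exp (s * of_real x)"]) auto
qed blast

lemma smooth_cmult: "smooth f \<Longrightarrow> smooth (\<lambda>x. c * f x)"
  using smooth_mult[OF smooth_exp[of c 0], of f] by simp

lemma smooth_affine:
  assumes "smooth f"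
  shows "smooth (\<lambda>x. f (a * x + b))"
proof (rule smooth_coinduct[of _ "{\<lambda>x. c * f (a * x + b) | c f. smooth f}"])
  fix p assume "p \<in> {\<lambda>x. c * f (a * x + b) | c f. smooth f}"
  then obtain c f where p: "p = (\<lambda>x. c * f (a * x + b))" and f: "smooth f" by blast
  obtain f' where f': "smooth f'" "\<And>x. (f has_vector_derivative f' x) (at x)" using smoothE[OF f] by blast
  have "(p has_vector_derivative (c * of_real a) * f' (a * x + b)) (at x)" for x
  proof -
    have "((\<lambda>x. a * x + b) has_vector_derivative a) (at x)"
      by (auto intro!: derivative_eq_intros simp: has_real_derivative_iff_has_vector_derivative[symmetric])
    from vector_diff_chain_at[OF this f'(2)]
    have "((\<lambda>x. f (a * x + b)) has_vector_derivative a *\<^sub>R f' (a * x + b)) (at x)" by (simp add: o_def)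
    from has_vector_derivative_mult_right[OF this, of c] show ?thesis
      by (simp add: p scaleR_conv_of_real mult_ac)
  qed
  then show "\<exists>p'\<in>{\<lambda>x. c * f (a * x + b) | c f. smooth f}. \<forall>x. (p has_vector_derivative p' x) (at x)"
    using f'(1) by (intro bexI[of _ "\<lambda>x. (c * of_real a) * f' (a * x + b)"]) blast+
next
  have "(\<lambda>x. f (a * x + b)) = (\<lambda>x. 1 * f (a * x + b))" by simp
  then show "(\<lambda>x. f (a * x + b)) \<in> {\<lambda>x. c * f (a * x + b) | c f. smooth f}" using assms by blast
qed

text \<open>
These functions \<open>p(1/x) exp(-1/x)\<close>, extended by 0, are the family closed under differentiation
that contains the classical flat function \<open>exp(-1/x)\<close>.
\<close>

definition flat_poly :: "real poly \<Rightarrow> real \<Rightarrow> real" where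
  "flat_poly p x = (if x > 0 then poly p (1 / x) * exp (- (1 / x)) else 0)"

lemma poly_times_exp_minus_tendsto_0: "((\<lambda>t::real. poly p t * exp (- t)) \<longlongrightarrow> 0) at_top"
proof -
  have "((\<lambda>t. \<Sum>i\<le>degree p. coeff p i * (t ^ i / exp t)) \<longlongrightarrow> (\<Sum>i\<le>degree p. coeff p i * 0)) at_top"
    by (intro tendsto_intros tendsto_power_div_exp_0)
  then show ?thesis by (simp add: poly_altdef sum_distrib_right exp_minus field_simps sum_divide_distrib)
qed

lemma flat_poly_tendsto_0: "(flat_poly p \<longlongrightarrow> 0) (at_right 0)"
proof -
  have "((\<lambda>x. poly p (inverse x) * exp (- inverse x)) \<longlongrightarrow> 0) (at_right (0::real))"
    by (rule filterlim_compose[OF poly_times_exp_minus_tendsto_0 filterlim_inverse_at_top_right])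
  moreover have "\<forall>\<^sub>F x in at_right 0. poly p (inverse x) * exp (- inverse x) = flat_poly p x"
    by (auto simp: eventually_at_filter flat_poly_def inverse_eq_divide)
  ultimately show ?thesis by (rule Lim_transform_eventually)
qed

lemma DERIV_flat_poly:
  "(flat_poly p has_real_derivative flat_poly (monom 1 2 * (p - pderiv p)) x) (at x)"
proof -
  consider "x < 0" | "x = 0" | "x > 0" by linarith
  then show ?thesis
  proof cases
    case 1
    have "((\<lambda>_. 0) has_real_derivative 0) (at x)" by simp
    then have "(flat_poly p has_real_derivative 0) (at x)"
      by (rule has_field_derivative_transform_within_open[of _ _ _ "{..<0}"]) (use 1 in \<open>auto simp: flat_poly_def\<close>)
    then show ?thesis using 1 by (simp add: flat_poly_def)
  next
    case 2
    \<comment> \<open>at the origin the difference quotient again belongs to the family, with \<open>p\<close> multiplied by the variable\<close>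
    have quot: "(flat_poly p y - flat_poly p 0) / (y - 0) = flat_poly (pCons 0 p) y" for y
      by (simp add: flat_poly_def)
    have "(flat_poly (pCons 0 p) \<longlongrightarrow> 0) (at_left 0)"
      by (rule Lim_transform_eventually[OF tendsto_const]) (auto simp: eventually_at_filter flat_poly_def)
    then have "(flat_poly (pCons 0 p) \<longlongrightarrow> 0) (at 0)"
      using flat_poly_tendsto_0 filterlim_split_at by blast
    then have "(flat_poly p has_real_derivative 0) (at 0)"
      unfolding has_field_derivative_iff quot by simp
    then show ?thesis using 2 by (simp add: flat_poly_def)
  next
    case 3
    have "((\<lambda>x. poly p (1 / x) * exp (- (1 / x))) has_real_derivative
      poly p (1 / x) * (exp (- (1 / x)) * (1 / x\<^sup>2)) + poly (pderiv p) (1 / x) * (- (1 / x\<^sup>2)) * exp (- (1 / x))) (at x)"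
      using 3 by (auto intro!: derivative_eq_intros DERIV_chain'[OF _ poly_DERIV] simp: power2_eq_square field_simps)
    moreover have "poly p (1 / x) * (exp (- (1 / x)) * (1 / x\<^sup>2)) + poly (pderiv p) (1 / x) * (- (1 / x\<^sup>2)) * exp (- (1 / x))
      = flat_poly (monom 1 2 * (p - pderiv p)) x"
      using 3 by (simp add: flat_poly_def poly_monom power_divide field_simps)
    ultimately have "((\<lambda>x. poly p (1 / x) * exp (- (1 / x))) has_real_derivative flat_poly (monom 1 2 * (p - pderiv p)) x) (at x)"
      by simp
    then show ?thesis
      by (rule has_field_derivative_transform_within_open[of _ _ _ "{0<..}"]) (use 3 in \<open>auto simp: flat_poly_def\<close>)
  qed
qed

definition flat :: "real \<Rightarrow> real" where
  "flat x = (if x > 0 then exp (- (1 / x)) else 0)"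

lemma smooth_flat: "smooth (\<lambda>x. complex_of_real (flat x))"
proof (rule smooth_coinduct[of _ "range (\<lambda>p x. complex_of_real (flat_poly p x))"])
  fix g assume "g \<in> range (\<lambda>p x. complex_of_real (flat_poly p x))"
  then obtain p where g: "g = (\<lambda>x. complex_of_real (flat_poly p x))" by blast
  show "\<exists>g'\<in>range (\<lambda>p x. complex_of_real (flat_poly p x)). \<forall>x. (g has_vector_derivative g' x) (at x)"
    unfolding g using DERIV_flat_poly[of p]
    by (intro bexI[of _ "\<lambda>x. complex_of_real (flat_poly (monom 1 2 * (p - pderiv p)) x)"])
      (auto intro!: has_vector_derivative_of_real simp: has_real_derivative_iff_has_vector_derivative)
next
  have "flat = flat_poly 1" by (simp add: fun_eq_iff flat_def flat_poly_def)
  then show "(\<lambda>x. complex_of_real (flat x)) \<in> range (\<lambda>p x. complex_of_real (flat_poly p x))" by (intro range_eqI[of _ _ 1]) simp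
qed

text \<open>
With \<open>a = 1 / (n + 2)\<close> this is \<open>exp (-a / (x - a)) * exp (-a / (1 - a - x))\<close> on \<open>{a<..<1 - a}\<close>. It is
supported inside the unit interval, stays below 1, and tends to 1 there as \<open>a\<close> tends to 0.
\<close>

definition cutoff :: "nat \<Rightarrow> real \<Rightarrow> real" where
  "cutoff n x = flat (real (n + 2) * x - 1) * flat (real (n + 2) * (1 - x) - 1)"

lemma smooth_cutoff: "smooth (\<lambda>x. complex_of_real (cutoff n x))"
proof -
  have "smooth (\<lambda>x. complex_of_real (flat (real (n + 2) * x + - 1)) * complex_of_real (flat (- real (n + 2) * x + (real (n + 2) - 1))))"
    by (intro smooth_mult smooth_affine[OF smooth_flat])
  then show ?thesis by (simp add: cutoff_def algebra_simps)
qed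

lemma cutoff_bounds: "0 \<le> cutoff n x" "cutoff n x \<le> 1"
  by (auto simp: cutoff_def flat_def intro!: mult_le_one)

lemma cutoff_support:
  assumes "cutoff n x \<noteq> 0"
  shows "1 / real (n + 2) \<le> x \<and> x \<le> 1 - 1 / real (n + 2)"
proof -
  have "real (n + 2) * x - 1 > 0" "real (n + 2) * (1 - x) - 1 > 0"
    using assms by (auto simp: cutoff_def flat_def split: if_splits)
  then show ?thesis by (simp add: field_simps)
qed

lemma cutoff_tendsto_1:
  assumes "0 < x" "x < 1"
  shows "(\<lambda>n. cutoff n x) \<longlonglongrightarrow> 1"
proof -
  have *: "(\<lambda>n. flat (real (n + 2) * y - 1)) \<longlonglongrightarrow> 1" if y: "y > 0" for y
  proof -
    have top: "filterlim (\<lambda>n. real (n + 2) * y - 1) at_top sequentially"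
      using y by real_asymp
    have "((\<lambda>t::real. exp (- (1 / t))) \<longlongrightarrow> 1) at_top" by real_asymp
    moreover have "\<forall>\<^sub>F t in at_top. exp (- (1 / t)) = flat t"
      using eventually_gt_at_top[of 0] by eventually_elim (simp add: flat_def)
    ultimately have "(flat \<longlongrightarrow> 1) at_top" by (rule Lim_transform_eventually)
    then show ?thesis by (rule filterlim_compose) (rule top)
  qed
  have "(\<lambda>n. cutoff n x) \<longlonglongrightarrow> 1 * 1"
    unfolding cutoff_def using assms by (intro tendsto_mult *) auto
  then show ?thesis by simp
qed

lemma test_functionI:
  assumes "smooth f" "0 < a" "b < 1" "\<And>x. f x \<noteq> 0 \<Longrightarrow> a \<le> x \<and> x \<le> b"
  shows "test_function f"
proof -
  have sub: "closure {x. f x \<noteq> 0} \<subseteq> {a..b}"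
    using assms(4) by (intro closure_minimal) auto
  moreover have "compact (closure {x. f x \<noteq> 0})"
    using sub compact_Icc closed_Int_compact[of "closure {x. f x \<noteq> 0}" "{a..b}"] by (simp add: Int_absorb2)
  ultimately show ?thesis using assms(1-3) unfolding test_function_def by (auto simp: subset_iff)
qed

lemma test_function_cutoff:
  assumes "smooth f"
  shows "test_function (\<lambda>x. complex_of_real (cutoff n x) * f x)"
proof (rule test_functionI)
  show "smooth (\<lambda>x. complex_of_real (cutoff n x) * f x)"
    by (intro smooth_mult smooth_cutoff assms)
  show "1 / real (n + 2) \<le> x \<and> x \<le> 1 - 1 / real (n + 2)" if "complex_of_real (cutoff n x) * f x \<noteq> 0" for x
    using that cutoff_support by auto
qed auto

lemma test_function_scale: "test_function f \<Longrightarrow> test_function (\<lambda>x. c * f x)"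
  unfolding test_function_def
proof (elim conjE, intro conjI smooth_cmult)
  assume "compact (closure {x. f x \<noteq> 0})" "closure {x. f x \<noteq> 0} \<subseteq> {0<..<1}"
  moreover have "closure {x. c * f x \<noteq> 0} \<subseteq> closure {x. f x \<noteq> 0}" by (intro closure_mono) auto
  ultimately show "compact (closure {x. c * f x \<noteq> 0})" "closure {x. c * f x \<noteq> 0} \<subseteq> {0<..<1}"
    using closed_Int_compact[of "closure {x. c * f x \<noteq> 0}" "closure {x. f x \<noteq> 0}"] by (auto simp: Int_absorb2)
qed

lemma test_function_add:
  assumes "test_function f" "test_function g"
  shows "test_function (\<lambda>x. f x + g x)"
proof -
  let ?K = "closure {x. f x \<noteq> 0} \<union> closure {x. g x \<noteq> 0}"
  have K: "compact ?K" "?K \<subseteq> {0<..<1}" using assms by (auto simp: test_function_def)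
  have "closure {x. f x + g x \<noteq> 0} \<subseteq> closure ({x. f x \<noteq> 0} \<union> {x. g x \<noteq> 0})" by (intro closure_mono) auto
  then have sub: "closure {x. f x + g x \<noteq> 0} \<subseteq> ?K" by (simp only: closure_Un)
  then have "compact (closure {x. f x + g x \<noteq> 0})"
    using K(1) closed_Int_compact[of "closure {x. f x + g x \<noteq> 0}" ?K] by (simp add: Int_absorb2)
  then show ?thesis
    using assms K sub unfolding test_function_def by (auto intro: smooth_add)
qed

lemma test_functionE:
  assumes "test_function f"
  obtains f' where "\<And>x. (f has_vector_derivative f' x) (at x)" "continuous_on UNIV f'"
    "continuous_on UNIV f" "f 0 = 0" "f 1 = 0" "(\<lambda>x. vector_derivative f (at x)) = f'"
proof -
  have "smooth f" using assms by (simp add: test_function_def)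
  then obtain f' where f': "smooth f'" "\<And>x. (f has_vector_derivative f' x) (at x)" by (rule smoothE) blast
  obtain f'' where "\<And>x. (f' has_vector_derivative f'' x) (at x)" using smoothE[OF f'(1)] by blast
  then have "continuous_on UNIV f'"
    by (intro continuous_at_imp_continuous_on) (auto intro: has_vector_derivative_continuous)
  moreover have "continuous_on UNIV f"
    using f'(2) by (intro continuous_at_imp_continuous_on) (auto intro: has_vector_derivative_continuous)
  moreover have "f x = 0" if "x \<notin> {0<..<1}" for x
    using assms that closure_subset[of "{x. f x \<noteq> 0}"] unfolding test_function_def by blast
  moreover have "(\<lambda>x. vector_derivative f (at x)) = f'"
    using vector_derivative_at[OF f'(2)] by (simp add: fun_eq_iff)
  ultimately show ?thesis by (intro that[of f'] f'(2)) auto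
qed

section \<open>The phase function and the sum of the weights\<close>

text \<open>
The real numbers \<open>l\<close> for which \<open>u x = exp (i l x)\<close> satisfies the boundary condition
\<open>u 1 + u' 1 = cis \<theta> * (u 0 - u' 0)\<close> that characterises the domain of \<open>A_op \<theta>\<close>.
\<close>

definition boundary_roots :: "real \<Rightarrow> real set" where
  "boundary_roots \<theta> = {l. cis l * (1 + \<i> * of_real l) = cis \<theta> * (1 - \<i> * of_real l)}"

definition phase :: "real \<Rightarrow> real" where
  "phase l = l + 2 * arctan l"

definition phase_inv :: "real \<Rightarrow> real" where
  "phase_inv = inv phase"

lemma isCont_phase: "isCont phase l"
  unfolding phase_def by (intro continuous_intros)

lemma strict_mono_phase: "strict_mono phase"
  by (auto simp: strict_mono_def phase_def intro!: add_strict_mono arctan_monotone)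

lemma phase_near: "\<bar>phase l - l\<bar> \<le> pi"
  using arctan_lbound[of l] arctan_ubound[of l] by (auto simp: phase_def abs_le_iff)

lemma phase_phase_inv [simp]: "phase (phase_inv t) = t"
proof -
  have "\<exists>l\<ge>t - pi. l \<le> t + pi \<and> phase l = t"
    using phase_near[of "t - pi"] phase_near[of "t + pi"] isCont_phase by (intro IVT) auto
  then have "t \<in> range phase" by (metis rangeI)
  then show ?thesis by (simp add: phase_inv_def f_inv_into_f)
qed

lemma phase_inv_phase [simp]: "phase_inv (phase l) = l"
  using strict_mono_phase by (simp add: phase_inv_def strict_mono_imp_inj_on)

lemma phase_inv_inj: "phase_inv s = phase_inv t \<longleftrightarrow> s = t"
  by (metis phase_phase_inv)

lemma phase_inv_near: "\<bar>phase_inv t - t\<bar> \<le> pi"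
  using phase_near[of "phase_inv t"] by (simp add: abs_minus_commute)

lemma cis_arctan: "1 + \<i> * of_real l = of_real (sqrt (1 + l\<^sup>2)) * cis (arctan l)"
proof -
  have "sqrt (1 + l\<^sup>2) \<noteq> 0" by (simp add: add_nonneg_eq_0_iff)
  then show ?thesis by (simp add: complex_eq_iff cos_arctan sin_arctan)
qed

text \<open>
Since \<open>1 + i l\<close> has argument \<open>arctan l\<close> and \<open>1 - i l\<close> has the same modulus and the opposite
argument, the boundary condition compares the arguments \<open>l + arctan l\<close> and \<open>\<theta> - arctan l\<close>.
\<close>

lemma phase_inv_in_roots:
  assumes "k \<in> \<int>"
  shows "phase_inv (\<theta> + 2 * pi * k) \<in> boundary_roots \<theta>"
proof -
  define l where "l = phase_inv (\<theta> + 2 * pi * k)"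
  have "l + 2 * arctan l = \<theta> + 2 * pi * k"
    using phase_phase_inv[of "\<theta> + 2 * pi * k"] by (simp add: phase_def l_def)
  then have "l + arctan l = (\<theta> - arctan l) + 2 * pi * k" by simp
  then have "cis (l + arctan l) = cis (\<theta> - arctan l) * cis (2 * pi * k)"
    by (simp only: cis_mult)
  then have "cis (l + arctan l) = cis (\<theta> - arctan l)"
    using assms by (simp add: cis_multiple_2pi)
  then have "cis l * cis (arctan l) = cis \<theta> * cis (arctan (- l))"
    by (simp add: cis_mult arctan_minus)
  moreover have "1 - \<i> * of_real l = of_real (sqrt (1 + l\<^sup>2)) * cis (arctan (- l))"
    using cis_arctan[of "- l"] by simp
  ultimately have "cis l * (1 + \<i> * of_real l) = cis \<theta> * (1 - \<i> * of_real l)"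
    unfolding cis_arctan[of l] by (simp add: mult.left_commute)
  then show ?thesis by (simp add: boundary_roots_def l_def)
qed

lemma DERIV_phase_inv:
  "(phase_inv has_real_derivative (1 + (phase_inv t)\<^sup>2) / (3 + (phase_inv t)\<^sup>2)) (at t)"
proof -
  define l where "l = phase_inv t"
  have pos: "1 + l\<^sup>2 > 0" "3 + l\<^sup>2 > 0" by (simp_all add: add_pos_nonneg)
  have "(phase has_real_derivative 1 + 2 * inverse (1 + l\<^sup>2)) (at l)"
    unfolding phase_def by (auto intro!: derivative_eq_intros)
  moreover have "1 + 2 * inverse (1 + l\<^sup>2) = (3 + l\<^sup>2) / (1 + l\<^sup>2)"
    using pos by (simp add: field_simps)
  ultimately have d: "(phase has_real_derivative (3 + l\<^sup>2) / (1 + l\<^sup>2)) (at l)" by simp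
  have "isCont phase_inv (phase l)"
    by (rule isCont_inverse_function[of 1]) (auto intro: isCont_phase)
  then have "isCont phase_inv t" by (simp add: l_def)
  then have "(phase_inv has_real_derivative inverse ((3 + l\<^sup>2) / (1 + l\<^sup>2))) (at t)"
    using d pos by (intro DERIV_inverse_function[where a = "t - 1" and b = "t + 1" and f = phase]) (auto simp: l_def)
  then show ?thesis by (simp add: l_def)
qed

definition weight :: "real \<Rightarrow> real" where
  "weight t = 2 / ((phase_inv t)\<^sup>2 + 3)"

text \<open>
The primitive \<open>s - phase_inv s\<close> equals \<open>2 * arctan (phase_inv s)\<close>, so its total variation over the
line is \<open>2 * pi\<close>.
\<close>

lemma DERIV_weight_primitive:
  "((\<lambda>s. s - phase_inv s) has_real_derivative weight t) (at t)"
proof -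
  have pos: "3 + (phase_inv t)\<^sup>2 > 0" by (simp add: add_pos_nonneg)
  have "((\<lambda>s. s - phase_inv s) has_real_derivative 1 - (1 + (phase_inv t)\<^sup>2) / (3 + (phase_inv t)\<^sup>2)) (at t)"
    by (intro derivative_intros DERIV_phase_inv)
  moreover have "1 - (1 + (phase_inv t)\<^sup>2) / (3 + (phase_inv t)\<^sup>2) = weight t"
    using pos by (simp add: weight_def field_simps)
  ultimately show ?thesis by simp
qed

text \<open>
In terms of \<open>l = phase_inv t\<close> and \<open>p = l^2 + 3\<close> the derivative is \<open>-4 l (1 + l^2) / p^3\<close>; now
\<open>-2 l \<le> 1 + l^2 \<le> p\<close> bounds it by \<open>2 / p\<close>.
\<close>

lemma DERIV_weight: "\<exists>d. (weight has_real_derivative d) (at t) \<and> d \<le> weight t"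
proof -
  define l where "l = phase_inv t"
  define p where "p = 3 + l\<^sup>2"
  have p: "p > 0" "l\<^sup>2 + 3 = p" by (simp_all add: p_def add_pos_nonneg)
  have "(weight has_real_derivative (0 * ((phase_inv t)\<^sup>2 + 3) - 2 * (real 2 * (phase_inv t ^ (2 - 1) * ((1 + l\<^sup>2) / p)) + 0))
      / (((phase_inv t)\<^sup>2 + 3) * ((phase_inv t)\<^sup>2 + 3))) (at t)"
    unfolding weight_def
  proof (intro DERIV_divide DERIV_const DERIV_add)
    show "((\<lambda>s. (phase_inv s)\<^sup>2) has_real_derivative real 2 * (phase_inv t ^ (2 - 1) * ((1 + l\<^sup>2) / p))) (at t)"
      using DERIV_power[OF DERIV_phase_inv[of t], of 2] by (simp add: l_def p_def mult_ac)
    show "(phase_inv t)\<^sup>2 + 3 \<noteq> 0" using p by (simp add: l_def)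
  qed
  then have "(weight has_real_derivative - 2 * (2 * l * ((1 + l\<^sup>2) / p)) / p\<^sup>2) (at t)"
    by (simp add: l_def[symmetric] p(2) power2_eq_square[of p])
  moreover have "- 2 * (2 * l * ((1 + l\<^sup>2) / p)) / p\<^sup>2 \<le> weight t"
  proof -
    have "0 \<le> (1 + l)\<^sup>2" by simp
    then have a: "- (2 * l) \<le> p" by (simp add: p_def power2_eq_square algebra_simps)
    have "- (2 * l) * (1 + l\<^sup>2) \<le> p * (1 + l\<^sup>2)" using a by (intro mult_right_mono) auto
    also have "\<dots> \<le> p * p" using p by (intro mult_left_mono) (auto simp: p_def)
    finally have "2 * (- (2 * l) * (1 + l\<^sup>2)) / p ^ 3 \<le> 2 * (p * p) / p ^ 3"
      using p by (intro divide_right_mono mult_left_mono) auto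
    moreover have "2 * (p * p) / p ^ 3 = weight t" using p by (simp add: weight_def l_def[symmetric] power3_eq_cube)
    moreover have "- 2 * (2 * l * (m / p)) / p\<^sup>2 = 2 * (- (2 * l) * m) / p ^ 3" for m
      using p by (simp add: power3_eq_cube power2_eq_square)
    ultimately show ?thesis by (simp only:)
  qed
  ultimately show ?thesis by blast
qed

definition weight_sum :: "nat \<Rightarrow> real \<Rightarrow> real" where
  "weight_sum M t = (\<Sum>n<2 * M + 1. weight (t + 2 * pi * (real n - real M)))"

text \<open>
Let \<open>g\<close> be a partial sum and \<open>G\<close> its primitive. The growth of \<open>G\<close> over a period telescopes and
tends to \<open>2 * pi\<close>. On \<open>[t + h, t + 2 pi]\<close> the growth is at most the length of the interval,
since \<open>g \<le> 1\<close>; so nearly the full growth \<open>h\<close> must occur on \<open>[t, t + h]\<close>, and \<open>g\<close> is nearly 1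
somewhere in it. As \<open>g' \<le> g \<le> 1\<close>, the value of \<open>g\<close> at \<open>t\<close> is smaller by at most \<open>h\<close>.
\<close>

theorem weight_sum_tendsto_one:
  assumes bessel: "\<And>M t. weight_sum M t \<le> 1" and e: "e > 0"
  shows "\<exists>M. weight_sum M t > 1 - e"
proof -
  define q where "q s = s - phase_inv s" for s
  define G where "G M s = (\<Sum>n<2 * M + 1. q (s + 2 * pi * (real n - real M)))" for M s
  have dG: "(G M has_real_derivative weight_sum M s) (at s)" for M s
    unfolding G_def weight_sum_def q_def
  proof (rule DERIV_sum)
    fix n
    show "((\<lambda>s. s + 2 * pi * (real n - real M) - phase_inv (s + 2 * pi * (real n - real M)))
       has_real_derivative weight (s + 2 * pi * (real n - real M))) (at s)"
      using DERIV_weight_primitive[of "s + 2 * pi * (real n - real M)"] by (rule DERIV_shift[THEN iffD1])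
  qed
  have dg: "\<exists>d. (weight_sum M has_real_derivative d) (at s) \<and> d \<le> 1" for M s
  proof -
    define a where "a n = s + 2 * pi * (real n - real M)" for n
    have "\<forall>n. \<exists>d. (weight has_real_derivative d) (at (a n)) \<and> d \<le> weight (a n)"
      using DERIV_weight by blast
    then obtain d where d: "\<And>n. (weight has_real_derivative d n) (at (a n))" "\<And>n. d n \<le> weight (a n)"
      by (auto dest!: choice)
    have "(weight_sum M has_real_derivative (\<Sum>n<2 * M + 1. d n)) (at s)"
      unfolding weight_sum_def
      by (rule DERIV_sum) (use d(1) in \<open>auto simp: DERIV_shift a_def\<close>)
    moreover have "(\<Sum>n<2 * M + 1. d n) \<le> weight_sum M s"
      unfolding weight_sum_def using d(2) by (intro sum_mono) (auto simp: a_def)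
    ultimately show ?thesis using bessel[of M s] by force
  qed
  define h where "h = min 1 (e / 2)"
  have h: "0 < h" "h \<le> 1" "h \<le> e / 2" using e by (auto simp: h_def)
  have tele: "G M (t + 2 * pi) - G M t = q (t + 2 * pi * (real M + 1)) - q (t - 2 * pi * real M)" for M
  proof -
    define f where "f n = q (t + 2 * pi * (real n - real M))" for n
    have "G M (t + 2 * pi) - G M t = (\<Sum>n<2 * M + 1. f (Suc n) - f n)"
      unfolding G_def sum_subtractf[symmetric] by (intro sum.cong) (auto simp: f_def algebra_simps)
    also have "\<dots> = f (2 * M + 1) - f 0" by (rule sum_lessThan_telescope)
    finally show ?thesis by (simp add: f_def algebra_simps)
  qed
  have q_arctan: "q s = 2 * arctan (phase_inv s)" for s
    using phase_phase_inv[of s] by (simp add: q_def phase_def)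
  have top: "filterlim phase_inv at_top at_top"
  proof (rule filterlim_at_top_mono)
    show "filterlim (\<lambda>s. s - pi) at_top at_top" by real_asymp
    show "\<forall>\<^sub>F s in at_top. s - pi \<le> phase_inv s"
      using phase_inv_near unfolding abs_le_iff by (intro always_eventually allI) (auto simp: algebra_simps)
  qed
  have bot: "filterlim phase_inv at_bot at_bot"
  proof (rule filterlim_at_bot_mono)
    show "filterlim (\<lambda>s. s + pi) at_bot at_bot" by real_asymp
    show "\<forall>\<^sub>F s in at_bot. phase_inv s \<le> s + pi"
      using phase_inv_near unfolding abs_le_iff by (intro always_eventually allI) (auto simp: algebra_simps)
  qed
  have "(\<lambda>M. q (t + 2 * pi * (real M + 1)) - q (t - 2 * pi * real M)) \<longlonglongrightarrow> 2 * (pi / 2) - 2 * (- (pi / 2))"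
    unfolding q_arctan
  proof (intro tendsto_intros)
    have "filterlim (\<lambda>M. t + 2 * pi * (real M + 1)) at_top sequentially" by real_asymp
    then show "(\<lambda>M. arctan (phase_inv (t + 2 * pi * (real M + 1)))) \<longlonglongrightarrow> pi / 2"
      by (rule filterlim_compose[OF tendsto_arctan_at_top filterlim_compose[OF top]])
    have "filterlim (\<lambda>M. t - 2 * pi * real M) at_bot sequentially" by real_asymp
    then show "(\<lambda>M. arctan (phase_inv (t - 2 * pi * real M))) \<longlonglongrightarrow> - (pi / 2)"
      by (rule filterlim_compose[OF tendsto_arctan_at_bot filterlim_compose[OF bot]])
  qed
  then have "(\<lambda>M. G M (t + 2 * pi) - G M t) \<longlonglongrightarrow> 2 * pi" by (simp add: tele)
  moreover have "2 * pi - h * (e / 2) < 2 * pi" using h e by simp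
  ultimately have "\<forall>\<^sub>F M in sequentially. 2 * pi - h * (e / 2) < G M (t + 2 * pi) - G M t"
    by (rule order_tendstoD)
  then obtain M where M: "2 * pi - h * (e / 2) < G M (t + 2 * pi) - G M t"
    by (auto simp: eventually_sequentially)
  have h2: "h < 2 * pi" using h pi_gt3 by simp
  obtain z where z: "t < z" "z < t + h" "G M (t + h) - G M t = (t + h - t) * weight_sum M z"
    using MVT2[of t "t + h" "G M" "weight_sum M"] dG h by auto
  obtain y where y: "G M (t + 2 * pi) - G M (t + h) = (t + 2 * pi - (t + h)) * weight_sum M y"
    using MVT2[of "t + h" "t + 2 * pi" "G M" "weight_sum M"] dG h2 by auto
  have "\<forall>s. \<exists>d. (weight_sum M has_real_derivative d) (at s) \<and> d \<le> 1" using dg by blast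
  then obtain g' where g': "\<And>s. (weight_sum M has_real_derivative g' s) (at s)" "\<And>s. g' s \<le> 1"
    by (auto dest!: choice)
  obtain x where x: "weight_sum M z - weight_sum M t = (z - t) * g' x"
    using MVT2[of t z "weight_sum M" "g'"] g'(1) z(1) by auto
  have "(2 * pi - h) * weight_sum M y \<le> (2 * pi - h) * 1"
    using h2 bessel[of M y] by (intro mult_left_mono) auto
  then have "h - h * (e / 2) < h * weight_sum M z" using M y z(3) by (simp add: algebra_simps)
  moreover have "h - h * (e / 2) = h * (1 - e / 2)" by (simp add: algebra_simps)
  ultimately have "1 - e / 2 < weight_sum M z" using h(1) by simp
  moreover have "(z - t) * g' x \<le> (z - t) * 1" using z g'(2) by (intro mult_left_mono) auto
  ultimately have "1 - e < weight_sum M t" using x z(1,2) h(3) unfolding mult_1_right by linarith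
  then show ?thesis by blast
qed

section \<open>The Hilbert space of the exponential kernel\<close>

text \<open>
Induction on the smallest point \<open>b\<close> of \<open>S\<close>. Subtracting the constant \<open>g b\<close> from the kernel splits off
\<open>g b * |\<Sum> a|^2\<close>, and the remaining kernel vanishes as soon as one of its arguments is \<open>b\<close>.
\<close>

lemma min_kernel_nonneg:
  fixes S :: "real set" and g :: "real \<Rightarrow> real" and a :: "real \<Rightarrow> complex"
  assumes "finite S" "\<And>x. x \<in> S \<Longrightarrow> 0 \<le> g x" "\<And>x y. x \<in> S \<Longrightarrow> y \<in> S \<Longrightarrow> x \<le> y \<Longrightarrow> g x \<le> g y"
  shows "0 \<le> Re (\<Sum>x\<in>S. \<Sum>y\<in>S. cnj (a x) * a y * of_real (g (min x y)))"
  using assms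
proof (induction S arbitrary: g rule: finite_linorder_min_induct)
  case empty
  then show ?case by simp
next
  case (insert b A)
  let ?q = "\<lambda>S g. \<Sum>x\<in>S. \<Sum>y\<in>S. cnj (a x) * a y * complex_of_real (g x y)"
  define h where "h x = g x - g b" for x
  have mb: "min b x = b" "min x b = b" if "x \<in> insert b A" for x using insert.hyps that by auto
  have "?q (insert b A) (\<lambda>x y. g (min x y)) = ?q (insert b A) (\<lambda>x y. g b) + ?q (insert b A) (\<lambda>x y. h (min x y))"
    by (simp add: h_def algebra_simps flip: sum.distrib)
  also have "?q (insert b A) (\<lambda>x y. g b) = of_real (g b) * (cnj (\<Sum>x\<in>insert b A. a x) * (\<Sum>y\<in>insert b A. a y))"
    unfolding cnj_sum sum_product unfolding sum_distrib_left
    by (intro sum.cong refl) (simp add: mult_ac)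
  also have "cnj (\<Sum>x\<in>insert b A. a x) * (\<Sum>y\<in>insert b A. a y) = of_real ((cmod (\<Sum>x\<in>insert b A. a x))\<^sup>2)"
    unfolding complex_norm_square by (rule mult.commute)
  also have "?q (insert b A) (\<lambda>x y. h (min x y)) = ?q A (\<lambda>x y. h (min x y))"
  proof (rule sum.mono_neutral_cong_right)
    show "\<forall>x\<in>insert b A - A. (\<Sum>y\<in>insert b A. cnj (a x) * a y * complex_of_real (h (min x y))) = 0"
      by (auto intro!: sum.neutral simp: mb h_def)
    show "(\<Sum>y\<in>insert b A. cnj (a x) * a y * complex_of_real (h (min x y))) = (\<Sum>y\<in>A. cnj (a x) * a y * complex_of_real (h (min x y)))"
      if "x \<in> A" for x
      using insert.hyps that by (intro sum.mono_neutral_right) (auto simp: mb h_def)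
  qed (use insert.hyps in auto)
  finally have eq: "?q (insert b A) (\<lambda>x y. g (min x y)) =
    of_real (g b) * of_real ((cmod (\<Sum>x\<in>insert b A. a x))\<^sup>2) + ?q A (\<lambda>x y. h (min x y))" .
  have "0 \<le> Re (?q A (\<lambda>x y. h (min x y)))"
  proof (rule insert.IH)
    show "0 \<le> h x" if "x \<in> A" for x
      using insert.prems(2)[of b x] insert.hyps that by (simp add: h_def less_imp_le)
    show "h x \<le> h y" if "x \<in> A" "y \<in> A" "x \<le> y" for x y
      using insert.prems(2)[of x y] that by (simp add: h_def)
  qed
  moreover have "0 \<le> Re (of_real (g b) * of_real ((cmod (\<Sum>x\<in>insert b A. a x))\<^sup>2))"
    using insert.prems(1)[of b] by (simp only: of_real_mult[symmetric] Re_complex_of_real) simp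
  ultimately show ?case unfolding eq plus_complex.sel by (rule add_nonneg_nonneg[rotated])
qed

text \<open>
Because \<open>exp (-|x - y|) = exp (-x) * exp (-y) * exp (2 * min x y)\<close>, the exponential kernel is a
rescaling of a kernel of the form treated before.
\<close>

lemma exp_kernel_psd: "0 \<le> Re (kernel_form exp_kernel c c)"
proof -
  define a where "a x = lookup c x * of_real (exp (- x))" for x
  have k: "exp_kernel (x - y) = of_real (exp (- x)) * of_real (exp (- y)) * of_real (exp (2 * min x y))" for x y
    unfolding exp_kernel_def of_real_mult[symmetric] exp_add[symmetric] by (simp add: min_def abs_if)
  have "kernel_form exp_kernel c c = (\<Sum>x\<in>keys c. \<Sum>y\<in>keys c. cnj (a x) * a y * of_real (exp (2 * min x y)))"
    unfolding kernel_form_def k a_def by (simp add: mult_ac)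
  then show ?thesis using min_kernel_nonneg[of "keys c" "\<lambda>x. exp (2 * x)" a] by simp
qed

interpretation E: pd_kernel exp_kernel
  by unfold_locales (simp_all add: exp_kernel_psd, simp add: exp_kernel_def)

abbreviation H :: "(real \<Rightarrow> complex) set" where
  "H \<equiv> rkhs exp_kernel"

abbreviation inner_H :: "(real \<Rightarrow> complex) \<Rightarrow> (real \<Rightarrow> complex) \<Rightarrow> complex" where
  "inner_H \<equiv> rkhs_inner exp_kernel"

abbreviation norm_H :: "(real \<Rightarrow> complex) \<Rightarrow> real" where
  "norm_H \<equiv> E.H.nrm"

lemma norm_K: "x \<in> {0<..<1} \<Longrightarrow> norm_H (E.K x) = 1"
  by (simp add: E.H.nrm_def E.reproducing) (simp add: E.K_def on01_def exp_kernel_def)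

lemma norm_K_diff:
  assumes "x \<in> {0<..<1}" "y \<in> {0<..<1}"
  shows "(norm_H (E.K x - E.K y))\<^sup>2 \<le> 2 * \<bar>x - y\<bar>"
proof -
  define t where "t = \<bar>x - y\<bar>"
  have "Re (inner_H (E.K x) (E.K y)) = exp (- t)"
    using assms by (simp add: E.reproducing) (simp add: E.K_def on01_def exp_kernel_def t_def)
  moreover have "(norm_H (E.K x - E.K y))\<^sup>2 = 2 - 2 * Re (inner_H (E.K x) (E.K y))"
    using E.H.nrm_add_sq[of "E.K x" "- E.K y"] assms by (simp add: E.H.nrm_minus E.H.ip_minus_right norm_K)
  ultimately show ?thesis
    unfolding t_def[symmetric] using exp_ge_add_one_self[of "- t"] by simp
qed

lemma rkhs_pointwise_bound: "f \<in> H \<Longrightarrow> cmod (f x) \<le> norm_H f"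
  using E.H.Cauchy_Schwarz[of "E.K x" f] E.reproducing[of f x] norm_K[of x] E.rkhs_outside[of f x]
  by (cases "x \<in> {0<..<1}") auto

lemma rkhs_continuous:
  assumes f: "f \<in> H"
  shows "continuous_on {0<..<1} f"
  unfolding continuous_on_iff
proof (intro ballI allI impI)
  fix x e :: real assume x: "x \<in> {0<..<1}" and e: "e > 0"
  define C where "C = norm_H f + 1"
  have C: "C > 0" using f by (simp add: C_def add_nonneg_pos)
  show "\<exists>d>0. \<forall>y\<in>{0<..<1}. dist y x < d \<longrightarrow> dist (f y) (f x) < e"
  proof (intro exI[of _ "(e / C)\<^sup>2 / 2"] conjI ballI impI)
    show "(e / C)\<^sup>2 / 2 > 0" using e C by simp
    fix y assume y: "y \<in> {0<..<1}" "dist y x < (e / C)\<^sup>2 / 2"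
    have "(norm_H (E.K y - E.K x))\<^sup>2 < (e / C)\<^sup>2"
      using norm_K_diff[OF y(1) x] y(2) by (simp add: dist_norm)
    then have k: "norm_H (E.K y - E.K x) < e / C" using e C by (simp add: power_less_imp_less_base)
    have "f y - f x = inner_H (E.K y - E.K x) f"
      using x y f by (simp add: E.H.ip_diff_left E.reproducing)
    then have "cmod (f y - f x) \<le> norm_H (E.K y - E.K x) * norm_H f"
      using E.H.Cauchy_Schwarz[of "E.K y - E.K x" f] x y f by (simp del: minus_apply)
    also have "\<dots> \<le> norm_H (E.K y - E.K x) * C"
      using x y by (intro mult_left_mono) (auto simp: C_def simp del: minus_apply)
    also have "\<dots> < e / C * C" using k C by (intro mult_strict_right_mono)
    finally show "dist (f y) (f x) < e" using C by (simp add: dist_norm)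
  qed
qed

text \<open>
The translates centred at the endpoints belong to the space and still reproduce the (continuous)
boundary values: by \<open>norm_K_diff\<close> translates depend continuously on their centre, so one may
pass to the limit from the interior.
\<close>

lemma K_boundary:
  assumes a: "a \<in> {0..1}"
  shows "E.K a \<in> H"
    and "\<And>g. continuous_on {0..1} g \<Longrightarrow> on01 g \<in> H \<Longrightarrow> inner_H (E.K a) (on01 g) = g a"
proof -
  \<comment> \<open>an interior sequence that tends to the point \<open>a\<close>, whichever endpoint or interior point it is\<close>
  define x where "x n = a + (1 / 2 - a) * (1 / real (n + 2))" for n
  have x01: "x n \<in> {0<..<1}" for n
  proof -
    define s where "s = 1 / real (n + 2)"
    define p where "p = a * (1 - s)"
    have s: "0 < s" "s \<le> 1 / 2" by (auto simp: s_def field_simps)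
    have "x n = a + (1 / 2 - a) * s" by (simp only: x_def s_def)
    then have "x n = p + s / 2" by (simp add: p_def algebra_simps)
    moreover have "p \<le> 1 - s" "0 \<le> p"
      using mult_right_mono[of a 1 "1 - s"] mult_nonneg_nonneg[of a "1 - s"] a s unfolding p_def by simp_all
    ultimately show ?thesis using s by simp
  qed
  have x_lim: "x \<longlonglongrightarrow> a" unfolding x_def by real_asymp
  have "E.H.cauchy_seq (\<lambda>n. E.K (x n))"
    unfolding E.H.cauchy_seq_def
  proof (intro allI impI)
    fix e :: real assume e: "e > 0"
    then have "e\<^sup>2 / 2 > 0" by simp
    then obtain N where N: "\<And>m n. m \<ge> N \<Longrightarrow> n \<ge> N \<Longrightarrow> dist (x m) (x n) < e\<^sup>2 / 2"
      using metric_CauchyD[OF LIMSEQ_imp_Cauchy[OF x_lim]] by blast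
    have "norm_H (E.K (x m) - E.K (x n)) < e" if "m \<ge> N" "n \<ge> N" for m n
    proof -
      have "(norm_H (E.K (x m) - E.K (x n)))\<^sup>2 < e\<^sup>2"
        using norm_K_diff[OF x01[of m] x01[of n]] N[OF that] by (simp add: dist_norm)
      then show ?thesis using e by (simp add: power_less_imp_less_base)
    qed
    then show "\<exists>N. \<forall>m\<ge>N. \<forall>n\<ge>N. norm_H (E.K (x m) - E.K (x n)) < e" by blast
  qed
  then obtain l where l: "l \<in> H" "(\<lambda>n. norm_H (E.K (x n) - l)) \<longlonglongrightarrow> 0"
    using E.H.complete[of "\<lambda>n. E.K (x n)"] x01 by auto
  have "l y = E.K a y" for y
  proof (cases "y \<in> {0<..<1}")
    case True
    have "(\<lambda>n. inner_H (E.K y) (E.K (x n))) \<longlonglongrightarrow> inner_H (E.K y) l"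
      using True x01 l by (intro E.H.ip_tendsto_right) auto
    then have "(\<lambda>n. E.K (x n) y) \<longlonglongrightarrow> l y"
      using True x01 l by (simp add: E.reproducing)
    moreover have "(\<lambda>n. E.K (x n) y) \<longlonglongrightarrow> E.K a y"
      unfolding E.K_def on01_def exp_kernel_def using True x_lim by (auto intro!: tendsto_intros)
    ultimately show ?thesis by (rule LIMSEQ_unique)
  next
    case False
    then show ?thesis using E.rkhs_outside[OF l(1)] by (auto simp: E.K_def on01_def)
  qed
  then have "l = E.K a" by auto
  then show "E.K a \<in> H" using l by simp
  fix g :: "real \<Rightarrow> complex" assume g: "continuous_on {0..1} g" "on01 g \<in> H"
  have "(\<lambda>n. inner_H (E.K (x n)) (on01 g)) \<longlonglongrightarrow> inner_H (E.K a) (on01 g)"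
    using E.H.ip_tendsto[of "\<lambda>n. E.K (x n)" l "\<lambda>_. on01 g" "on01 g"] x01 l g \<open>l = E.K a\<close> by simp
  then have "(\<lambda>n. g (x n)) \<longlonglongrightarrow> inner_H (E.K a) (on01 g)"
    using x01 g by (simp add: E.reproducing) (simp add: on01_def)
  moreover have "(\<lambda>n. g (x n)) \<longlonglongrightarrow> g a"
    by (rule continuous_on_tendsto_compose[OF g(1) x_lim a])
       (use x01 in \<open>auto intro!: always_eventually simp: less_imp_le\<close>)
  ultimately show "inner_H (E.K a) (on01 g) = g a" by (rule LIMSEQ_unique)
qed

lemma integral_Icc_cong:
  fixes f g :: "real \<Rightarrow> complex"
  assumes "\<And>x. x \<in> {0<..<1} \<Longrightarrow> f x = g x"
  shows "integral {0..1} f = integral {0..1} g"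
  by (rule integral_spike[of "{0, 1}"]) (use assms in auto)

lemma integrable_bounded_continuous_Ioo:
  fixes f :: "real \<Rightarrow> complex"
  assumes "continuous_on {0<..<1} f" "\<And>x. x \<in> {0<..<1} \<Longrightarrow> cmod (f x) \<le> C"
  shows "f integrable_on {0..1}"
proof -
  have "f \<in> borel_measurable (lebesgue_on {0<..<1})"
    using assms(1) by (intro continuous_imp_measurable_on_sets_lebesgue) auto
  then have "f integrable_on {0<..<1}"
    by (rule measurable_bounded_by_integrable_imp_integrable[where g = "\<lambda>_. C"])
      (use assms(2) in \<open>auto simp: integrable_on_Icc_iff_Ioo[symmetric]\<close>)
  then show ?thesis by (simp add: integrable_on_Icc_iff_Ioo)
qed

lemma continuous_Icc_bound:
  fixes \<phi> :: "real \<Rightarrow> complex"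
  assumes "continuous_on {0..1} \<phi>"
  obtains C where "C \<ge> 0" "\<And>y. y \<in> {0..1} \<Longrightarrow> cmod (\<phi> y) \<le> C"
proof -
  have "bounded (\<phi> ` {0..1})"
    by (intro compact_imp_bounded compact_continuous_image assms compact_Icc)
  then obtain C where "\<forall>z\<in>\<phi> ` {0..1}. cmod z \<le> C" unfolding bounded_iff by blast
  then have "cmod (\<phi> y) \<le> max C 0" if "y \<in> {0..1}" for y using that by (auto simp: le_max_iff_disj)
  then show ?thesis using that[of "max C 0"] by simp
qed

lemma test_pairing_integrable:
  assumes \<phi>: "continuous_on {0..1} \<phi>" and g: "g \<in> H"
  shows "(\<lambda>y. cnj (\<phi> y) * g y) integrable_on {0..1}"
proof -
  obtain C where C: "\<And>y. y \<in> {0..1} \<Longrightarrow> cmod (\<phi> y) \<le> C" and C0: "C \<ge> 0"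
    using continuous_Icc_bound[OF \<phi>] by blast
  show ?thesis
  proof (rule integrable_bounded_continuous_Ioo[of _ "C * norm_H g"])
    have "continuous_on {0<..<1} \<phi>" using \<phi> by (rule continuous_on_subset) auto
    then show "continuous_on {0<..<1} (\<lambda>y. cnj (\<phi> y) * g y)"
      using rkhs_continuous[OF g] by (intro continuous_intros)
    show "cmod (cnj (\<phi> y) * g y) \<le> C * norm_H g" if "y \<in> {0<..<1}" for y
      unfolding norm_mult complex_mod_cnj using that C[of y] rkhs_pointwise_bound[OF g] C0 by (intro mult_mono) auto
  qed
qed

abbreviation conv :: "(real \<Rightarrow> complex) \<Rightarrow> real \<Rightarrow> complex" where
  "conv \<equiv> F_conv exp_kernel"

text \<open>
Riesz's theorem gives a vector that represents integration against \<open>\<phi>\<close>; testing it against the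
translates of the kernel identifies it with the convolution.
\<close>

lemma conv_pairing:
  assumes \<phi>: "continuous_on {0..1} \<phi>"
  shows "conv \<phi> \<in> H" and "g \<in> H \<Longrightarrow> inner_H (conv \<phi>) g = integral {0..1} (\<lambda>y. cnj (\<phi> y) * g y)"
proof -
  define L where "L g = integral {0..1} (\<lambda>y. cnj (\<phi> y) * g y)" for g
  obtain C where C: "\<And>y. y \<in> {0..1} \<Longrightarrow> cmod (\<phi> y) \<le> C" and C0: "C \<ge> 0"
    using continuous_Icc_bound[OF \<phi>] by blast
  note int = test_pairing_integrable[OF \<phi>]
  have "\<exists>r\<in>H. \<forall>g\<in>H. inner_H r g = L g"
  proof (rule E.H.Riesz_representation[of L C])
    show "L (f + g) = L f + L g" if "f \<in> H" "g \<in> H" for f g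
      unfolding L_def using int[OF that(1)] int[OF that(2)] by (simp add: distrib_left integral_add)
    show "L (cscale a g) = a * L g" if "g \<in> H" for a g
      unfolding L_def by (simp add: cscale_def mult.left_commute)
    show "cmod (L g) \<le> C * norm_H g" if "g \<in> H" for g
    proof -
      have "cmod (L g) \<le> integral {0..1} (\<lambda>_::real. C * norm_H g)"
        unfolding L_def
      proof (rule integral_norm_bound_integral[OF int[OF that]])
        show "cmod (cnj (\<phi> y) * g y) \<le> C * norm_H g" if "y \<in> {0..1}" for y
          unfolding norm_mult complex_mod_cnj using that C[of y] rkhs_pointwise_bound[OF \<open>g \<in> H\<close>] C0 by (intro mult_mono) auto
      qed auto
      then show ?thesis by simp
    qed
  qed
  then obtain r where r: "r \<in> H" "\<And>g. g \<in> H \<Longrightarrow> inner_H r g = L g" by blast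
  have "r x = conv \<phi> x" for x
  proof (cases "x \<in> {0<..<1}")
    case True
    have "r x = inner_H (E.K x) r" using True r by (simp add: E.reproducing)
    also have "\<dots> = cnj (L (E.K x))"
      using True r E.H.ip_cnj[of r "E.K x"] by simp
    also have "\<dots> = integral {0..1} (\<lambda>y. \<phi> y * cnj (E.K x y))"
      unfolding L_def integral_cnj by simp
    also have "\<dots> = integral {0..1} (\<lambda>y. \<phi> y * exp_kernel (x - y))"
      by (rule integral_Icc_cong) (auto simp: E.K_def on01_def exp_kernel_def abs_minus_commute)
    finally show ?thesis using True by (simp add: F_conv_def on01_def)
  next
    case False
    then show ?thesis using E.rkhs_outside[OF r(1)] by (auto simp: F_conv_def on01_def)
  qed
  then have "r = conv \<phi>" by auto
  then show "conv \<phi> \<in> H" "g \<in> H \<Longrightarrow> inner_H (conv \<phi>) g = integral {0..1} (\<lambda>y. cnj (\<phi> y) * g y)"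
    using r by (auto simp: L_def)
qed

lemma conv_integrable:
  assumes "continuous_on {0..1} \<phi>"
  shows "(\<lambda>y. \<phi> y * exp_kernel (x - y)) integrable_on {0..1}"
  unfolding exp_kernel_def by (intro integrable_continuous_interval continuous_intros assms)

lemma conv_add:
  assumes "continuous_on {0..1} \<phi>" "continuous_on {0..1} \<psi>"
  shows "conv (\<lambda>x. \<phi> x + \<psi> x) = conv \<phi> + conv \<psi>"
  using integral_add[OF conv_integrable[OF assms(1)] conv_integrable[OF assms(2)]]
  by (auto simp: F_conv_def on01_def fun_eq_iff distrib_right)

lemma conv_scale: "conv (\<lambda>x. c * \<phi> x) = cscale c (conv \<phi>)"
  by (auto simp: F_conv_def on01_def fun_eq_iff cscale_def mult.assoc)

lemma conv_diff:
  assumes "continuous_on {0..1} \<phi>" "continuous_on {0..1} \<psi>"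
  shows "conv (\<lambda>x. \<phi> x - \<psi> x) = conv \<phi> - conv \<psi>"
  using integral_diff[OF conv_integrable[OF assms(1)] conv_integrable[OF assms(2)]]
  by (auto simp: F_conv_def on01_def fun_eq_iff left_diff_distrib)

text \<open>
From \<open>|F_\<phi>|^2 = \<integral> cnj \<phi> * F_\<phi>\<close>, where the second factor is pointwise at most its norm.
\<close>

lemma norm_conv_le:
  assumes \<phi>: "continuous_on {0..1} \<phi>"
  shows "norm_H (conv \<phi>) \<le> integral {0..1} (\<lambda>y. cmod (\<phi> y))"
proof -
  let ?r = "conv \<phi>"
  note r = conv_pairing[OF \<phi>]
  have n0: "0 \<le> norm_H ?r" using r(1) by simp
  have int: "(\<lambda>y. cmod (\<phi> y) * norm_H ?r) integrable_on {0..1}"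
    by (intro integrable_continuous_interval continuous_intros \<phi>)
  have "(norm_H ?r)\<^sup>2 = cmod (inner_H ?r ?r)" using r(1) by (simp add: E.H.ip_self norm_power)
  also have "\<dots> \<le> integral {0..1} (\<lambda>y. cmod (\<phi> y) * norm_H ?r)"
    unfolding r(2)[OF r(1)]
    by (rule integral_norm_bound_integral[OF test_pairing_integrable[OF \<phi> r(1)] int])
      (auto simp: norm_mult intro!: mult_left_mono rkhs_pointwise_bound r)
  also have "\<dots> = integral {0..1} (\<lambda>y. cmod (\<phi> y)) * norm_H ?r" by simp
  finally have "norm_H ?r * norm_H ?r \<le> integral {0..1} (\<lambda>y. cmod (\<phi> y)) * norm_H ?r"
    by (simp add: power2_eq_square)
  moreover have "0 \<le> integral {0..1} (\<lambda>y. cmod (\<phi> y))"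
    by (intro integral_nonneg integrable_continuous_interval continuous_intros \<phi>) auto
  ultimately show ?thesis using n0 by (cases "norm_H ?r = 0") (auto simp: mult_le_cancel_right)
qed

section \<open>Exponentials in the Hilbert space\<close>

text \<open>
Both the candidates for eigenvectors, with imaginary \<open>s\<close>, and the boundary translate \<open>K 0\<close>, with
\<open>s = -1\<close>, are exponentials.
\<close>

definition expo :: "complex \<Rightarrow> real \<Rightarrow> complex" where
  "expo s = on01 (\<lambda>x. exp (s * of_real x))"

lemma has_vector_derivative_exp:
  fixes s :: complex
  shows "((\<lambda>x. exp (s * of_real x)) has_vector_derivative s * exp (s * of_real x)) (at x within S)"
proof -
  have "((\<lambda>z. exp (s * z)) has_field_derivative s * exp (s * of_real x)) (at (of_real x))"
    by (auto intro!: derivative_eq_intros)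
  then show ?thesis
    by (rule has_vector_derivative_at_within[OF has_vector_derivative_real_field])
qed

lemma has_vector_derivative_exp_real:
  "((\<lambda>x. exp (complex_of_real x)) has_vector_derivative exp (of_real x)) (at x within S)"
  "((\<lambda>x. exp (- complex_of_real x)) has_vector_derivative - exp (- of_real x)) (at x within S)"
  using has_vector_derivative_exp[of 1] has_vector_derivative_exp[of "-1"] by simp_all

lemma integral_exp:
  fixes s :: complex
  assumes "s \<noteq> 0" "a \<le> b"
  shows "integral {a..b} (\<lambda>y. exp (s * of_real y)) = (exp (s * of_real b) - exp (s * of_real a)) / s"
proof -
  have "((\<lambda>y. s * exp (s * of_real y)) has_integral exp (s * of_real b) - exp (s * of_real a)) {a..b}"
    by (intro fundamental_theorem_of_calculus assms has_vector_derivative_exp)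
  then have "integral {a..b} (\<lambda>y. s * exp (s * of_real y)) = exp (s * of_real b) - exp (s * of_real a)"
    by (rule integral_unique)
  then show ?thesis using assms by (simp add: field_simps)
qed

text \<open>
The contributions of the points to the left and to the right of \<open>x\<close> to the convolution at \<open>x\<close>.
Their sum is the convolution; the right part minus the left part is its derivative.
\<close>

definition left_part :: "(real \<Rightarrow> complex) \<Rightarrow> real \<Rightarrow> complex" where
  "left_part \<phi> x = exp (- of_real x) * integral {0..x} (\<lambda>y. \<phi> y * exp (of_real y))"

definition right_part :: "(real \<Rightarrow> complex) \<Rightarrow> real \<Rightarrow> complex" where
  "right_part \<phi> x = exp (of_real x) * integral {x..1} (\<lambda>y. \<phi> y * exp (- of_real y))"

lemma conv_split:
  assumes \<phi>: "continuous_on {0..1} \<phi>" and x: "x \<in> {0<..<1}"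
  shows "conv \<phi> x = left_part \<phi> x + right_part \<phi> x"
proof -
  have "integral {0..1} (\<lambda>y. \<phi> y * exp_kernel (x - y))
      = integral {0..x} (\<lambda>y. \<phi> y * exp_kernel (x - y)) + integral {x..1} (\<lambda>y. \<phi> y * exp_kernel (x - y))"
    using x conv_integrable[OF \<phi>] by (intro Henstock_Kurzweil_Integration.integral_combine[symmetric]) auto
  also have "integral {0..x} (\<lambda>y. \<phi> y * exp_kernel (x - y)) = integral {0..x} (\<lambda>y. exp (- of_real x) * (\<phi> y * exp (of_real y)))"
    by (intro integral_cong) (auto simp: exp_kernel_def exp_diff exp_minus field_simps simp flip: exp_of_real)
  also have "\<dots> = left_part \<phi> x" by (simp add: left_part_def)
  also have "integral {x..1} (\<lambda>y. \<phi> y * exp_kernel (x - y)) = integral {x..1} (\<lambda>y. exp (of_real x) * (\<phi> y * exp (- of_real y)))"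
    by (intro integral_cong) (auto simp: exp_kernel_def exp_diff exp_minus field_simps simp flip: exp_of_real)
  also have "\<dots> = right_part \<phi> x" by (simp add: right_part_def)
  finally show ?thesis using x by (simp add: F_conv_def on01_def)
qed

lemma parts_integrable:
  assumes \<phi>: "continuous_on {0..1} \<phi>" and x: "x \<in> {0..1}"
  shows "(\<lambda>y. \<phi> y * exp (complex_of_real y)) integrable_on {0..x}"
    and "(\<lambda>y. \<phi> y * exp (- complex_of_real y)) integrable_on {x..1}"
  using x by (auto intro!: integrable_continuous_interval continuous_intros continuous_on_subset[OF \<phi>])

lemma left_part_derivative:
  assumes \<phi>: "continuous_on {0..1} \<phi>" and x: "x \<in> {0..1}"
  shows "(left_part \<phi> has_vector_derivative \<phi> x - left_part \<phi> x) (at x within {0..1})"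
proof -
  have "((\<lambda>u. integral {0..u} (\<lambda>y. \<phi> y * exp (of_real y))) has_vector_derivative \<phi> x * exp (of_real x)) (at x within {0..1})"
    by (intro integral_has_vector_derivative continuous_intros \<phi> x)
  from has_vector_derivative_mult[OF has_vector_derivative_exp_real(2) this]
  show ?thesis
    unfolding left_part_def by (rule has_vector_derivative_eq_rhs) (simp add: exp_minus)
qed

lemma right_part_derivative:
  assumes \<phi>: "continuous_on {0..1} \<phi>" and x: "x \<in> {0..1}"
  shows "(right_part \<phi> has_vector_derivative right_part \<phi> x - \<phi> x) (at x within {0..1})"
proof -
  have "((\<lambda>u. integral {u..1} (\<lambda>y. \<phi> y * exp (- of_real y))) has_vector_derivative - (\<phi> x * exp (- of_real x))) (at x within {0..1})"
    by (intro integral_has_vector_derivative' continuous_intros \<phi> x)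
  from has_vector_derivative_mult[OF has_vector_derivative_exp_real(1) this]
  show ?thesis
    unfolding right_part_def by (rule has_vector_derivative_eq_rhs) (simp_all add: exp_minus)
qed

lemma left_part_exp:
  assumes "s \<noteq> -1" "0 \<le> x"
  shows "left_part (\<lambda>y. exp (s * of_real y)) x = (exp (s * of_real x) - exp (- of_real x)) / (s + 1)"
proof -
  have s: "s + 1 \<noteq> 0" using assms by (simp add: add_eq_0_iff2)
  have "integral {0..x} (\<lambda>y. exp (s * of_real y) * exp (of_real y)) = integral {0..x} (\<lambda>y. exp ((s + 1) * of_real y))"
    by (simp add: distrib_right exp_add)
  also have "\<dots> = (exp ((s + 1) * of_real x) - 1) / (s + 1)"
    using integral_exp[OF s assms(2)] by simp
  finally have "left_part (\<lambda>y. exp (s * of_real y)) x = exp (- of_real x) * (exp ((s + 1) * of_real x) - 1) / (s + 1)"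
    by (simp add: left_part_def)
  also have "exp (- of_real x) * (exp ((s + 1) * of_real x) - 1) = exp (s * of_real x) - exp (- of_real x)"
    unfolding right_diff_distrib exp_add[symmetric] by (simp add: algebra_simps)
  finally show ?thesis .
qed

lemma right_part_exp:
  assumes "s \<noteq> 1" "x \<le> 1"
  shows "right_part (\<lambda>y. exp (s * of_real y)) x = (exp (s * of_real x) - exp s * exp (of_real x - 1)) / (1 - s)"
proof -
  have s: "s - 1 \<noteq> 0" using assms by simp
  have "integral {x..1} (\<lambda>y. exp (s * of_real y) * exp (- of_real y)) = integral {x..1} (\<lambda>y. exp ((s - 1) * of_real y))"
    by (simp add: left_diff_distrib exp_diff exp_minus divide_inverse)
  also have "\<dots> = (exp (s - 1) - exp ((s - 1) * of_real x)) / (s - 1)"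
    using integral_exp[OF s assms(2)] by simp
  finally have "right_part (\<lambda>y. exp (s * of_real y)) x = exp (of_real x) * (exp (s - 1) - exp ((s - 1) * of_real x)) / (s - 1)"
    by (simp add: right_part_def)
  also have "exp (of_real x) * (exp (s - 1) - exp ((s - 1) * of_real x)) = exp s * exp (of_real x - 1) - exp (s * of_real x)"
    unfolding right_diff_distrib exp_add[symmetric] by (simp add: algebra_simps)
  also have "(exp s * exp (of_real x - 1) - exp (s * of_real x)) / (s - 1) = (exp (s * of_real x) - exp s * exp (of_real x - 1)) / (1 - s)"
    using minus_divide_divide[of "exp s * exp (of_real x - 1) - exp (s * of_real x)" "s - 1"] by simp
  finally show ?thesis .
qed

lemma K_0: "E.K 0 = on01 (\<lambda>x. exp (- of_real x))"
  by (auto simp: E.K_def on01_def exp_kernel_def fun_eq_iff simp flip: exp_of_real)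

lemma K_1: "E.K 1 = on01 (\<lambda>x. exp (of_real x - 1))"
  by (auto simp: E.K_def on01_def exp_kernel_def fun_eq_iff simp flip: exp_of_real)

lemma K_0_eq_expo: "E.K 0 = expo (-1)"
  by (simp add: K_0 expo_def)

text \<open>
If \<open>u = F_\<phi> + a K 0 + b K 1\<close>, then \<open>u - u'' = 2 \<phi>\<close>, \<open>u 0 - u' 0 = 2 a\<close> and \<open>u 1 + u' 1 = 2 b\<close>. The
density \<open>wave l\<close> and the coefficient \<open>coef l\<close> of \<open>K 0\<close> are the ones for \<open>u x = exp (i l x)\<close>;
the coefficient of \<open>K 1\<close> is then \<open>cnj (coef l) * cis l\<close>.
\<close>

definition wave :: "real \<Rightarrow> real \<Rightarrow> complex" where
  "wave l y = (1 + (of_real l)\<^sup>2) / 2 * exp (\<i> * of_real l * of_real y)"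

definition coef :: "real \<Rightarrow> complex" where
  "coef l = (1 - \<i> * of_real l) / 2"

lemma coef_cnj: "cnj (coef l) = (1 + \<i> * of_real l) / 2"
  by (simp add: coef_def)

lemma wave_parts:
  assumes "x \<in> {0..1}"
  shows "left_part (wave l) x = coef l * (exp (\<i> * of_real l * of_real x) - exp (- of_real x))"
    and "right_part (wave l) x = cnj (coef l) * (exp (\<i> * of_real l * of_real x) - cis l * exp (of_real x - 1))"
proof -
  have s: "\<i> * of_real l \<noteq> -1" "\<i> * complex_of_real l \<noteq> 1" by (auto simp: complex_eq_iff)
  have nz: "\<i> * of_real l + 1 \<noteq> 0" "1 - \<i> * complex_of_real l \<noteq> 0"
    by (auto simp: complex_eq_iff)
  have fac: "(1 + (complex_of_real l)\<^sup>2) / 2 = coef l * (\<i> * of_real l + 1)"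
    "(1 + (complex_of_real l)\<^sup>2) / 2 = cnj (coef l) * (1 - \<i> * of_real l)"
    unfolding coef_cnj by (simp_all add: coef_def algebra_simps power2_eq_square)
  have L: "left_part (\<lambda>y. c * f y) x = c * left_part f x" "right_part (\<lambda>y. c * f y) x = c * right_part f x" for c f
    by (simp_all add: left_part_def right_part_def mult.assoc mult.left_commute)
  show "left_part (wave l) x = coef l * (exp (\<i> * of_real l * of_real x) - exp (- of_real x))"
    unfolding wave_def[abs_def] L(1) fac(1) using assms s nz by (simp add: left_part_exp)
  show "right_part (wave l) x = cnj (coef l) * (exp (\<i> * of_real l * of_real x) - cis l * exp (of_real x - 1))"
    unfolding wave_def[abs_def] L(2) fac(2) using assms s nz by (simp add: right_part_exp cis_conv_exp)
qed

lemma continuous_wave: "continuous_on S (wave l)"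
  unfolding wave_def[abs_def] by (intro continuous_intros)

lemma e_fun_eq_expo: "e_fun l = expo (\<i> * of_real l)"
  by (simp add: e_fun_def expo_def)

lemma e_fun_decomposition:
  "e_fun l = conv (wave l) + cscale (coef l) (E.K 0) + cscale (cnj (coef l) * cis l) (E.K 1)"
proof
  fix x
  show "e_fun l x = (conv (wave l) + cscale (coef l) (E.K 0) + cscale (cnj (coef l) * cis l) (E.K 1)) x"
  proof (cases "x \<in> {0<..<1}")
    case True
    have "coef l + cnj (coef l) = 1" by (simp add: coef_def add_divide_distrib[symmetric])
    then have "exp (\<i> * of_real l * of_real x) = coef l * exp (\<i> * of_real l * of_real x) + cnj (coef l) * exp (\<i> * of_real l * of_real x)"
      by (simp flip: distrib_right)
    then show ?thesis
      using True conv_split[OF continuous_wave True, of l] wave_parts[of x l]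
      by (simp add: e_fun_def K_0 K_1 on01_def cscale_def algebra_simps)
  next
    case False
    then show ?thesis by (auto simp: e_fun_def E.K_def F_conv_def on01_def cscale_def)
  qed
qed

lemma K_0_in [simp]: "E.K 0 \<in> H" and K_1_in [simp]: "E.K 1 \<in> H"
  using K_boundary(1) by auto

lemma conv_wave_in [simp]: "conv (wave l) \<in> H"
  by (intro conv_pairing continuous_wave)

lemma e_fun_in [simp]: "e_fun l \<in> H"
  unfolding e_fun_decomposition by auto

lemma inner_K_0_expo: "expo s \<in> H \<Longrightarrow> inner_H (E.K 0) (expo s) = 1"
  using K_boundary(2)[of 0 "\<lambda>x. exp (s * of_real x)"] by (simp add: expo_def continuous_intros)

lemma inner_K_1_expo: "expo s \<in> H \<Longrightarrow> inner_H (E.K 1) (expo s) = exp s"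
  using K_boundary(2)[of 1 "\<lambda>x. exp (s * of_real x)"] by (simp add: expo_def continuous_intros)

text \<open>
Pair the decomposition with \<open>e_fun l\<close>: the density contributes \<open>(1 + l^2) / 2\<close>, and the two boundary
terms contribute \<open>coef l\<close> and its conjugate, which add up to 1.
\<close>

lemma norm_e_fun: "(norm_H (e_fun l))\<^sup>2 = (l\<^sup>2 + 3) / 2"
proof -
  have "inner_H (conv (wave l)) (e_fun l) = integral {0..1} (\<lambda>y. cnj (wave l y) * e_fun l y)"
    by (intro conv_pairing continuous_wave e_fun_in)
  also have "\<dots> = integral {0..1} (\<lambda>y::real. (1 + (of_real l)\<^sup>2) / 2 :: complex)"
  proof (rule integral_Icc_cong)
    fix y :: real assume y: "y \<in> {0<..<1}"
    have "exp (- (\<i> * of_real l * of_real y)) * exp (\<i> * of_real l * of_real y) = (1::complex)"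
      by (simp flip: exp_add)
    then show "cnj (wave l y) * e_fun l y = (1 + (of_real l)\<^sup>2) / 2"
      using y by (simp add: wave_def e_fun_def on01_def exp_cnj mult.assoc)
  qed
  finally have 1: "inner_H (conv (wave l)) (e_fun l) = (1 + (of_real l)\<^sup>2) / 2" by simp
  have 2: "inner_H (E.K 0) (e_fun l) = 1" "inner_H (E.K 1) (e_fun l) = cis l"
    using inner_K_0_expo inner_K_1_expo e_fun_in by (simp_all add: e_fun_eq_expo cis_conv_exp)
  have "inner_H (e_fun l) (e_fun l) = (1 + (of_real l)\<^sup>2) / 2 + cnj (coef l) + coef l * (cnj (cis l) * cis l)"
    using 1 2 by (subst (1) e_fun_decomposition) (simp add: E.H.ip_simps)
  also have "cnj (cis l) * cis l = 1" by (simp add: cis_cnj cis_mult)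
  also have "(1 + (of_real l)\<^sup>2) / 2 + cnj (coef l) + coef l * 1 = complex_of_real ((l\<^sup>2 + 3) / 2)"
    by (simp add: coef_def field_simps)
  finally have "Re (inner_H (e_fun l) (e_fun l)) = (l\<^sup>2 + 3) / 2"
    by (simp only: Re_complex_of_real)
  then show ?thesis by (simp add: E.H.nrm_sq)
qed

section \<open>The operator D and its norm identity\<close>

lemma integral_by_parts_vanishing:
  fixes f g :: "real \<Rightarrow> complex"
  assumes "\<And>x. x \<in> {0..1} \<Longrightarrow> (f has_vector_derivative f' x) (at x within {0..1})"
    and "\<And>x. x \<in> {0..1} \<Longrightarrow> (g has_vector_derivative g' x) (at x within {0..1})"
    and "continuous_on {0..1} f'" "continuous_on {0..1} g'" "f 0 = 0" "f 1 = 0"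
  shows "integral {0..1} (\<lambda>x. f' x * g x) = - integral {0..1} (\<lambda>x. f x * g' x)"
proof -
  have c: "continuous_on {0..1} f" "continuous_on {0..1} g"
    using assms(1,2) unfolding continuous_on_eq_continuous_within by (blast intro: has_vector_derivative_continuous)+
  have "((\<lambda>x. f x * g' x + f' x * g x) has_integral f 1 * g 1 - f 0 * g 0) {0..1}"
    by (intro fundamental_theorem_of_calculus has_vector_derivative_mult assms) auto
  then have "integral {0..1} (\<lambda>x. f x * g' x + f' x * g x) = 0"
    using assms(5,6) by (simp add: integral_unique)
  moreover have "integral {0..1} (\<lambda>x. f x * g' x + f' x * g x)
      = integral {0..1} (\<lambda>x. f x * g' x) + integral {0..1} (\<lambda>x. f' x * g x)"
    by (intro integral_add integrable_continuous_interval continuous_intros c assms)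
  ultimately show ?thesis by (simp add: add_eq_0_iff)
qed

text \<open>
What the computations with test functions use of them: continuous differentiability and zero
values at the endpoints, which remove all boundary terms.
\<close>

locale vanishing_C1 =
  fixes f f' :: "real \<Rightarrow> complex"
  assumes deriv: "\<And>x. (f has_vector_derivative f' x) (at x)"
    and cont': "continuous_on UNIV f'" and zero: "f 0 = 0" "f 1 = 0"
begin

lemma cont: "continuous_on {0..1} f" "continuous_on {0..1} f'"
proof -
  show "continuous_on {0..1} f'" by (rule continuous_on_subset[OF cont']) simp
  have "continuous_on UNIV f"
    using has_vector_derivative_continuous[OF deriv] by (simp add: continuous_at_imp_continuous_on)
  then show "continuous_on {0..1} f" by (rule continuous_on_subset) simp
qed

lemma deriv_within: "(f has_vector_derivative f' x) (at x within S)"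
  using deriv by (rule has_vector_derivative_at_within)

text \<open>
One integration by parts shows that \<open>expo s\<close> is an eigenvector of the adjoint of \<open>D_F\<close>, with
eigenvalue \<open>- s\<close>.
\<close>

lemma expo_pairing:
  assumes "expo s \<in> H"
  shows "inner_H (expo s) (conv f') = - cnj s * inner_H (expo s) (conv f)"
proof -
  have pair: "inner_H (expo s) (conv \<phi>) = integral {0..1} (\<lambda>y. \<phi> y * exp (cnj s * of_real y))"
    if \<phi>: "continuous_on {0..1} \<phi>" for \<phi>
  proof -
    have "inner_H (expo s) (conv \<phi>) = cnj (integral {0..1} (\<lambda>y. cnj (\<phi> y) * expo s y))"
      using E.H.ip_cnj[of "conv \<phi>" "expo s"] conv_pairing[OF \<phi>] assms by simp
    also have "\<dots> = integral {0..1} (\<lambda>y. \<phi> y * cnj (expo s y))"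
      unfolding integral_cnj by simp
    also have "\<dots> = integral {0..1} (\<lambda>y. \<phi> y * exp (cnj s * of_real y))"
      by (rule integral_Icc_cong) (simp add: expo_def on01_def exp_cnj)
    finally show ?thesis .
  qed
  have "integral {0..1} (\<lambda>y. f' y * exp (cnj s * of_real y)) = - integral {0..1} (\<lambda>y. f y * (cnj s * exp (cnj s * of_real y)))"
    by (rule integral_by_parts_vanishing)
      (auto intro!: deriv_within has_vector_derivative_exp cont continuous_intros simp: zero)
  then show ?thesis
    by (simp add: pair cont mult.left_commute)
qed

lemma parts_derivative:
  assumes x: "x \<in> {0..1}"
  shows "left_part f' x = f x - left_part f x" "right_part f' x = right_part f x - f x"
proof -
  have L: "((\<lambda>y. f y * exp (of_real y) + f' y * exp (of_real y)) has_integral f x * exp (of_real x) - f 0 * exp (of_real 0)) {0..x}"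
    using x has_vector_derivative_mult[OF deriv_within has_vector_derivative_exp_real(1)]
    by (intro fundamental_theorem_of_calculus) auto
  have R: "((\<lambda>y. f' y * exp (- of_real y) - f y * exp (- of_real y)) has_integral f 1 * exp (- of_real 1) - f x * exp (- of_real x)) {x..1}"
    using x has_vector_derivative_mult[OF deriv_within has_vector_derivative_exp_real(2)]
    by (intro fundamental_theorem_of_calculus) auto
  note i = parts_integrable[OF _ x]
  have "integral {0..x} (\<lambda>y. f y * exp (of_real y)) + integral {0..x} (\<lambda>y. f' y * exp (of_real y)) = f x * exp (of_real x)"
    using integral_unique[OF L] integral_add[OF i(1)[OF cont(1)] i(1)[OF cont(2)]] zero by simp
  then have "exp (- of_real x) * (integral {0..x} (\<lambda>y. f y * exp (of_real y)) + integral {0..x} (\<lambda>y. f' y * exp (of_real y))) = f x"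
    by (simp add: exp_minus)
  then show "left_part f' x = f x - left_part f x"
    by (simp add: left_part_def distrib_left eq_diff_eq add.commute)
  have "integral {x..1} (\<lambda>y. f' y * exp (- of_real y)) - integral {x..1} (\<lambda>y. f y * exp (- of_real y)) = - f x * exp (- of_real x)"
    using integral_unique[OF R] integral_diff[OF i(2)[OF cont(2)] i(2)[OF cont(1)]] zero by simp
  then have "exp (of_real x) * (integral {x..1} (\<lambda>y. f' y * exp (- of_real y)) - integral {x..1} (\<lambda>y. f y * exp (- of_real y))) = - f x"
    by (simp add: exp_minus)
  then have "right_part f' x - right_part f x = - f x"
    by (simp add: right_part_def right_diff_distrib)
  then show "right_part f' x = right_part f x - f x"
    by (simp add: diff_eq_eq)
qed

lemma conv_deriv: "x \<in> {0<..<1} \<Longrightarrow> conv f' x = right_part f x - left_part f x"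
  using conv_split[OF cont(2), of x] parts_derivative[of x] by simp

text \<open>
Both norms are integrals against convolutions, by \<open>conv_pairing\<close>. With
\<open>w = right_part f - left_part f\<close> one has \<open>F_f' = w\<close> and \<open>w' = F_f - 2 f\<close>, and one integration by
parts turns \<open>\<integral> cnj f' * w\<close> into \<open>2 \<integral> |f|^2 - \<integral> cnj f * F_f\<close>.
\<close>

lemma norm_conv_deriv:
  "(norm_H (conv f'))\<^sup>2 + (norm_H (conv f))\<^sup>2 = 2 * integral {0..1} (\<lambda>y. (cmod (f y))\<^sup>2)"
proof -
  let ?w = "\<lambda>x. right_part f x - left_part f x" and ?w' = "\<lambda>x. right_part f x + left_part f x - 2 * f x"
  have cw: "continuous_on {0..1} (left_part f)" "continuous_on {0..1} (right_part f)"
    using left_part_derivative[OF cont(1)] right_part_derivative[OF cont(1)]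
    unfolding continuous_on_eq_continuous_within by (blast intro: has_vector_derivative_continuous)+
  have dw: "(?w has_vector_derivative ?w' x) (at x within {0..1})" if "x \<in> {0..1}" for x
    using has_vector_derivative_diff[OF right_part_derivative[OF cont(1) that] left_part_derivative[OF cont(1) that]]
    by (rule has_vector_derivative_eq_rhs) simp
  have "inner_H (conv f') (conv f') = integral {0..1} (\<lambda>y. cnj (f' y) * conv f' y)"
    using conv_pairing[OF cont(2)] by simp
  also have "\<dots> = integral {0..1} (\<lambda>y. cnj (f' y) * ?w y)"
    by (rule integral_Icc_cong) (simp add: conv_deriv)
  also have "\<dots> = - integral {0..1} (\<lambda>y. cnj (f y) * ?w' y)"
    by (rule integral_by_parts_vanishing)
      (auto intro!: dw has_vector_derivative_cnj deriv_within continuous_intros cont cw simp: zero)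
  finally have 1: "inner_H (conv f') (conv f') = - integral {0..1} (\<lambda>y. cnj (f y) * ?w' y)" .
  have "inner_H (conv f) (conv f) = integral {0..1} (\<lambda>y. cnj (f y) * conv f y)"
    using conv_pairing[OF cont(1)] by simp
  also have "\<dots> = integral {0..1} (\<lambda>y. cnj (f y) * (right_part f y + left_part f y))"
    by (rule integral_Icc_cong) (simp add: conv_split[OF cont(1)] add.commute)
  finally have 2: "inner_H (conv f) (conv f) = integral {0..1} (\<lambda>y. cnj (f y) * (right_part f y + left_part f y))" .
  have "inner_H (conv f') (conv f') + inner_H (conv f) (conv f)
    = integral {0..1} (\<lambda>y. cnj (f y) * (right_part f y + left_part f y) - cnj (f y) * ?w' y)"
    unfolding 1 2 by (subst integral_diff) (auto intro!: integrable_continuous_interval continuous_intros cont cw)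
  also have "\<dots> = integral {0..1} (\<lambda>y. complex_of_real (2 * (cmod (f y))\<^sup>2))"
    by (intro integral_cong) (simp add: right_diff_distrib complex_norm_square mult_ac del: of_real_power)
  also have "\<dots> = complex_of_real (integral {0..1} (\<lambda>y. 2 * (cmod (f y))\<^sup>2))"
    by (intro integral_unique has_integral_of_real integrable_integral integrable_continuous_interval continuous_intros cont)
  finally have "complex_of_real ((norm_H (conv f'))\<^sup>2 + (norm_H (conv f))\<^sup>2) = complex_of_real (2 * integral {0..1} (\<lambda>y. (cmod (f y))\<^sup>2))"
    using conv_pairing(1)[OF cont(1)] conv_pairing(1)[OF cont(2)] by (simp add: E.H.ip_self)
  then show ?thesis by (simp only: of_real_eq_iff)
qed

end

lemma vanishing_C1_test_function:
  assumes "test_function f"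
  shows "vanishing_C1 f (\<lambda>x. vector_derivative f (at x))"
proof (rule test_functionE[OF assms])
  fix f' assume f': "\<And>x. (f has_vector_derivative f' x) (at x)" "continuous_on UNIV f'"
    "continuous_on UNIV f" "f 0 = 0" "f 1 = 0" "(\<lambda>x. vector_derivative f (at x)) = f'"
  show ?thesis unfolding f'(6) using f'(1-5) by (simp add: vanishing_C1_def)
qed

lemma D_opE:
  assumes "(u, v) \<in> D_op exp_kernel"
  obtains f f' where "test_function f" "vanishing_C1 f f'" "u = conv f" "v = conv f'"
proof -
  obtain f where f: "test_function f" "u = conv f" "v = conv (\<lambda>x. vector_derivative f (at x))"
    using assms unfolding D_op_def by blast
  then show ?thesis
    using that[of f "\<lambda>x. vector_derivative f (at x)"] vanishing_C1_test_function by blast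
qed

lemma D_opI:
  assumes "test_function f" "\<And>x. (f has_vector_derivative f' x) (at x)"
  shows "(conv f, conv f') \<in> D_op exp_kernel"
proof -
  have "f' = (\<lambda>x. vector_derivative f (at x))"
    using vector_derivative_at[OF assms(2)] by (simp add: fun_eq_iff)
  then show ?thesis using assms(1) unfolding D_op_def by blast
qed

lemma D_op_sub: "D_op exp_kernel \<subseteq> H \<times> H"
proof clarify
  fix u v assume "(u, v) \<in> D_op exp_kernel"
  then obtain f f' where "vanishing_C1 f f'" "u = conv f" "v = conv f'" by (rule D_opE) blast
  then show "u \<in> H \<and> v \<in> H" by (auto intro: conv_pairing vanishing_C1.cont)
qed

lemma D_op_add:
  assumes "(u, v) \<in> D_op exp_kernel" "(u', v') \<in> D_op exp_kernel"
  shows "(u + u', v + v') \<in> D_op exp_kernel"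
proof -
  obtain f f' where f: "test_function f" "vanishing_C1 f f'" "u = conv f" "v = conv f'"
    using assms(1) by (rule D_opE) blast
  obtain g g' where g: "test_function g" "vanishing_C1 g g'" "u' = conv g" "v' = conv g'"
    using assms(2) by (rule D_opE) blast
  have "(conv (\<lambda>x. f x + g x), conv (\<lambda>x. f' x + g' x)) \<in> D_op exp_kernel"
    using f g by (intro D_opI test_function_add has_vector_derivative_add) (auto simp: vanishing_C1_def)
  then show ?thesis
    using f g by (simp add: conv_add vanishing_C1.cont)
qed

lemma D_op_scale:
  assumes "(u, v) \<in> D_op exp_kernel"
  shows "(cscale a u, cscale a v) \<in> D_op exp_kernel"
proof -
  obtain f f' where f: "test_function f" "vanishing_C1 f f'" "u = conv f" "v = conv f'"
    using assms(1) by (rule D_opE) blast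
  have "(conv (\<lambda>x. a * f x), conv (\<lambda>x. a * f' x)) \<in> D_op exp_kernel"
    using f by (intro D_opI test_function_scale has_vector_derivative_mult_right) (auto simp: vanishing_C1_def)
  then show ?thesis using f by (simp add: conv_scale)
qed

abbreviation D_closure :: op_graph where
  "D_closure \<equiv> op_closure H inner_H (D_op exp_kernel)"

lemma D_closure_sub: "(h, k) \<in> D_closure \<Longrightarrow> h \<in> H \<and> k \<in> H"
  by (auto simp: op_closure_def)

text \<open>
The pairing relation of \<open>D_F\<close> with an exponential passes to the closure by continuity. For
\<open>s = i l\<close> it yields the symmetry of \<open>A_op\<close>; for \<open>s = -1\<close> it says that \<open>h\<close> and its
derivative have the same value at 0.
\<close>

lemma D_closure_expo:
  assumes hk: "(h, k) \<in> D_closure" and s: "expo s \<in> H"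
  shows "inner_H (expo s) k = - cnj s * inner_H (expo s) h"
proof -
  obtain u v where uv: "h \<in> H" "k \<in> H" "\<And>n. (u n, v n) \<in> D_op exp_kernel" "\<And>n. u n \<in> H" "\<And>n. v n \<in> H"
    "E.H.tends_to u h" "E.H.tends_to v k"
    using hk D_op_sub by (rule E.H.op_closureE) blast
  have "inner_H (expo s) (v n) = - cnj s * inner_H (expo s) (u n)" for n
    using uv(3)[of n] by (rule D_opE) (simp add: vanishing_C1.expo_pairing s)
  moreover have "(\<lambda>n. inner_H (expo s) (v n)) \<longlonglongrightarrow> inner_H (expo s) k"
    by (intro E.H.ip_tendsto_right s uv)
  moreover have "(\<lambda>n. - cnj s * inner_H (expo s) (u n)) \<longlonglongrightarrow> - cnj s * inner_H (expo s) h"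
    by (intro tendsto_mult_left E.H.ip_tendsto_right s uv)
  ultimately show ?thesis using LIMSEQ_unique by force
qed

section \<open>The closure of D\<close>

lemma parts_diff:
  assumes "continuous_on {0..1} f" "continuous_on {0..1} g" "x \<in> {0..1}"
  shows "left_part (\<lambda>y. f y - g y) x = left_part f x - left_part g x"
    and "right_part (\<lambda>y. f y - g y) x = right_part f x - right_part g x"
proof -
  note i = parts_integrable[OF _ assms(3)]
  show "left_part (\<lambda>y. f y - g y) x = left_part f x - left_part g x"
    using integral_diff[OF i(1)[OF assms(1)] i(1)[OF assms(2)]]
    by (simp add: left_part_def left_diff_distrib right_diff_distrib)
  show "right_part (\<lambda>y. f y - g y) x = right_part f x - right_part g x"
    using integral_diff[OF i(2)[OF assms(1)] i(2)[OF assms(2)]]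
    by (simp add: right_part_def left_diff_distrib right_diff_distrib)
qed

lemma parts_bound:
  assumes f: "continuous_on {0..1} f" and x: "x \<in> {0..1}"
  shows "cmod (left_part f x) \<le> integral {0..1} (\<lambda>y. cmod (f y))"
    and "cmod (right_part f x) \<le> integral {0..1} (\<lambda>y. cmod (f y))"
proof -
  have *: "cmod (integral {a..b} (\<lambda>y. f y * exp (of_real (w y)))) \<le> integral {0..1} (\<lambda>y. cmod (f y))"
    if "0 \<le> a" "b \<le> 1" "\<And>y. a \<le> y \<Longrightarrow> y \<le> b \<Longrightarrow> w y \<le> 0" "continuous_on {0..1} w" for a b and w :: "real \<Rightarrow> real"
  proof -
    have sub: "{a..b} \<subseteq> {0..1}" using that by auto
    have c: "continuous_on {a..b} f" "continuous_on {a..b} w"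
      using continuous_on_subset[OF f sub] continuous_on_subset[OF that(4) sub] by auto
    have "cmod (integral {a..b} (\<lambda>y. f y * exp (of_real (w y)))) \<le> integral {a..b} (\<lambda>y. cmod (f y))"
      by (rule integral_norm_bound_integral)
        (use that c in \<open>auto intro!: integrable_continuous_interval continuous_intros mult_left_le simp: norm_mult\<close>)
    also have "\<dots> \<le> integral {0..1} (\<lambda>y. cmod (f y))"
      using sub by (intro integral_subset_le integrable_continuous_interval continuous_intros c f) auto
    finally show ?thesis .
  qed
  have w: "continuous_on {0..1} (\<lambda>y. y - x)" "continuous_on {0..1} (\<lambda>y. x - y)"
    by (intro continuous_intros)+
  have "left_part f x = integral {0..x} (\<lambda>y. f y * exp (of_real (y - x)))"
    unfolding left_part_def integral_mult_right[symmetric]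
    by (intro integral_cong) (simp add: exp_diff exp_minus field_simps)
  then show "cmod (left_part f x) \<le> integral {0..1} (\<lambda>y. cmod (f y))"
    using *[of 0 x "\<lambda>y. y - x"] x w by simp
  have "right_part f x = integral {x..1} (\<lambda>y. f y * exp (of_real (x - y)))"
    unfolding right_part_def integral_mult_right[symmetric]
    by (intro integral_cong) (simp add: exp_diff exp_minus field_simps)
  then show "cmod (right_part f x) \<le> integral {0..1} (\<lambda>y. cmod (f y))"
    using *[of x 1 "\<lambda>y. x - y"] x w by simp
qed

text \<open>
Dominated convergence. The cutoffs vanish at the two endpoints, so the pointwise limit there is
\<open>|f|\<close> and not 0.
\<close>

lemma cutoff_L1:
  assumes f: "continuous_on {0..1} f" "\<And>n. continuous_on {0..1} (\<lambda>x. complex_of_real (cutoff n x) * f x)"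
  shows "(\<lambda>n. integral {0..1} (\<lambda>y. cmod (of_real (cutoff n y) * f y - f y))) \<longlonglongrightarrow> 0"
proof -
  define g where "g x = (if x \<in> {0<..<1} then 0 else cmod (f x))" for x
  have eq: "cmod (of_real (cutoff n y) * f y - f y) = (1 - cutoff n y) * cmod (f y)" for n y
  proof -
    have "of_real (cutoff n y) * f y - f y = - (of_real (1 - cutoff n y) * f y)" by (simp add: algebra_simps)
    then show ?thesis using cutoff_bounds[of n y] by (simp only: norm_minus_cancel norm_mult norm_of_real)
  qed
  have "(\<lambda>n. integral {0..1} (\<lambda>y. cmod (of_real (cutoff n y) * f y - f y))) \<longlonglongrightarrow> integral {0..1} g"
  proof (rule dominated_convergence(2)[where h = "\<lambda>y. cmod (f y)"])
    show "(\<lambda>y. cmod (of_real (cutoff n y) * f y - f y)) integrable_on {0..1}" for n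
      by (intro integrable_continuous_interval continuous_intros f)
    show "(\<lambda>y. cmod (f y)) integrable_on {0..1}"
      by (intro integrable_continuous_interval continuous_intros f)
    show "norm (cmod (of_real (cutoff n y) * f y - f y)) \<le> cmod (f y)" for n y
      unfolding eq using cutoff_bounds[of n y] by (simp add: mult_left_le_one_le)
    show "(\<lambda>n. cmod (of_real (cutoff n y) * f y - f y)) \<longlonglongrightarrow> g y" if "y \<in> {0..1}" for y
    proof (cases "y \<in> {0<..<1}")
      case True
      have "(\<lambda>n. (1 - cutoff n y) * cmod (f y)) \<longlonglongrightarrow> (1 - 1) * cmod (f y)"
        using True by (intro tendsto_intros cutoff_tendsto_1) auto
      then show ?thesis using True by (simp add: eq g_def)
    next
      case False
      then have "cutoff n y = 0" for n
        using that cutoff_support[of n y] by (cases "y = 0"; cases "y = 1") (auto simp: cutoff_def flat_def)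
      then show ?thesis using False by (auto simp: g_def)
    qed
  qed
  also have "integral {0..1} g = integral {0..1} (\<lambda>_::real. 0::real)"
    by (rule integral_spike[of "{0, 1}"]) (auto simp: g_def)
  finally show ?thesis by simp
qed

text \<open>
Multiply \<open>f\<close> by the cutoffs. The resulting test functions \<open>p n\<close> converge in mean, so their convolutions
converge to that of \<open>f\<close>. They are bounded, so they also converge in mean square, and by
\<open>norm_conv_deriv\<close> the convolutions of their derivatives form a Cauchy sequence. Its limit is
identified by its values: these involve \<open>p n\<close> and not its derivative, and so they converge
although \<open>f\<close> itself may be nonzero at the endpoints.
\<close>

theorem smooth_in_D_closure:
  assumes f: "smooth f"
  shows "(conv f, on01 (\<lambda>x. right_part f x - left_part f x)) \<in> D_closure"
proof -
  define p where "p n x = complex_of_real (cutoff n x) * f x" for n x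
  define p' where "p' n x = vector_derivative (p n) (at x)" for n x
  have tf: "test_function (p n)" for n
    unfolding p_def by (rule test_function_cutoff[OF f])
  have C1: "vanishing_C1 (p n) (p' n)" for n
    using vanishing_C1_test_function[OF tf[of n]] by (simp add: p'_def[abs_def])
  have cp: "continuous_on {0..1} (p n)" "continuous_on {0..1} (p' n)" for n
    using vanishing_C1.cont[OF C1] by auto
  obtain f' where "\<And>x. (f has_vector_derivative f' x) (at x)" using smoothE[OF f] by blast
  then have cf: "continuous_on {0..1} f"
    using has_vector_derivative_continuous by (intro continuous_at_imp_continuous_on) blast
  obtain C where C: "C \<ge> 0" "\<And>y. y \<in> {0..1} \<Longrightarrow> cmod (f y) \<le> C" using continuous_Icc_bound[OF cf] by blast
  have pC: "cmod (p n y) \<le> C" if "y \<in> {0..1}" for n y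
    using mult_mono[OF cutoff_bounds(2)[of n y] C(2)[OF that]] cutoff_bounds[of n y] by (simp add: p_def norm_mult)
  define \<delta> where "\<delta> n = integral {0..1} (\<lambda>y. cmod (p n y - f y))" for n
  have \<delta>: "\<delta> \<longlonglongrightarrow> 0"
    unfolding \<delta>_def p_def using cp by (intro cutoff_L1 cf) (simp add: p_def[abs_def])
  have \<delta>0: "0 \<le> \<delta> n" for n
    unfolding \<delta>_def by (intro integral_nonneg integrable_continuous_interval continuous_intros cp cf) auto
  have cauchy_bound: "(norm_H (conv (p' m) - conv (p' n)))\<^sup>2 \<le> 4 * C * (\<delta> m + \<delta> n)" for m n
  proof -
    interpret d: vanishing_C1 "\<lambda>x. p m x - p n x" "\<lambda>x. p' m x - p' n x"
      using C1[of m] C1[of n] unfolding vanishing_C1_def by (auto intro!: has_vector_derivative_diff continuous_intros)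
    have "(norm_H (conv (p' m) - conv (p' n)))\<^sup>2 \<le> 2 * integral {0..1} (\<lambda>y. (cmod (p m y - p n y))\<^sup>2)"
      using d.norm_conv_deriv zero_le_power2[of "norm_H (conv (\<lambda>x. p m x - p n x))"]
      unfolding conv_diff[OF cp(2) cp(2)] by linarith
    moreover have "integral {0..1} (\<lambda>y. (cmod (p m y - p n y))\<^sup>2)
        \<le> integral {0..1} (\<lambda>y. 2 * C * (cmod (p m y - f y) + cmod (p n y - f y)))"
    proof (rule integral_le)
      show "(cmod (p m y - p n y))\<^sup>2 \<le> 2 * C * (cmod (p m y - f y) + cmod (p n y - f y))" if "y \<in> {0..1}" for y
      proof -
        have "cmod (p m y - p n y) \<le> 2 * C"
          using norm_triangle_ineq4[of "p m y" "p n y"] pC[OF that, of m] pC[OF that, of n] by simp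
        moreover have "cmod (p m y - p n y) \<le> cmod (p m y - f y) + cmod (p n y - f y)"
          using norm_triangle_ineq4[of "p m y - f y" "p n y - f y"] by simp
        ultimately show ?thesis
          unfolding power2_eq_square using C(1) by (intro mult_mono) auto
      qed
    qed (intro integrable_continuous_interval continuous_intros cp cf)+
    moreover have "integral {0..1} (\<lambda>y. 2 * C * (cmod (p m y - f y) + cmod (p n y - f y))) = 2 * C * (\<delta> m + \<delta> n)"
      unfolding \<delta>_def integral_mult_right
      by (subst integral_add) (auto intro!: integrable_continuous_interval continuous_intros cp cf)
    ultimately show ?thesis by linarith
  qed
  have "E.H.cauchy_seq (\<lambda>n. conv (p' n))"
    unfolding E.H.cauchy_seq_def
  proof (intro allI impI)
    fix e :: real assume e: "e > 0"
    have "(\<lambda>n. 8 * C * \<delta> n) \<longlonglongrightarrow> 8 * C * 0" by (intro tendsto_intros \<delta>)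
    then obtain N where N: "\<And>n. n \<ge> N \<Longrightarrow> 8 * C * \<delta> n < e\<^sup>2"
      using order_tendstoD(2)[of "\<lambda>n. 8 * C * \<delta> n" 0 sequentially "e\<^sup>2"] e by (auto simp: eventually_sequentially)
    have "norm_H (conv (p' m) - conv (p' n)) < e" if "m \<ge> N" "n \<ge> N" for m n
    proof -
      have "4 * C * (\<delta> m + \<delta> n) < e\<^sup>2" using N[OF that(1)] N[OF that(2)] by (simp add: distrib_left)
      then have "(norm_H (conv (p' m) - conv (p' n)))\<^sup>2 < e\<^sup>2" using cauchy_bound[of m n] by linarith
      then show ?thesis using e by (simp add: power_less_imp_less_base)
    qed
    then show "\<exists>N. \<forall>m\<ge>N. \<forall>n\<ge>N. norm_H (conv (p' m) - conv (p' n)) < e" by blast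
  qed
  then obtain k where k: "k \<in> H" "(\<lambda>n. norm_H (conv (p' n) - k)) \<longlonglongrightarrow> 0"
    using E.H.complete[of "\<lambda>n. conv (p' n)"] conv_pairing(1)[OF cp(2)] by blast
  have "k x = on01 (\<lambda>x. right_part f x - left_part f x) x" for x
  proof (cases "x \<in> {0<..<1}")
    case True
    have "(\<lambda>n. inner_H (E.K x) (conv (p' n))) \<longlonglongrightarrow> inner_H (E.K x) k"
      using True k conv_pairing(1)[OF cp(2)] by (intro E.H.ip_tendsto_right) auto
    then have "(\<lambda>n. conv (p' n) x) \<longlonglongrightarrow> k x"
      using True k conv_pairing(1)[OF cp(2)] by (simp add: E.reproducing)
    moreover have "(\<lambda>n. conv (p' n) x) \<longlonglongrightarrow> right_part f x - left_part f x"
    proof -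
      have x: "x \<in> {0..1}" using True by simp
      have cd: "continuous_on {0..1} (\<lambda>y. p n y - f y)" for n by (intro continuous_intros cp cf)
      have "(\<lambda>n. right_part (p n) x - right_part f x) \<longlonglongrightarrow> 0" "(\<lambda>n. left_part (p n) x - left_part f x) \<longlonglongrightarrow> 0"
        using parts_bound[OF cd x] parts_diff[OF cp(1) cf x]
        by (auto intro!: Lim_null_comparison[OF _ \<delta>] simp: \<delta>_def)
      then have "(\<lambda>n. right_part (p n) x - left_part (p n) x) \<longlonglongrightarrow> right_part f x - left_part f x"
        by (intro tendsto_diff) (simp_all add: LIM_zero_iff)
      then show ?thesis using vanishing_C1.conv_deriv[OF C1 True] by simp
    qed
    ultimately have "k x = right_part f x - left_part f x" by (rule LIMSEQ_unique)
    then show ?thesis using True by (simp add: on01_def)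
  next
    case False
    then show ?thesis using E.rkhs_outside[OF k(1)] by (auto simp: on01_def)
  qed
  then have k_eq: "k = on01 (\<lambda>x. right_part f x - left_part f x)" by auto
  show ?thesis
  proof (rule E.H.op_closureI[of _ _ "\<lambda>n. conv (p n)" "\<lambda>n. conv (p' n)"])
    show "conv f \<in> H" by (rule conv_pairing(1)[OF cf])
    show "on01 (\<lambda>x. right_part f x - left_part f x) \<in> H" using k(1) k_eq by simp
    show "(conv (p n), conv (p' n)) \<in> D_op exp_kernel" for n
      using D_opI[OF tf vanishing_C1.deriv[OF C1]] .
    show "(\<lambda>n. norm_H (conv (p' n) - on01 (\<lambda>x. right_part f x - left_part f x))) \<longlonglongrightarrow> 0"
      using k(2) k_eq by simp
    show "(\<lambda>n. norm_H (conv (p n) - conv f)) \<longlonglongrightarrow> 0"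
    proof (rule E.H.nrm_diff_tendsto_0I[OF _ _ _ \<delta>])
      show "norm_H (conv (p n) - conv f) \<le> \<delta> n" for n
        unfolding \<delta>_def conv_diff[OF cp(1) cf, symmetric]
        by (intro norm_conv_le continuous_intros cp cf)
    qed (intro conv_pairing(1) cp cf)+
  qed
qed

section \<open>The operators A\<close>

definition defect :: "real \<Rightarrow> complex \<Rightarrow> real \<Rightarrow> complex" where
  "defect \<theta> \<sigma> = E.K 0 + cscale (\<sigma> * cis \<theta>) (E.K 1)"

lemma defect_in [simp]: "defect \<theta> \<sigma> \<in> H"
  by (auto simp: defect_def)

text \<open>
The vectors \<open>K 0\<close> and \<open>K 1\<close> are the functions \<open>exp (-x)\<close> and \<open>exp (x - 1)\<close> that span the deficiency
spaces. For \<open>\<sigma> = 1\<close> their combination \<open>defect\<close> is the one adjoined to the domain, and for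
\<open>\<sigma> = -1\<close> it is, up to the factor \<open>i\<close>, the image.
\<close>

lemma A_op_iff:
  "(u, v) \<in> A_op \<theta> \<longleftrightarrow> (\<exists>h k c. (h, k) \<in> D_closure \<and> u = h + cscale c (defect \<theta> 1) \<and>
     v = cscale (- \<i>) k + cscale (\<i> * c) (defect \<theta> (-1)))"
proof -
  have "on01 (\<lambda>x. exp (- of_real x) + cis \<theta> * exp (of_real x - 1)) = defect \<theta> 1"
    "on01 (\<lambda>x. exp (- of_real x) - cis \<theta> * exp (of_real x - 1)) = defect \<theta> (-1)"
    by (auto simp: defect_def K_0 K_1 on01_def cscale_def fun_eq_iff)
  then show ?thesis unfolding A_op_def by auto
qed

lemma A_opI:
  "(h, k) \<in> D_closure \<Longrightarrow> (h + cscale c (defect \<theta> 1), cscale (- \<i>) k + cscale (\<i> * c) (defect \<theta> (-1))) \<in> A_op \<theta>"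
  unfolding A_op_iff by blast

lemma A_op_sub: "A_op \<theta> \<subseteq> H \<times> H"
proof clarify
  fix u v assume "(u, v) \<in> A_op \<theta>"
  then obtain h k c where "(h, k) \<in> D_closure" "u = h + cscale c (defect \<theta> 1)"
    "v = cscale (- \<i>) k + cscale (\<i> * c) (defect \<theta> (-1))" unfolding A_op_iff by blast
  then show "u \<in> H \<and> v \<in> H" using D_closure_sub[of h k] by auto
qed

lemma A_op_add:
  assumes "(u, v) \<in> A_op \<theta>" "(u', v') \<in> A_op \<theta>"
  shows "(u + u', v + v') \<in> A_op \<theta>"
proof -
  obtain h k c where 1: "(h, k) \<in> D_closure" "u = h + cscale c (defect \<theta> 1)"
    "v = cscale (- \<i>) k + cscale (\<i> * c) (defect \<theta> (-1))" using assms(1) unfolding A_op_iff by blast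
  obtain h' k' c' where 2: "(h', k') \<in> D_closure" "u' = h' + cscale c' (defect \<theta> 1)"
    "v' = cscale (- \<i>) k' + cscale (\<i> * c') (defect \<theta> (-1))" using assms(2) unfolding A_op_iff by blast
  have "(h + h', k + k') \<in> D_closure"
    by (rule E.H.op_closure_add[OF D_op_sub D_op_add 1(1) 2(1)])
  from A_opI[OF this, of "c + c'"] show ?thesis
    by (simp add: 1 2 cscale_def fun_eq_iff plus_fun_def algebra_simps)
qed

lemma A_op_scale:
  assumes "(u, v) \<in> A_op \<theta>"
  shows "(cscale a u, cscale a v) \<in> A_op \<theta>"
proof -
  obtain h k c where 1: "(h, k) \<in> D_closure" "u = h + cscale c (defect \<theta> 1)"
    "v = cscale (- \<i>) k + cscale (\<i> * c) (defect \<theta> (-1))" using assms(1) unfolding A_op_iff by blast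
  have "(cscale a h, cscale a k) \<in> D_closure"
    by (rule E.H.op_closure_scale[OF D_op_sub D_op_scale 1(1)])
  from A_opI[OF this, of "a * c"] show ?thesis
    by (simp add: 1 cscale_def fun_eq_iff plus_fun_def algebra_simps)
qed

lemma inner_K_0_K_0: "inner_H (E.K 0) (E.K 0) = 1"
  using inner_K_0_expo[of "-1"] K_0_in by (simp add: K_0_eq_expo)

text \<open>
The coefficient \<open>c\<close> is a continuous functional on the graph: pairing with \<open>K 0\<close> takes the value
at 0, and \<open>h\<close> and \<open>k\<close> have the same value there, so the chosen combination cancels them.
\<close>

lemma A_op_coefficient:
  assumes hk: "(h, k) \<in> D_closure" and u: "u = h + cscale c (defect \<theta> 1)"
    and v: "v = cscale (- \<i>) k + cscale (\<i> * c) (defect \<theta> (-1))"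
  shows "c = (inner_H (E.K 0) u - \<i> * inner_H (E.K 0) v) / 2"
proof -
  have hkV: "h \<in> H" "k \<in> H" using D_closure_sub[OF hk] by auto
  have "inner_H (E.K 0) k = inner_H (E.K 0) h"
    using D_closure_expo[OF hk, of "-1"] K_0_in by (simp add: K_0_eq_expo)
  moreover have "inner_H (E.K 0) (defect \<theta> 1) + inner_H (E.K 0) (defect \<theta> (-1)) = 2"
    by (simp add: defect_def E.H.ip_simps inner_K_0_K_0)
  moreover have "inner_H (E.K 0) u - \<i> * inner_H (E.K 0) v = inner_H (E.K 0) h - inner_H (E.K 0) k
      + c * (inner_H (E.K 0) (defect \<theta> 1) + inner_H (E.K 0) (defect \<theta> (-1)))"
    using hkV by (simp add: u v E.H.ip_simps algebra_simps)
  ultimately show ?thesis by simp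
qed

text \<open>
The coefficients converge by \<open>A_op_coefficient\<close>; subtracting the adjoined part leaves
a convergent sequence in the closed graph of the closure of \<open>D_F\<close>.
\<close>

lemma A_op_closed:
  assumes st: "\<And>n. (s n, t n) \<in> A_op \<theta>" and uv: "u \<in> H" "v \<in> H"
    and lim: "E.H.tends_to s u" "E.H.tends_to t v"
  shows "(u, v) \<in> A_op \<theta>"
proof -
  have stV: "s n \<in> H" "t n \<in> H" for n using st[of n] A_op_sub by auto
  define c where "c n = (inner_H (E.K 0) (s n) - \<i> * inner_H (E.K 0) (t n)) / 2" for n
  define c0 where "c0 = (inner_H (E.K 0) u - \<i> * inner_H (E.K 0) v) / 2"
  have c: "c \<longlonglongrightarrow> c0"
    unfolding c_def c0_def by (intro tendsto_intros E.H.ip_tendsto_right) (use uv stV lim in auto)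
  define h where "h n = s n + cscale (- c n) (defect \<theta> 1)" for n
  define k where "k n = cscale \<i> (t n) + cscale (c n) (defect \<theta> (-1))" for n
  have hk: "(h n, k n) \<in> D_closure" for n
  proof -
    obtain h' k' c' where 1: "(h', k') \<in> D_closure" "s n = h' + cscale c' (defect \<theta> 1)"
      "t n = cscale (- \<i>) k' + cscale (\<i> * c') (defect \<theta> (-1))" using st[of n] unfolding A_op_iff by blast
    have "c' = c n" unfolding c_def by (rule A_op_coefficient[OF 1])
    then have "h n = h'" "k n = k'"
      by (simp_all add: h_def k_def 1(2,3) cscale_def fun_eq_iff algebra_simps)
    then show ?thesis using 1(1) by simp
  qed
  define h0 where "h0 = u + cscale (- c0) (defect \<theta> 1)"
  define k0 where "k0 = cscale \<i> v + cscale c0 (defect \<theta> (-1))"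
  have "(h0, k0) \<in> D_closure"
  proof (rule E.H.op_closure_closed[OF D_op_sub hk])
    show "E.H.tends_to h h0"
      unfolding h_def h0_def using stV uv lim c
      by (intro E.H.nrm_add_tendsto E.H.nrm_scale_tendsto tendsto_minus) auto
    show "E.H.tends_to k k0"
      unfolding k_def k0_def using stV uv lim c
      by (intro E.H.nrm_add_tendsto E.H.nrm_scale_tendsto) auto
  qed (use uv in \<open>auto simp: h0_def k0_def\<close>)
  from A_opI[OF this, of c0 \<theta>] show ?thesis
    by (simp add: h0_def k0_def cscale_def fun_eq_iff plus_fun_def algebra_simps)
qed

lemma A_op_zero: "(0, 0) \<in> A_op \<theta>"
proof -
  have "smooth (\<lambda>x. 0 * exp (0 * of_real x))" by (rule smooth_exp)
  from A_op_scale[OF A_opI[OF smooth_in_D_closure[OF this]], of 0] show ?thesis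
    by (simp add: cscale_def zero_fun_def)
qed

lemma roots_iff: "l \<in> boundary_roots \<theta> \<longleftrightarrow> cnj (coef l) * cis l = coef l * cis \<theta>"
proof -
  have "1 + \<i> * of_real l = 2 * cnj (coef l)" "1 - \<i> * of_real l = 2 * coef l" by (simp_all add: coef_def)
  then show ?thesis unfolding boundary_roots_def mem_Collect_eq by (simp add: mult.commute)
qed

text \<open>
In the decomposition of \<open>e_fun l\<close> the coefficients of \<open>K 0\<close> and \<open>K 1\<close> are \<open>coef l\<close> and
\<open>cnj (coef l) * cis l\<close>. The boundary condition says precisely that they are in the ratio
\<open>1 : cis \<theta>\<close> prescribed by the domain of \<open>A_op \<theta>\<close>.
\<close>

lemma e_fun_eigenvector:
  assumes l: "l \<in> boundary_roots \<theta>"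
  shows "(e_fun l, cscale (of_real l) (e_fun l)) \<in> A_op \<theta>"
proof -
  define a where "a = coef l"
  have root: "cnj a * cis l = a * cis \<theta>" using l by (simp add: roots_iff a_def)
  have "smooth (wave l)" unfolding wave_def[abs_def] by (rule smooth_exp)
  from A_opI[OF smooth_in_D_closure[OF this], of a \<theta>]
  have mem: "(conv (wave l) + cscale a (defect \<theta> 1),
    cscale (- \<i>) (on01 (\<lambda>x. right_part (wave l) x - left_part (wave l) x)) + cscale (\<i> * a) (defect \<theta> (-1))) \<in> A_op \<theta>" .
  have "conv (wave l) + cscale a (defect \<theta> 1) = e_fun l"
    unfolding e_fun_decomposition a_def[symmetric] root
    by (simp add: defect_def cscale_def fun_eq_iff algebra_simps)
  moreover have "cscale (- \<i>) (on01 (\<lambda>x. right_part (wave l) x - left_part (wave l) x)) + cscale (\<i> * a) (defect \<theta> (-1))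
    = cscale (of_real l) (e_fun l)"
  proof
    fix x
    show "(cscale (- \<i>) (on01 (\<lambda>x. right_part (wave l) x - left_part (wave l) x)) + cscale (\<i> * a) (defect \<theta> (-1))) x
      = cscale (of_real l) (e_fun l) x"
    proof (cases "x \<in> {0<..<1}")
      case True
      define E1 :: complex where "E1 = exp (of_real x - 1)"
      define E0 :: complex where "E0 = exp (- of_real x)"
      define w where "w = exp (\<i> * of_real l * of_real x)"
      have il: "cnj a - a = \<i> * of_real l" by (simp add: a_def coef_def add_divide_distrib diff_divide_distrib)
      have "- \<i> * (cnj a * (w - cis l * E1) - a * (w - E0)) + \<i> * a * (E0 - cis \<theta> * E1)
        = - \<i> * ((cnj a - a) * w) + \<i> * E1 * (cnj a * cis l - a * cis \<theta>)"
        by (simp add: algebra_simps)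
      also have "\<dots> = of_real l * w" by (simp add: il root mult.assoc[symmetric])
      finally show ?thesis
        using True wave_parts[of x l]
        by (simp add: cscale_def on01_def e_fun_def defect_def K_0 K_1 a_def E1_def E0_def w_def)
    next
      case False
      then show ?thesis by (auto simp: cscale_def on01_def e_fun_def defect_def K_0 K_1)
    qed
  qed
  ultimately show ?thesis using mem by simp
qed

text \<open>
On the closure of \<open>D_F\<close> this is \<open>D_closure_expo\<close>. On the adjoined vector it is the identity
\<open>i (1 - t) = l (1 + t)\<close> for \<open>t = cis (\<theta> - l)\<close>, which rewrites the boundary condition.
\<close>

lemma A_op_symmetric_on_e_fun:
  assumes l: "l \<in> boundary_roots \<theta>" and uv: "(u, v) \<in> A_op \<theta>"
  shows "inner_H (e_fun l) v = of_real l * inner_H (e_fun l) u"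
proof -
  obtain h k c where 1: "(h, k) \<in> D_closure" "u = h + cscale c (defect \<theta> 1)"
    "v = cscale (- \<i>) k + cscale (\<i> * c) (defect \<theta> (-1))" using uv unfolding A_op_iff by blast
  have hkV: "h \<in> H" "k \<in> H" using D_closure_sub[OF 1(1)] by auto
  have k: "inner_H (e_fun l) k = \<i> * of_real l * inner_H (e_fun l) h"
    using D_closure_expo[OF 1(1), of "\<i> * of_real l"] e_fun_in[of l] by (simp add: e_fun_eq_expo)
  have K: "inner_H (e_fun l) (E.K 0) = 1" "inner_H (e_fun l) (E.K 1) = cis (- l)"
    using inner_K_0_expo inner_K_1_expo e_fun_in[of l] E.H.ip_cnj[of "E.K 0" "e_fun l"] E.H.ip_cnj[of "E.K 1" "e_fun l"]
    by (simp_all add: e_fun_eq_expo cis_cnj flip: cis_conv_exp)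
  define t where "t = cis \<theta> * cis (- l)"
  have "t * (1 - \<i> * of_real l) = (cis \<theta> * (1 - \<i> * of_real l)) * cis (- l)"
    by (simp only: t_def mult_ac)
  also have "\<dots> = (cis l * (1 + \<i> * of_real l)) * cis (- l)" using l by (simp add: boundary_roots_def)
  also have "\<dots> = (cis l * cis (- l)) * (1 + \<i> * of_real l)" by (simp only: mult_ac)
  also have "cis l * cis (- l) = 1" by (simp add: cis_mult)
  finally have "1 + \<i> * of_real l = t * (1 - \<i> * of_real l)" by simp
  then have "\<i> * (1 + \<i> * of_real l) = \<i> * (t * (1 - \<i> * of_real l))" by simp
  then have t: "\<i> * (1 - t) = of_real l * (1 + t)"
    by (simp add: algebra_simps)
  have "inner_H (e_fun l) v = of_real l * inner_H (e_fun l) h + c * (\<i> * (1 - t))"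
    using hkV by (simp add: 1 E.H.ip_simps k K defect_def t_def algebra_simps)
  also have "\<dots> = of_real l * inner_H (e_fun l) u"
    unfolding t using hkV by (simp add: 1 E.H.ip_simps K defect_def t_def algebra_simps)
  finally show ?thesis .
qed

section \<open>Completeness and the spectrum\<close>

definition unit_e :: "real \<Rightarrow> real \<Rightarrow> complex" where
  "unit_e l = cscale (of_real (sqrt (2 / (l\<^sup>2 + 3)))) (e_fun l)"

lemma unit_e_in [simp]: "unit_e l \<in> H"
  by (simp add: unit_e_def)

lemma sqrt_factor_sq: "(sqrt (2 / (l\<^sup>2 + 3)))\<^sup>2 = 2 / (l\<^sup>2 + 3)"
  by simp

lemma norm_unit_e: "norm_H (unit_e l) = 1"
proof -
  have pos: "l\<^sup>2 + 3 > 0" by (simp add: add_nonneg_pos)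
  have "norm_H (unit_e l) = sqrt (2 / (l\<^sup>2 + 3)) * norm_H (e_fun l)"
    by (simp add: unit_e_def E.H.nrm_scale)
  then have "(norm_H (unit_e l))\<^sup>2 = 2 / (l\<^sup>2 + 3) * ((l\<^sup>2 + 3) / 2)"
    by (simp only: power_mult_distrib sqrt_factor_sq norm_e_fun)
  also have "\<dots> = 1\<^sup>2" using pos by simp
  finally show ?thesis by (rule power2_eq_imp_eq) simp_all
qed

lemma cmod_inner_unit_e_K:
  assumes "x \<in> {0<..<1}"
  shows "(cmod (inner_H (unit_e l) (E.K x)))\<^sup>2 = 2 / (l\<^sup>2 + 3)"
proof -
  have "inner_H (unit_e l) (E.K x) = cnj (unit_e l x)"
    using E.H.ip_cnj[of "E.K x" "unit_e l"] assms by (simp add: E.reproducing)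
  moreover have "cmod (exp (\<i> * of_real l * of_real x)) = 1"
    using norm_exp_i_times[of "l * x"] by (simp add: mult.assoc)
  ultimately show ?thesis
    using assms by (simp add: unit_e_def cscale_def e_fun_def on01_def norm_mult)
qed

lemma unit_e_eigenvector:
  assumes "l \<in> boundary_roots \<theta>"
  shows "(unit_e l, cscale (of_real l) (unit_e l)) \<in> A_op \<theta>"
  using A_op_scale[OF e_fun_eigenvector[OF assms], of "of_real (sqrt (2 / (l\<^sup>2 + 3)))"] by (simp add: unit_e_def cscale_def mult.left_commute)

lemma A_op_symmetric_on_unit_e:
  assumes "l \<in> boundary_roots \<theta>" "(u, v) \<in> A_op \<theta>"
  shows "inner_H (unit_e l) v = of_real l * inner_H (unit_e l) u"
proof -
  have "u \<in> H" "v \<in> H" using assms(2) A_op_sub by auto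
  then show ?thesis
    using A_op_symmetric_on_e_fun[OF assms] by (simp add: unit_e_def E.H.ip_scale_left mult.left_commute)
qed

lemma unit_e_orthonormal: "E.H.orthonormal (unit_e ` boundary_roots \<theta>)" "inj_on unit_e (boundary_roots \<theta>)"
  using E.H.eigenvectors_orthonormal[of "A_op \<theta>" "boundary_roots \<theta>" unit_e]
    A_op_sub unit_e_eigenvector norm_unit_e A_op_symmetric_on_unit_e by blast+

text \<open>
The \<open>2 M + 1\<close> solutions of the boundary condition with phases \<open>\<theta> + 2 \<pi> n\<close>, \<open>|n| \<le> M\<close>; the index is shifted by \<open>M\<close> to run
through the natural numbers.
\<close>

definition root_window :: "real \<Rightarrow> nat \<Rightarrow> real set" where
  "root_window \<theta> M = (\<lambda>n. phase_inv (\<theta> + 2 * pi * (real n - real M))) ` {..<2 * M + 1}"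

lemma root_window: "root_window \<theta> M \<subseteq> boundary_roots \<theta>" "finite (root_window \<theta> M)"
  unfolding root_window_def by (auto intro!: phase_inv_in_roots)

lemma root_window_sum:
  assumes "x \<in> {0<..<1}"
  shows "(\<Sum>u\<in>unit_e ` root_window \<theta> M. (cmod (inner_H u (E.K x)))\<^sup>2) = weight_sum M \<theta>"
proof -
  have inj: "inj_on unit_e (root_window \<theta> M)"
    using unit_e_orthonormal(2) root_window(1) by (rule inj_on_subset)
  have inj': "inj_on (\<lambda>n. phase_inv (\<theta> + 2 * pi * (real n - real M))) {..<2 * M + 1}"
    by (auto simp: inj_on_def phase_inv_inj)
  have "(\<Sum>u\<in>unit_e ` root_window \<theta> M. (cmod (inner_H u (E.K x)))\<^sup>2) = (\<Sum>l\<in>root_window \<theta> M. 2 / (l\<^sup>2 + 3))"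
    using assms by (simp add: sum.reindex[OF inj] cmod_inner_unit_e_K)
  also have "\<dots> = weight_sum M \<theta>"
    unfolding root_window_def weight_sum_def weight_def sum.reindex[OF inj'] o_def ..
  finally show ?thesis .
qed

text \<open>
Bessel's inequality for the unit vector \<open>K (1 / 2)\<close>. It holds for the eigenvectors of every
\<open>\<theta>\<close>, as the averaging in \<open>weight_sum_tendsto_one\<close> requires.
\<close>

lemma weight_sum_le_1: "weight_sum M \<theta> \<le> 1"
proof -
  have half: "(1 / 2 :: real) \<in> {0<..<1}" by simp
  have "(\<Sum>u\<in>unit_e ` root_window \<theta> M. (cmod (inner_H u (E.K (1 / 2))))\<^sup>2) \<le> (norm_H (E.K (1 / 2)))\<^sup>2"
    using root_window unit_e_orthonormal(1) half
    by (intro E.H.Bessel finite_imageI E.H.orthonormal_subset[OF unit_e_orthonormal(1)] image_mono E.K_in) auto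
  then show ?thesis unfolding root_window_sum[OF half] norm_K[OF half] by simp
qed

text \<open>
The distance from \<open>K x\<close> to the span of a window of eigenvectors is \<open>sqrt (1 - weight_sum M \<theta>)\<close>,
which becomes arbitrarily small.
\<close>

lemma unit_e_dense: "H \<subseteq> E.H.closed_span (unit_e ` boundary_roots \<theta>)"
proof (rule E.kernels_dense)
  show "unit_e ` boundary_roots \<theta> \<subseteq> H" by auto
  fix x :: real assume x: "x \<in> {0<..<1}"
  show "E.K x \<in> E.H.closed_span (unit_e ` boundary_roots \<theta>)"
    unfolding E.H.closed_span_def
  proof (intro CollectI conjI allI impI)
    show "E.K x \<in> H" using x by simp
    fix e :: real assume e: "e > 0"
    obtain M where M: "weight_sum M \<theta> > 1 - e\<^sup>2"
      using weight_sum_tendsto_one[OF weight_sum_le_1, of "e\<^sup>2" \<theta>] e by auto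
    define T where "T = unit_e ` root_window \<theta> M"
    have T: "finite T" "T \<subseteq> unit_e ` boundary_roots \<theta>" using root_window by (auto simp: T_def)
    have on: "E.H.orthonormal T" using unit_e_orthonormal(1) T(2) by (rule E.H.orthonormal_subset)
    have "(norm_H (E.K x - E.H.proj T (E.K x)))\<^sup>2 = 1 - weight_sum M \<theta>"
      using E.H.nrm_residual[OF T(1) on, of "E.K x"] x root_window_sum[OF x] by (simp add: norm_K T_def)
    then have "(norm_H (E.K x - E.H.proj T (E.K x)))\<^sup>2 < e\<^sup>2" using M by simp
    then have "norm_H (E.K x - E.H.proj T (E.K x)) < e" using e by (simp add: power_less_imp_less_base)
    moreover have "E.H.proj T (E.K x) \<in> module.span cscale (unit_e ` boundary_roots \<theta>)"
      unfolding E.H.proj_def using T(2) by (intro E.H.span_sum E.H.span_scale E.H.span_base) auto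
    ultimately show "\<exists>s\<in>module.span cscale (unit_e ` boundary_roots \<theta>). norm_H (E.K x - s) < e" by blast
  qed
qed

lemma closed_roots: "closed (boundary_roots \<theta>)"
  unfolding boundary_roots_def by (intro closed_Collect_eq continuous_intros)

theorem spectrum_A_op: "op_spectrum H inner_H (A_op \<theta>) = complex_of_real ` boundary_roots \<theta>"
proof (rule E.H.spectrum_of_eigenbasis[where e = unit_e])
  show "(u, v) \<in> A_op \<theta>"
    if "\<And>n. (s n, t n) \<in> A_op \<theta>" "u \<in> H" "v \<in> H"
      "E.H.tends_to s u" "E.H.tends_to t v" for s t u v
    using that by (rule A_op_closed)
qed (rule A_op_sub A_op_zero A_op_add A_op_scale unit_e_eigenvector norm_unit_e
      A_op_symmetric_on_unit_e unit_e_dense closed_roots; assumption)+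

theorem corollary5p35:
  fixes \<theta> :: real
  assumes "0 \<le> \<theta>" and "\<theta> < 2 * pi"
  shows "op_spectrum (rkhs exp_kernel) (rkhs_inner exp_kernel) (A_op \<theta>) \<subseteq> \<real> \<and>
    orthonormal_basis (rkhs exp_kernel) (rkhs_inner exp_kernel)
      {cscale (complex_of_real (sqrt (2 / (l\<^sup>2 + 3)))) (e_fun l) | l :: real.
        complex_of_real l \<in> op_spectrum (rkhs exp_kernel) (rkhs_inner exp_kernel) (A_op \<theta>)}"
proof
  show "op_spectrum H inner_H (A_op \<theta>) \<subseteq> \<real>"
    by (auto simp: spectrum_A_op)
  have "{cscale (complex_of_real (sqrt (2 / (l\<^sup>2 + 3)))) (e_fun l) | l :: real.
        complex_of_real l \<in> op_spectrum H inner_H (A_op \<theta>)} = unit_e ` boundary_roots \<theta>"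
    unfolding spectrum_A_op unit_e_def by (auto simp: image_iff)
  then show "orthonormal_basis H inner_H {cscale (complex_of_real (sqrt (2 / (l\<^sup>2 + 3)))) (e_fun l) | l :: real.
        complex_of_real l \<in> op_spectrum H inner_H (A_op \<theta>)}"
    using unit_e_orthonormal(1) unit_e_dense by (simp add: E.H.orthonormal_basis_iff)
qed

end
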